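(* Let $p>0$ and $q>0$ be the parameters of the DCS-RJMin algorithm described in the context, applied to the problem $\eta u-\Delta u=f$ in $\Omega$, $u=0$ on $\partial\Omega$, with subdomains $\Omega_1,\dots,\Omega_N$ and coarse space $X_d$. If $q=p$, then the iterates produced by the DCS-RJMin algorithm satisfy, for every $i\in\{1,\dots,N\}$, $$\lim_{n\to+\infty}\bigl\lVert u_i^{n+1/2}-u_i^{n}\bigr\rVert_{L^2(\Omega_i)}=0 .$$
   Context: **Problem.** $\Omega\subset\mathbb{R}^2$ is a (bounded, connected) polygonal domain, $\eta\ge 0$ is a constant, and $f\in L^2(\Omega)$. The problem to be solved is $\eta u-\Delta u=f$ in $\Omega$, $u=0$ on $\partial\Omega$. **Domain decomposition.** $\Omega$ is meshed by a coarse triangular or cartesian mesh, and the cells $\Omega_1,\dots,\Omega_N$ of this mesh are the (non-overlapping) subdomains. $\bm{\nu}_i$ is the outward unit normal to $\Omega_i$, and $\mathcal{N}(i)$ is the set of all $j$ such that $\Omega_j$ and $\Omega_i$ are adjacent (share an edge $\partial\Omega_i\cap\partial\Omega_j$). For a function $v$ on $\Omega$ that may be discontinuous across the interfaces, $v_i$ denotes its restriction to $\Omega_i$. Traces and normal derivatives of $v_i$ on $\partial\Omega_i$ are taken from inside $\Omega_i$. **Coarse space.** $\mathcal{A}$ is the set of all functions $v$ on $\Omega$, possibly discontinuous across the interfaces between subdomains, whose restriction $v_i\in H^1(\Omega_i)$ to each subdomain solves the homogeneous problem: $\eta v_i-\Delta v_i=0$ in $\Omega_i$ and $v_i=0$ on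 $\partial\Omega_i\cap\partial\Omega$. $X_d$ is a finite-dimensional linear subspace of $\mathcal{A}$, whose elements have normal derivatives in $L^2$ on the interfaces, so that the minimization below makes sense. **DCS-RJMin algorithm** (Discontinuous Coarse Space Robin Jump Minimizer), with parameters $p>0$, $q>0$ and $X_d$: 1. Set $u^0$ to either the null function or the coarse space solution (a function belonging to $X_d$). 2. For $n=0,1,2,\dots$: (a) For each $i$, let $u_i^{n+1/2}\in H^1(\Omega_i)$ be the unique solution of $$\eta u_i^{n+1/2}-\Delta u_i^{n+1/2}=f \ \text{ in } \Omega_i,$$ $$\frac{\partial u_i^{n+1/2}}{\partial\bm{\nu}_i}+p\,u_i^{n+1/2}=\frac{\partial u_j^{n}}{\partial\bm{\nu}_i}+p\,u_j^{n}\ \text{ on } \partial\Omega_i\cap\partial\Omega_j \text{ for all } j\in\mathcal{N}(i),$$ $$u_i^{n+1/2}=0\ \text{ on } \partial\Omega_i\cap\partial\Omega .$$ (b) Let $U^{n+1}\in X_d$ be the unique coarse function that minimizes, over $X_d$, $$\sum_{i=1}^N\sum_{j\in\mathcal{N}(i)}\left\lVert \frac{\partial(u_i^{n+1/2}+U_i^{n+1})}{\partial\bm{\nu}_i}+q(u_i^{n+1/2}+U_i^{n+1})-\frac{\partial(u_j^{n+1/2}+U_j^{n+1})}{\partial\bm{\nu}_i}-q(u_j^{n+1/2}+U_j^{n+1})\right\rVert^2_{L^2(\partial\Omega_i\cap\partial\Omega_j)} .$$ (c) Set $u^{n+1}:=u^{n+1/2}+U^{n+1}$. *)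

theory Defs
  imports "HOL-Analysis.Analysis"
begin

section \<open>Square-integrable functions\<close>

text \<open>Elements of function spaces are represented by functions, not by classes modulo null sets.
  \<open>D\<close> always stands for an open set; \<open>lebesgue_on D\<close> ignores the values of a function outside \<open>D\<close>.\<close>

definition L2 :: "'a measure \<Rightarrow> ('a \<Rightarrow> 'b::real_normed_vector) \<Rightarrow> bool" where
  "L2 M f \<longleftrightarrow> f \<in> borel_measurable M \<and> integrable M (\<lambda>x. (norm (f x))\<^sup>2)"

definition L2_norm :: "'a measure \<Rightarrow> ('a \<Rightarrow> 'b::real_normed_vector) \<Rightarrow> real" where
  "L2_norm M f = sqrt (LINT x|M. (norm (f x))\<^sup>2)"

text \<open>Arc length on a nondegenerate segment \<open>e\<close>. The segment determines its endpoints up to order,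
  and the measure does not depend on the order.\<close>

definition edge_measure :: "(real^2) set \<Rightarrow> (real^2) measure" where
  "edge_measure e =
     (let (a, b) = (SOME (a, b). e = closed_segment a b)
      in distr (restrict_space lborel {0..dist a b}) borel (\<lambda>t. a + (t / dist a b) *\<^sub>R (b - a)))"

section \<open>Weak derivatives and traces\<close>

definition C1_with_gradient :: "(real^2 \<Rightarrow> real) \<Rightarrow> (real^2 \<Rightarrow> real^2) \<Rightarrow> bool" where
  "C1_with_gradient \<phi> g \<longleftrightarrow> (\<forall>x. GDERIV \<phi> x :> g x) \<and> continuous_on UNIV g"

text \<open>The test functions are the compactly supported \<open>C\<^sup>1\<close> functions.\<close>

definition test_function :: "(real^2) set \<Rightarrow> (real^2 \<Rightarrow> real) \<Rightarrow> (real^2 \<Rightarrow> real^2) \<Rightarrow> bool" where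
  "test_function D \<phi> g \<longleftrightarrow> C1_with_gradient \<phi> g \<and>
     compact (closure {x. \<phi> x \<noteq> 0}) \<and> closure {x. \<phi> x \<noteq> 0} \<subseteq> D"

text \<open>\<open>v \<in> H\<^sup>1(D)\<close> with weak gradient \<open>G\<close>.\<close>

definition H1_with_gradient ::
    "(real^2) set \<Rightarrow> (real^2 \<Rightarrow> real) \<Rightarrow> (real^2 \<Rightarrow> real^2) \<Rightarrow> bool" where
  "H1_with_gradient D v G \<longleftrightarrow> L2 (lebesgue_on D) v \<and> L2 (lebesgue_on D) G \<and>
     (\<forall>\<phi> g. test_function D \<phi> g \<longrightarrow>
        (LINT x|lebesgue_on D. v x *\<^sub>R g x) = - (LINT x|lebesgue_on D. \<phi> x *\<^sub>R G x))"

definition H1 :: "(real^2) set \<Rightarrow> (real^2 \<Rightarrow> real) \<Rightarrow> bool" where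
  "H1 D v \<longleftrightarrow> (\<exists>G. H1_with_gradient D v G)"

text \<open>\<open>v \<in> H\<^sup>1(D)\<close> and \<open>\<Delta> v = l \<in> L\<^sup>2(D)\<close> in the sense of distributions.\<close>

definition has_weak_laplacian ::
    "(real^2) set \<Rightarrow> (real^2 \<Rightarrow> real) \<Rightarrow> (real^2 \<Rightarrow> real) \<Rightarrow> bool" where
  "has_weak_laplacian D v l \<longleftrightarrow> L2 (lebesgue_on D) l \<and>
     (\<exists>G. H1_with_gradient D v G \<and>
        (\<forall>\<phi> g. test_function D \<phi> g \<longrightarrow>
           (LINT x|lebesgue_on D. G x \<bullet> g x) = - (LINT x|lebesgue_on D. l x * \<phi> x)))"

text \<open>\<open>\<eta> v - \<Delta> v = f\<close> in \<open>D\<close>, for \<open>v \<in> H\<^sup>1(D)\<close> and \<open>f \<in> L\<^sup>2(D)\<close>.\<close>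

definition solves_pde ::
    "real \<Rightarrow> (real^2) set \<Rightarrow> (real^2 \<Rightarrow> real) \<Rightarrow> (real^2 \<Rightarrow> real) \<Rightarrow> bool" where
  "solves_pde \<eta> D f v \<longleftrightarrow>
     (\<exists>l. has_weak_laplacian D v l \<and> (AE x in lebesgue_on D. \<eta> * v x - l x = f x))"

text \<open>For a convex polygon \<open>D\<close>, the trace operator is the continuous extension to \<open>H\<^sup>1(D)\<close> of the
  restriction to the boundary of \<open>C\<^sup>1\<close> functions; \<open>g\<close> matters only on the edges of \<open>D\<close>.\<close>

definition has_trace :: "(real^2) set \<Rightarrow> (real^2 \<Rightarrow> real) \<Rightarrow> (real^2 \<Rightarrow> real) \<Rightarrow> bool" where
  "has_trace D v g \<longleftrightarrow> (\<forall>e. e edge_of closure D \<longrightarrow> L2 (edge_measure e) g) \<and>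
     (\<exists>G \<phi> \<gamma>. H1_with_gradient D v G \<and> (\<forall>n::nat. C1_with_gradient (\<phi> n) (\<gamma> n)) \<and>
        (\<lambda>n. L2_norm (lebesgue_on D) (\<lambda>x. \<phi> n x - v x)) \<longlonglongrightarrow> 0 \<and>
        (\<lambda>n. L2_norm (lebesgue_on D) (\<lambda>x. \<gamma> n x - G x)) \<longlonglongrightarrow> 0 \<and>
        (\<forall>e. e edge_of closure D \<longrightarrow>
           (\<lambda>n. L2_norm (edge_measure e) (\<lambda>x. \<phi> n x - g x)) \<longlonglongrightarrow> 0))"

definition trace :: "(real^2) set \<Rightarrow> (real^2 \<Rightarrow> real) \<Rightarrow> real^2 \<Rightarrow> real" where
  "trace D v = (SOME g. has_trace D v g)"

definition vanishes_on :: "(real^2) set \<Rightarrow> (real^2) set \<Rightarrow> (real^2 \<Rightarrow> real) \<Rightarrow> bool" where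
  "vanishes_on D S v \<longleftrightarrow> (\<exists>g. has_trace D v g \<and>
     (\<forall>e. e edge_of closure D \<longrightarrow> (AE x in edge_measure e. x \<in> S \<longrightarrow> g x = 0)))"

text \<open>\<open>h\<close> is the outward normal derivative of \<open>v\<close> on the part \<open>\<Gamma>\<close> (a union of edges) of the boundary
  of the convex polygon \<open>D\<close>, as a square-integrable function, in the sense of Green's formula
  \[ \int_D \nabla v \cdot \nabla w + \int_D (\Delta v) w = \int_\Gamma h w \]
  for all \<open>w \<in> H\<^sup>1(D)\<close> with vanishing trace on the rest of the boundary.\<close>

definition has_normal_derivative ::
    "(real^2) set \<Rightarrow> (real^2) set \<Rightarrow> (real^2 \<Rightarrow> real) \<Rightarrow> (real^2 \<Rightarrow> real) \<Rightarrow> bool" where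
  "has_normal_derivative D \<Gamma> v h \<longleftrightarrow>
     (\<forall>e. e edge_of closure D \<and> e \<subseteq> \<Gamma> \<longrightarrow> L2 (edge_measure e) h) \<and>
     (\<exists>G l. H1_with_gradient D v G \<and> has_weak_laplacian D v l \<and>
        (\<forall>w W. H1_with_gradient D w W \<and> vanishes_on D (frontier D - \<Gamma>) w \<longrightarrow>
           (LINT x|lebesgue_on D. G x \<bullet> W x + l x * w x) =
           (\<Sum>e | e edge_of closure D \<and> e \<subseteq> \<Gamma>. LINT x|edge_measure e. h x * trace D w x)))"

definition normal_derivative ::
    "(real^2) set \<Rightarrow> (real^2) set \<Rightarrow> (real^2 \<Rightarrow> real) \<Rightarrow> real^2 \<Rightarrow> real" where
  "normal_derivative D \<Gamma> v = (SOME h. has_normal_derivative D \<Gamma> v h)"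

section \<open>Domain and coarse mesh\<close>

text \<open>The condition \<open>interior (closure \<Omega>) = \<Omega>\<close> excludes slits.\<close>

definition polygonal_domain :: "(real^2) set \<Rightarrow> bool" where
  "polygonal_domain \<Omega> \<longleftrightarrow> open \<Omega> \<and> connected \<Omega> \<and> bounded \<Omega> \<and> \<Omega> \<noteq> {} \<and>
     interior (closure \<Omega>) = \<Omega> \<and>
     (\<exists>S. finite S \<and> frontier \<Omega> = (\<Union>(a, b)\<in>S. closed_segment a b))"

definition triangular_cells :: "nat \<Rightarrow> (nat \<Rightarrow> (real^2) set) \<Rightarrow> bool" where
  "triangular_cells N C \<longleftrightarrow> (\<forall>i\<in>{1..N}. \<exists>T. 2 simplex T \<and> C i = interior T)"

definition cartesian_cells :: "nat \<Rightarrow> (nat \<Rightarrow> (real^2) set) \<Rightarrow> bool" where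
  "cartesian_cells N C \<longleftrightarrow>
     (\<exists>X Y :: nat \<Rightarrow> real. strict_mono X \<and> strict_mono Y \<and>
        (\<forall>i\<in>{1..N}. \<exists>k l. C i = box (vector [X k, Y l]) (vector [X (Suc k), Y (Suc l)])))"

text \<open>The mesh is conforming: the closures of two distinct cells are disjoint or meet in a common
  vertex or a common edge.\<close>

definition coarse_mesh :: "(real^2) set \<Rightarrow> nat \<Rightarrow> (nat \<Rightarrow> (real^2) set) \<Rightarrow> bool" where
  "coarse_mesh \<Omega> N C \<longleftrightarrow>
     closure \<Omega> = (\<Union>i\<in>{1..N}. closure (C i)) \<and>
     (\<forall>i\<in>{1..N}. \<forall>j\<in>{1..N}. i \<noteq> j \<longrightarrow>
        C i \<inter> C j = {} \<and> (closure (C i) \<inter> closure (C j)) face_of closure (C i)) \<and>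
     (triangular_cells N C \<or> cartesian_cells N C)"

definition interface :: "(nat \<Rightarrow> (real^2) set) \<Rightarrow> nat \<Rightarrow> nat \<Rightarrow> (real^2) set" where
  "interface C i j = frontier (C i) \<inter> frontier (C j)"

definition neighbours :: "nat \<Rightarrow> (nat \<Rightarrow> (real^2) set) \<Rightarrow> nat \<Rightarrow> nat set" where
  "neighbours N C i = {j \<in> {1..N}. j \<noteq> i \<and> interface C i j edge_of closure (C i)}"

definition interfaces :: "nat \<Rightarrow> (nat \<Rightarrow> (real^2) set) \<Rightarrow> nat \<Rightarrow> (real^2) set" where
  "interfaces N C i = (\<Union>j\<in>neighbours N C i. interface C i j)"

section \<open>The algorithm\<close>

text \<open>For adjacent cells \<open>i\<close> and \<open>j\<close> with outward unit normals \<open>\<nu>\<^sub>i\<close> and \<open>\<nu>\<^sub>j = - \<nu>\<^sub>i\<close> on their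
  interface, \<open>robin_own N C s i v\<close> is \<open>\<partial>v\<^sub>i/\<partial>\<nu>\<^sub>i + s v\<^sub>i\<close> and \<open>robin_neighbour N C s j v\<close> is
  \<open>\<partial>v\<^sub>j/\<partial>\<nu>\<^sub>i + s v\<^sub>j = - \<partial>v\<^sub>j/\<partial>\<nu>\<^sub>j + s v\<^sub>j\<close>.\<close>

definition robin_own ::
    "nat \<Rightarrow> (nat \<Rightarrow> (real^2) set) \<Rightarrow> real \<Rightarrow> nat \<Rightarrow> (real^2 \<Rightarrow> real) \<Rightarrow> real^2 \<Rightarrow> real" where
  "robin_own N C s i v x =
     normal_derivative (C i) (interfaces N C i) v x + s * trace (C i) v x"

definition robin_neighbour ::
    "nat \<Rightarrow> (nat \<Rightarrow> (real^2) set) \<Rightarrow> real \<Rightarrow> nat \<Rightarrow> (real^2 \<Rightarrow> real) \<Rightarrow> real^2 \<Rightarrow> real" where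
  "robin_neighbour N C s j v x =
     - normal_derivative (C j) (interfaces N C j) v x + s * trace (C j) v x"

text \<open>The space \<open>\<A>\<close>, without any condition on normal derivatives.\<close>

definition homogeneous_solutions ::
    "real \<Rightarrow> (real^2) set \<Rightarrow> nat \<Rightarrow> (nat \<Rightarrow> (real^2) set) \<Rightarrow> (real^2 \<Rightarrow> real) set" where
  "homogeneous_solutions \<eta> \<Omega> N C = {v. \<forall>i\<in>{1..N}.
     H1 (C i) v \<and> solves_pde \<eta> (C i) (\<lambda>x. 0) v \<and>
     vanishes_on (C i) (frontier (C i) \<inter> frontier \<Omega>) v}"

definition finite_dim_subspace :: "(real^2 \<Rightarrow> real) set \<Rightarrow> bool" where
  "finite_dim_subspace V \<longleftrightarrow> (\<exists>B. finite B \<and> V = {\<lambda>x. \<Sum>b\<in>B. c b * b x | c. True})"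

definition coarse_space ::
    "real \<Rightarrow> (real^2) set \<Rightarrow> nat \<Rightarrow> (nat \<Rightarrow> (real^2) set) \<Rightarrow> (real^2 \<Rightarrow> real) set \<Rightarrow> bool" where
  "coarse_space \<eta> \<Omega> N C Xd \<longleftrightarrow>
     finite_dim_subspace Xd \<and> Xd \<subseteq> homogeneous_solutions \<eta> \<Omega> N C \<and>
     (\<forall>v\<in>Xd. \<forall>i\<in>{1..N}. \<exists>h. has_normal_derivative (C i) (interfaces N C i) v h)"

definition robin_step ::
    "real \<Rightarrow> (real^2) set \<Rightarrow> nat \<Rightarrow> (nat \<Rightarrow> (real^2) set) \<Rightarrow> (real^2 \<Rightarrow> real) \<Rightarrow> real \<Rightarrow>
     (real^2 \<Rightarrow> real) \<Rightarrow> (real^2 \<Rightarrow> real) \<Rightarrow> bool" where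
  "robin_step \<eta> \<Omega> N C f p u u' \<longleftrightarrow> (\<forall>i\<in>{1..N}.
     H1 (C i) u' \<and> solves_pde \<eta> (C i) f u' \<and>
     vanishes_on (C i) (frontier (C i) \<inter> frontier \<Omega>) u' \<and>
     (\<exists>h. has_normal_derivative (C i) (interfaces N C i) u' h) \<and>
     (\<forall>j\<in>neighbours N C i. AE x in edge_measure (interface C i j).
        robin_own N C p i u' x = robin_neighbour N C p j u x))"

definition robin_jump ::
    "nat \<Rightarrow> (nat \<Rightarrow> (real^2) set) \<Rightarrow> real \<Rightarrow> (real^2 \<Rightarrow> real) \<Rightarrow> real" where
  "robin_jump N C q v = (\<Sum>i\<in>{1..N}. \<Sum>j\<in>neighbours N C i.
     (L2_norm (edge_measure (interface C i j))
        (\<lambda>x. robin_own N C q i v x - robin_neighbour N C q j v x))\<^sup>2)"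

text \<open>\<open>u n\<close> is \<open>u\<^sup>n\<close>, \<open>uh n\<close> is the half-step iterate \<open>u\<^sup>n\<^sup>+\<^sup>1\<^sup>/\<^sup>2\<close> and \<open>U n\<close> is \<open>U\<^sup>n\<close> (so \<open>U 0\<close> is not used).
  The minimizer is unique up to null sets.\<close>

definition DCS_RJMin ::
    "real \<Rightarrow> (real^2) set \<Rightarrow> nat \<Rightarrow> (nat \<Rightarrow> (real^2) set) \<Rightarrow> (real^2 \<Rightarrow> real) \<Rightarrow> real \<Rightarrow> real \<Rightarrow>
     (real^2 \<Rightarrow> real) set \<Rightarrow> (nat \<Rightarrow> real^2 \<Rightarrow> real) \<Rightarrow> (nat \<Rightarrow> real^2 \<Rightarrow> real) \<Rightarrow>
     (nat \<Rightarrow> real^2 \<Rightarrow> real) \<Rightarrow> bool" where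
  "DCS_RJMin \<eta> \<Omega> N C f p q Xd u uh U \<longleftrightarrow>
     (u 0 = (\<lambda>x. 0) \<or> u 0 \<in> Xd) \<and>
     (\<forall>n. robin_step \<eta> \<Omega> N C f p (u n) (uh n) \<and>
        is_arg_min (\<lambda>V. robin_jump N C q (\<lambda>x. uh n x + V x)) (\<lambda>V. V \<in> Xd) (U (Suc n)) \<and>
        u (Suc n) = (\<lambda>x. uh n x + U (Suc n) x))"

end

theory Submission
  imports Defs
begin

text \<open>For \<open>n \<ge> 1\<close> the difference \<open>w = uh n - u n\<close> solves the homogeneous problem on each cell. By the
  transmission condition its Robin data, seen from the two sides of the interfaces, are minus the Robin
  jumps of \<open>u n\<close> and of \<open>uh n\<close>. As \<open>q = p\<close>, the functional \<open>J\<close> minimized in the coarse step measures the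
  same jumps, so Green's formula gives \<open>J (u n) = J (uh n) + 4 p E(w)\<close>, where \<open>E(w)\<close> is the sum over the cells
  of \<open>\<parallel>\<nabla>w\<parallel>\<^sup>2 + \<eta> \<parallel>w\<parallel>\<^sup>2\<close>. Since \<open>J (u (n + 1)) \<le> J (uh n)\<close>, \<open>E(w)\<close> tends to zero, and so does \<open>J (U (n + 1))\<close>
  because \<open>U (n + 1)\<close> minimizes a quadratic functional over a linear space. As \<open>\<eta>\<close> may vanish, the energy
  controls \<open>w\<close> only up to a constant on each cell. The constant tends to zero on cells with an edge on
  \<open>\<partial>\<Omega>\<close>; testing the transmission condition against a bump function on an interface carries this over to
  neighbouring cells, and every cell is connected to \<open>\<partial>\<Omega>\<close> through interfaces.\<close>

section \<open>Square-integrable functions\<close>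

text \<open>The transmission condition couples consecutive steps: on the interface of cells i and j,
  the own Robin trace of \<open>w (Suc n)\<close> in cell i minus the neighbour trace of
  \<open>w n\<close> in cell j is minus the jump of \<open>U (Suc (Suc n))\<close>. The cell
  constants therefore satisfy c_i(n+1) - c_j(n) -> 0 with a shifted index, which still carries a
  limit from j to i; no rate results. The energy does not bound a normal derivative in L2 of an
  edge, only its integral against a fixed function. This is why one fixed bump is used per
  interface, and why it avoids the other edges: Green's formula then sees that interface alone.
  Traces and normal derivatives are values of \<open>SOME\<close>, so they are linear only almost
  everywhere and only by uniqueness. For traces uniqueness comes from the trace inequality, for
  normal derivatives from the fundamental lemma for arc length. The trace and Poincare inequalities
  are computed for C1 functions and pass to H1 functions along the C1 sequences contained in
  \<open>has_trace\<close>.\<close>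

lemma L2_measurable: "L2 M f \<Longrightarrow> f \<in> borel_measurable M"
  by (simp add: L2_def)

lemma L2_norm_nonneg [simp]: "0 \<le> L2_norm M f"
  by (simp add: L2_norm_def)

lemma L2_norm_square: "(L2_norm M f)\<^sup>2 = (LINT x|M. (norm (f x))\<^sup>2)"
  by (simp add: L2_norm_def)

lemma L2_norm_minus_commute: "L2_norm M (\<lambda>x. f x - g x) = L2_norm M (\<lambda>x. g x - f x)"
  by (simp add: L2_norm_def norm_minus_commute)

lemma integrable_inner_L2:
  fixes f g :: "'a \<Rightarrow> 'b::euclidean_space"
  assumes "L2 M f" "L2 M g"
  shows "integrable M (\<lambda>x. f x \<bullet> g x)"
proof (rule Bochner_Integration.integrable_bound)
  show "integrable M (\<lambda>x. (norm (f x))\<^sup>2 + (norm (g x))\<^sup>2)"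
    using assms by (simp add: L2_def)
  show "(\<lambda>x. f x \<bullet> g x) \<in> borel_measurable M"
    using assms by (auto simp: L2_def)
  have "\<bar>f x \<bullet> g x\<bar> \<le> (norm (f x))\<^sup>2 + (norm (g x))\<^sup>2" for x
    using Cauchy_Schwarz_ineq2[of "f x" "g x"] sum_squares_bound[of "norm (f x)" "norm (g x)"]
      mult_nonneg_nonneg[OF norm_ge_zero[of "f x"] norm_ge_zero[of "g x"]]
    by linarith
  then show "AE x in M. norm (f x \<bullet> g x) \<le> norm ((norm (f x))\<^sup>2 + (norm (g x))\<^sup>2)"
    by simp
qed

lemma L2_add:
  fixes f g :: "'a \<Rightarrow> 'b::euclidean_space"
  assumes "L2 M f" "L2 M g"
  shows "L2 M (\<lambda>x. f x + g x)"
proof -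
  have "integrable M (\<lambda>x. (norm (f x))\<^sup>2 + 2 * (f x \<bullet> g x) + (norm (g x))\<^sup>2)"
    using assms integrable_inner_L2[OF assms] by (auto simp: L2_def)
  then have "integrable M (\<lambda>x. (norm (f x + g x))\<^sup>2)"
    by (simp add: dot_square_norm[symmetric] algebra_simps inner_commute)
  with assms show ?thesis by (auto simp: L2_def)
qed

lemma L2_scaleR:
  fixes f :: "'a \<Rightarrow> 'b::euclidean_space"
  assumes "L2 M f"
  shows "L2 M (\<lambda>x. c *\<^sub>R f x)"
  using assms by (auto simp: L2_def power_mult_distrib)

lemma L2_cmult: "L2 M f \<Longrightarrow> L2 M (\<lambda>x. c * f x :: real)"
  using L2_scaleR[of M f c] by simp

lemma L2_diff:
  fixes f g :: "'a \<Rightarrow> 'b::euclidean_space"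
  assumes "L2 M f" "L2 M g"
  shows "L2 M (\<lambda>x. f x - g x)"
  using L2_add[OF assms(1) L2_scaleR[OF assms(2), of "-1"]] by simp

lemma L2_norm_scaleR:
  fixes f :: "'a \<Rightarrow> 'b::euclidean_space"
  shows "L2_norm M (\<lambda>x. c *\<^sub>R f x) = \<bar>c\<bar> * L2_norm M f"
  by (simp add: L2_norm_def power_mult_distrib real_sqrt_mult)

lemma L2_norm_cmult: "L2_norm M (\<lambda>x. c * f x :: real) = \<bar>c\<bar> * L2_norm M f"
  using L2_norm_scaleR[of M c f] by simp

text \<open>Young's inequality with weights \<open>b / a\<close> and \<open>a / b\<close>. The norms
  are enlarged by \<open>e > 0\<close> so that the weights make sense when a norm is zero; then
  \<open>e\<close> tends to 0.\<close>

lemma L2_Cauchy_Schwarz: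
  fixes f g :: "'a \<Rightarrow> 'b::euclidean_space"
  assumes "L2 M f" "L2 M g"
  shows "\<bar>LINT x|M. f x \<bullet> g x\<bar> \<le> L2_norm M f * L2_norm M g"
proof -
  define A B where "A = L2_norm M f" and "B = L2_norm M g"
  have AB: "A \<ge> 0" "B \<ge> 0" by (simp_all add: A_def B_def)
  have *: "\<bar>LINT x|M. f x \<bullet> g x\<bar> \<le> (A + e) * (B + e)" if "e > 0" for e
  proof -
    define a b where "a = A + e" and "b = B + e"
    have ab: "a > 0" "b > 0" "A \<le> a" "B \<le> b" using AB that by (auto simp: a_def b_def)
    have pt: "\<bar>f x \<bullet> g x\<bar> \<le> (b / a * (norm (f x))\<^sup>2 + a / b * (norm (g x))\<^sup>2) / 2" for x
    proof -
      have "0 \<le> (b * norm (f x) - a * norm (g x))\<^sup>2 / (a * b)" using ab by simp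
      also have "\<dots> = b / a * (norm (f x))\<^sup>2 + a / b * (norm (g x))\<^sup>2 - 2 * (norm (f x) * norm (g x))"
        using ab by (simp add: field_simps power2_eq_square)
      finally have "2 * (norm (f x) * norm (g x)) \<le> b / a * (norm (f x))\<^sup>2 + a / b * (norm (g x))\<^sup>2"
        by simp
      with Cauchy_Schwarz_ineq2[of "f x" "g x"] show ?thesis
        unfolding le_divide_eq_numeral1 by linarith
    qed
    have "\<bar>LINT x|M. f x \<bullet> g x\<bar> \<le> (LINT x|M. \<bar>f x \<bullet> g x\<bar>)"
      by (rule integral_abs_bound)
    also have "\<dots> \<le> (LINT x|M. (b / a * (norm (f x))\<^sup>2 + a / b * (norm (g x))\<^sup>2) / 2)"
      using integrable_inner_L2[OF assms] assms pt
      by (intro integral_mono) (auto simp: L2_def)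
    also have "\<dots> = (b / a * A\<^sup>2 + a / b * B\<^sup>2) / 2"
      using assms by (simp add: L2_def A_def B_def L2_norm_square)
    also have "\<dots> \<le> (b / a * a\<^sup>2 + a / b * b\<^sup>2) / 2"
      using ab AB by (intro divide_right_mono add_mono mult_left_mono power_mono) auto
    also have "\<dots> = a * b" using ab by (simp add: field_simps power2_eq_square)
    finally show ?thesis by (simp add: a_def b_def)
  qed
  have "((\<lambda>e. (A + e) * (B + e)) \<longlongrightarrow> (A + 0) * (B + 0)) (at_right 0)"
    by (intro tendsto_intros)
  then have "\<bar>LINT x|M. f x \<bullet> g x\<bar> \<le> (A + 0) * (B + 0)"
    by (rule tendsto_lowerbound) (auto simp: eventually_at_right_less intro: eventually_mono[OF eventually_at_right_less] *)
  then show ?thesis by (simp add: A_def B_def)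
qed

lemma L2_norm_add_square:
  fixes f g :: "'a \<Rightarrow> 'b::euclidean_space"
  assumes "L2 M f" "L2 M g"
  shows "(L2_norm M (\<lambda>x. f x + g x))\<^sup>2 =
    (L2_norm M f)\<^sup>2 + 2 * (LINT x|M. f x \<bullet> g x) + (L2_norm M g)\<^sup>2"
proof -
  have "(L2_norm M (\<lambda>x. f x + g x))\<^sup>2 = (LINT x|M. (norm (f x))\<^sup>2 + 2 * (f x \<bullet> g x) + (norm (g x))\<^sup>2)"
    by (simp add: L2_norm_square dot_square_norm[symmetric] algebra_simps inner_commute)
  then show ?thesis
    using assms integrable_inner_L2[OF assms] by (simp add: L2_def L2_norm_square)
qed

lemma L2_norm_triangle:
  fixes f g :: "'a \<Rightarrow> 'b::euclidean_space"
  assumes "L2 M f" "L2 M g"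
  shows "L2_norm M (\<lambda>x. f x + g x) \<le> L2_norm M f + L2_norm M g"
proof (rule power2_le_imp_le)
  show "(L2_norm M (\<lambda>x. f x + g x))\<^sup>2 \<le> (L2_norm M f + L2_norm M g)\<^sup>2"
    using L2_Cauchy_Schwarz[OF assms] unfolding L2_norm_add_square[OF assms] power2_sum by linarith
qed simp

lemma L2_norm_triangle_diff:
  fixes f g h :: "'a \<Rightarrow> 'b::euclidean_space"
  assumes "L2 M f" "L2 M g" "L2 M h"
  shows "L2_norm M (\<lambda>x. f x - h x) \<le> L2_norm M (\<lambda>x. f x - g x) + L2_norm M (\<lambda>x. g x - h x)"
  using L2_norm_triangle[OF L2_diff[OF assms(1,2)] L2_diff[OF assms(2,3)]] by simp

lemma L2_norm_le_add_diff:
  fixes f g :: "'a \<Rightarrow> 'b::euclidean_space"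
  assumes "L2 M f" "L2 M g"
  shows "L2_norm M f \<le> L2_norm M g + L2_norm M (\<lambda>x. f x - g x)"
  using L2_norm_triangle[OF assms(2) L2_diff[OF assms]] by simp

lemma L2_norm_cong_AE:
  assumes "AE x in M. f x = g x" "f \<in> borel_measurable M" "g \<in> borel_measurable M"
  shows "L2_norm M f = L2_norm M g"
proof -
  have "(LINT x|M. (norm (f x))\<^sup>2) = (LINT x|M. (norm (g x))\<^sup>2)"
    using assms by (intro integral_cong_AE) auto
  then show ?thesis by (simp add: L2_norm_def)
qed

lemma L2_norm_zero_imp_AE:
  assumes "L2 M f" "L2_norm M f = 0"
  shows "AE x in M. f x = 0"
proof -
  have "(LINT x|M. (norm (f x))\<^sup>2) = 0"
    using assms(2) by (simp add: L2_norm_def)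
  then have "AE x in M. (norm (f x))\<^sup>2 = 0"
    using assms(1) by (subst (asm) integral_nonneg_eq_0_iff_AE) (auto simp: L2_def)
  then show ?thesis by simp
qed

lemma L2_norm_zero [simp]: "L2_norm M (\<lambda>x. 0) = 0"
  by (simp add: L2_norm_def)

lemma tendsto_L2_norm_add:
  fixes f g :: "'a \<Rightarrow> 'b::euclidean_space"
  assumes "L2 M f" "L2 M g" "\<And>n. L2 M (h n)" "\<And>n. L2 M (k n)"
    and "(\<lambda>n. L2_norm M (\<lambda>x. h n x - f x)) \<longlonglongrightarrow> 0"
    and "(\<lambda>n. L2_norm M (\<lambda>x. k n x - g x)) \<longlonglongrightarrow> 0"
  shows "(\<lambda>n. L2_norm M (\<lambda>x. h n x + c *\<^sub>R k n x - (f x + c *\<^sub>R g x))) \<longlonglongrightarrow> 0"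
proof (rule Lim_null_comparison)
  show "(\<lambda>n. L2_norm M (\<lambda>x. h n x - f x) + \<bar>c\<bar> * L2_norm M (\<lambda>x. k n x - g x)) \<longlonglongrightarrow> 0"
    using tendsto_add[OF assms(5) tendsto_mult_left[OF assms(6), of "\<bar>c\<bar>"]] by simp
  have "L2_norm M (\<lambda>x. h n x + c *\<^sub>R k n x - (f x + c *\<^sub>R g x))
    \<le> L2_norm M (\<lambda>x. h n x - f x) + \<bar>c\<bar> * L2_norm M (\<lambda>x. k n x - g x)" for n
    using L2_norm_triangle[OF L2_diff[OF assms(3,1)] L2_scaleR[OF L2_diff[OF assms(4,2)]], of n c n]
    unfolding L2_norm_scaleR by (simp add: algebra_simps)
  then show "\<forall>\<^sub>F n in sequentially. norm (L2_norm M (\<lambda>x. h n x + c *\<^sub>R k n x - (f x + c *\<^sub>R g x)))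
    \<le> L2_norm M (\<lambda>x. h n x - f x) + \<bar>c\<bar> * L2_norm M (\<lambda>x. k n x - g x)" by simp
qed

lemma L2_const: "finite_measure M \<Longrightarrow> L2 M (\<lambda>x. c)"
  by (simp add: L2_def finite_measure.integrable_const)

lemma L2_norm_const:
  "finite_measure M \<Longrightarrow> L2_norm M (\<lambda>x. c::real) = \<bar>c\<bar> * sqrt (measure M (space M))"
  by (simp add: L2_norm_def real_sqrt_mult mult.commute)

lemma L2_bounded:
  assumes "finite_measure M" "f \<in> borel_measurable M" "AE x in M. norm (f x) \<le> B"
  shows "L2 M f"
proof -
  interpret finite_measure M by fact
  have "integrable M (\<lambda>x. (norm (f x))\<^sup>2)"
  proof (rule integrable_const_bound[of _ "B\<^sup>2"])
    show "AE x in M. norm ((norm (f x))\<^sup>2) \<le> B\<^sup>2"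
      using assms(3) by eventually_elim (auto intro: power_mono)
  qed (use assms(2) in auto)
  with assms(2) show ?thesis by (simp add: L2_def)
qed

text \<open>The analytic inequalities are proved with nonnegative integrals, where Fubini and
  substitution require no integrability; this brings them back to norms.\<close>

lemma L2_norm_le_nn_integral:
  assumes f: "L2 M f" and C: "C \<ge> 0"
    and le: "(\<integral>\<^sup>+x. ennreal ((norm (f x))\<^sup>2) \<partial>M) \<le> ennreal (C\<^sup>2)"
  shows "L2_norm M f \<le> C"
proof (rule power2_le_imp_le)
  have "ennreal (LINT x|M. (norm (f x))\<^sup>2) \<le> ennreal (C\<^sup>2)"
    using f le by (subst nn_integral_eq_integral[symmetric]) (auto simp: L2_def)
  then show "(L2_norm M f)\<^sup>2 \<le> C\<^sup>2" by (simp add: L2_norm_square)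
qed fact

lemma nn_integral_L2_norm:
  assumes "L2 M f"
  shows "(\<integral>\<^sup>+x. ennreal ((norm (f x))\<^sup>2) \<partial>M) = ennreal ((L2_norm M f)\<^sup>2)"
  using assms by (simp add: L2_def nn_integral_eq_integral L2_norm_square)

section \<open>Line integrals and linear coordinates in the plane\<close>

lemma C1_with_gradient_continuous:
  assumes "C1_with_gradient \<phi> g"
  shows "continuous_on UNIV \<phi>" "continuous_on UNIV g"
proof -
  show "continuous_on UNIV \<phi>"
    using assms unfolding C1_with_gradient_def gderiv_def
    by (metis continuous_at_imp_continuous_on has_derivative_continuous)
  show "continuous_on UNIV g"
    using assms by (simp add: C1_with_gradient_def)
qed

lemma C1_with_gradient_measurable [measurable]:
  assumes "C1_with_gradient \<phi> g"
  shows "\<phi> \<in> borel_measurable borel" "g \<in> borel_measurable borel"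
  using C1_with_gradient_continuous[OF assms] by (auto intro: borel_measurable_continuous_onI)

lemma C1_with_gradient_line:
  assumes "C1_with_gradient \<phi> g"
  shows "((\<lambda>t. \<phi> (a + t *\<^sub>R v)) has_real_derivative g (a + t *\<^sub>R v) \<bullet> v) (at t)"
    and "isCont (\<lambda>t. g (a + t *\<^sub>R v) \<bullet> v) t"
    and "isCont (\<lambda>t. \<phi> (a + t *\<^sub>R v)) t"
proof -
  have "(\<phi> has_derivative (\<lambda>h. h \<bullet> g (a + t *\<^sub>R v))) (at (a + t *\<^sub>R v))"
    using assms by (simp add: C1_with_gradient_def gderiv_def)
  moreover have "((\<lambda>t. a + t *\<^sub>R v) has_derivative (\<lambda>h. h *\<^sub>R v)) (at t)"
    by (auto intro!: derivative_eq_intros)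
  ultimately have "((\<lambda>t. \<phi> (a + t *\<^sub>R v)) has_derivative (\<lambda>h. (h *\<^sub>R v) \<bullet> g (a + t *\<^sub>R v))) (at t)"
    using has_derivative_compose[of "\<lambda>t. a + t *\<^sub>R v"] by blast
  then show "((\<lambda>t. \<phi> (a + t *\<^sub>R v)) has_real_derivative g (a + t *\<^sub>R v) \<bullet> v) (at t)"
    unfolding has_field_derivative_def
    by (rule has_derivative_eq_rhs) (auto simp: inner_commute)
  have c: "continuous_on UNIV g" "continuous_on UNIV \<phi>"
    using C1_with_gradient_continuous[OF assms] by auto
  have "continuous_on UNIV (\<lambda>t. g (a + t *\<^sub>R v) \<bullet> v)" "continuous_on UNIV (\<lambda>t. \<phi> (a + t *\<^sub>R v))"
    by (auto intro!: continuous_intros continuous_on_compose2[OF c(1)] continuous_on_compose2[OF c(2)])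
  then show "isCont (\<lambda>t. g (a + t *\<^sub>R v) \<bullet> v) t" "isCont (\<lambda>t. \<phi> (a + t *\<^sub>R v)) t"
    by (simp_all add: continuous_on_eq_continuous_at)
qed

text \<open>The derivative \<open>f\<close> may have any sign; only the majorant \<open>k\<close>
  has to be nonnegative to appear under a nonnegative integral. Each application chooses a primitive
  \<open>F\<close> whose increment is the quantity to be bounded.\<close>

lemma FTC_le_nn_integral:
  fixes F f k :: "real \<Rightarrow> real"
  assumes "a \<le> b" and F: "\<And>t. (F has_real_derivative f t) (at t)"
    and f: "\<And>t. isCont f t" and k: "\<And>t. isCont k t" "\<And>t. 0 \<le> k t"
    and le: "\<And>t. t \<in> {a..b} \<Longrightarrow> f t \<le> k t"
  shows "ennreal (F b - F a) \<le> (\<integral>\<^sup>+t. indicator {a..b} t * ennreal (k t) \<partial>lborel)"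
proof -
  have ki: "integrable lborel (\<lambda>t. k t * indicator {a..b} t)"
    using borel_integrable_atLeastAtMost'[of a b k] k(1)
    by (simp add: set_integrable_def continuous_at_imp_continuous_on mult.commute)
  have fi: "integrable lborel (\<lambda>t. f t * indicator {a..b} t)"
    using borel_integrable_atLeastAtMost'[of a b f] f
    by (simp add: set_integrable_def continuous_at_imp_continuous_on mult.commute)
  have "F b - F a = (LBINT t. f t * indicator {a..b} t)"
    by (rule integral_FTC_Icc_real[OF assms(1) F f, symmetric])
  also have "\<dots> \<le> (LBINT t. k t * indicator {a..b} t)"
    using ki fi le by (intro integral_mono) (auto simp: indicator_def)
  finally have "ennreal (F b - F a) \<le> ennreal (LBINT t. k t * indicator {a..b} t)"
    by (rule ennreal_leI)
  also have "\<dots> = (\<integral>\<^sup>+t. ennreal (k t * indicator {a..b} t) \<partial>lborel)"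
    using ki k(2) by (intro nn_integral_eq_integral[symmetric]) auto
  also have "\<dots> = (\<integral>\<^sup>+t. indicator {a..b} t * ennreal (k t) \<partial>lborel)"
    by (intro nn_integral_cong) (auto simp: indicator_def)
  finally show ?thesis .
qed

section \<open>Lebesgue measure of the plane as a product measure and in affine coordinates\<close>

lemma lborel_real2:
  "(lborel :: (real^2) measure) =
     distr (lborel \<Otimes>\<^sub>M lborel) borel (\<lambda>p. fst p *\<^sub>R axis 1 1 + snd p *\<^sub>R axis 2 1)"
proof (rule lborel_eqI)
  fix l u :: "real^2"
  assume le: "\<And>b. b \<in> Basis \<Longrightarrow> l \<bullet> b \<le> u \<bullet> b"
  have B: "(Basis :: (real^2) set) = {axis 1 1, axis 2 1}"
    by (auto simp: Basis_vec_def UNIV_2)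
  have ne: "axis 1 1 \<noteq> (axis 2 1 :: real^2)" by (simp add: axis_eq_axis)
  have le': "l $ 1 \<le> u $ 1" "l $ 2 \<le> u $ 2"
    using le[of "axis 1 1"] le[of "axis 2 1"] by (auto simp: B inner_axis)
  have vi: "(\<lambda>p. fst p *\<^sub>R axis 1 1 + snd p *\<^sub>R axis 2 1) -` box l u
      = {l $ 1<..<u $ 1} \<times> {l $ 2<..<u $ 2}"
    by (auto simp: mem_box_cart forall_2 axis_def)
  have "emeasure (distr (lborel \<Otimes>\<^sub>M lborel) borel (\<lambda>p. fst p *\<^sub>R axis 1 1 + snd p *\<^sub>R (axis 2 1 :: real^2))) (box l u)
     = emeasure (lborel \<Otimes>\<^sub>M lborel) ({l $ 1<..<u $ 1} \<times> {l $ 2<..<u $ 2})"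
    by (subst emeasure_distr) (auto simp: vi space_pair_measure)
  also have "\<dots> = ennreal (u $ 1 - l $ 1) * ennreal (u $ 2 - l $ 2)"
    using le' by (subst lborel.emeasure_pair_measure_Times) auto
  also have "\<dots> = ennreal (prod ((\<bullet>) (u - l)) Basis)"
    using le' ne by (simp add: B inner_axis ennreal_mult)
  finally show "emeasure (distr (lborel \<Otimes>\<^sub>M lborel) borel (\<lambda>p. fst p *\<^sub>R axis 1 1 + snd p *\<^sub>R (axis 2 1 :: real^2))) (box l u)
     = ennreal (prod ((\<bullet>) (u - l)) Basis)" .
qed simp

lemma nn_integral_real2:
  fixes F :: "real^2 \<Rightarrow> ennreal"
  assumes [measurable]: "F \<in> borel_measurable borel"
  shows "(\<integral>\<^sup>+z. F z \<partial>lborel) = (\<integral>\<^sup>+x. \<integral>\<^sup>+y. F (x *\<^sub>R axis 1 1 + y *\<^sub>R axis 2 1) \<partial>lborel \<partial>lborel)"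
proof -
  have "(\<integral>\<^sup>+z. F z \<partial>lborel) =
      (\<integral>\<^sup>+p. F (fst p *\<^sub>R axis 1 1 + snd p *\<^sub>R axis 2 1) \<partial>(lborel \<Otimes>\<^sub>M lborel))"
    by (subst lborel_real2, subst nn_integral_distr) auto
  also have "\<dots> = (\<integral>\<^sup>+x. \<integral>\<^sup>+y. F (x *\<^sub>R axis 1 1 + y *\<^sub>R axis 2 1) \<partial>lborel \<partial>lborel)"
    by (subst lborel.nn_integral_fst[symmetric]) auto
  finally show ?thesis .
qed

text \<open>Two substitutions on the line. For fixed \<beta> the variable \<alpha> is replaced by
  the first coordinate, which requires \<open>u $ 1 \<noteq> 0\<close>; for a fixed first
  coordinate, \<beta> is replaced by the second one. The two factors multiply to the
  determinant.\<close>

lemma nn_integral_affine_coordinates_aux: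
  fixes F :: "real^2 \<Rightarrow> ennreal" and s u v :: "real^2"
  assumes [measurable]: "F \<in> borel_measurable borel"
    and u: "u $ 1 \<noteq> 0" and det: "u $ 1 * v $ 2 - u $ 2 * v $ 1 \<noteq> 0"
  shows "ennreal \<bar>u $ 1 * v $ 2 - u $ 2 * v $ 1\<bar> *
      (\<integral>\<^sup>+\<beta>. \<integral>\<^sup>+\<alpha>. F (s + \<alpha> *\<^sub>R u + \<beta> *\<^sub>R v) \<partial>lborel \<partial>lborel) = (\<integral>\<^sup>+z. F z \<partial>lborel)"
proof -
  \<comment> \<open>The rate at which the second coordinate changes with \<beta> while the first one
    is kept fixed.\<close>
  define c where "c = v $ 2 - v $ 1 * u $ 2 / u $ 1"
  have c: "c \<noteq> 0" and uc: "\<bar>u $ 1 * v $ 2 - u $ 2 * v $ 1\<bar> = \<bar>u $ 1\<bar> * \<bar>c\<bar>"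
    using u det by (auto simp: c_def field_simps abs_mult[symmetric])
  define H where "H x y = F (x *\<^sub>R axis 1 1 + y *\<^sub>R axis 2 1)" for x y
  define k where "k \<beta> x = H x (s $ 2 + (x - s $ 1) / u $ 1 * u $ 2 + c * \<beta>)" for \<beta> x
  have Fk: "F (s + \<alpha> *\<^sub>R u + \<beta> *\<^sub>R v) = k \<beta> ((s $ 1 + \<beta> * v $ 1) + u $ 1 * \<alpha>)" for \<alpha> \<beta>
    unfolding k_def H_def using u
    by (intro arg_cong[where f = F]) (auto simp: vec_eq_iff forall_2 axis_def c_def field_simps)
  have [measurable]: "(\<lambda>(x, y). H x y) \<in> borel_measurable (borel \<Otimes>\<^sub>M borel)"
    unfolding H_def by measurable
  have [measurable]: "(\<lambda>(\<beta>, x). k \<beta> x) \<in> borel_measurable (borel \<Otimes>\<^sub>M borel)"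
    unfolding k_def by measurable
  have [measurable]: "k \<beta> \<in> borel_measurable borel" for \<beta>
    unfolding k_def[abs_def] by measurable
  have "ennreal \<bar>u $ 1 * v $ 2 - u $ 2 * v $ 1\<bar> *
      (\<integral>\<^sup>+\<beta>. \<integral>\<^sup>+\<alpha>. F (s + \<alpha> *\<^sub>R u + \<beta> *\<^sub>R v) \<partial>lborel \<partial>lborel)
    = ennreal \<bar>c\<bar> * (\<integral>\<^sup>+\<beta>. ennreal \<bar>u $ 1\<bar> * (\<integral>\<^sup>+\<alpha>. k \<beta> ((s $ 1 + \<beta> * v $ 1) + u $ 1 * \<alpha>) \<partial>lborel) \<partial>lborel)"
    unfolding uc Fk by (subst nn_integral_cmult) (auto simp: ennreal_mult mult_ac)
  also have "\<dots> = ennreal \<bar>c\<bar> * (\<integral>\<^sup>+\<beta>. \<integral>\<^sup>+x. k \<beta> x \<partial>lborel \<partial>lborel)"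
    by (subst nn_integral_real_affine[OF _ u, symmetric]) auto
  also have "\<dots> = ennreal \<bar>c\<bar> * (\<integral>\<^sup>+x. \<integral>\<^sup>+\<beta>. k \<beta> x \<partial>lborel \<partial>lborel)"
    by (subst lborel_pair.Fubini') auto
  also have "\<dots> = (\<integral>\<^sup>+x. ennreal \<bar>c\<bar> * (\<integral>\<^sup>+\<beta>. k \<beta> x \<partial>lborel) \<partial>lborel)"
    by (subst nn_integral_cmult) auto
  also have "\<dots> = (\<integral>\<^sup>+x. \<integral>\<^sup>+y. H x y \<partial>lborel \<partial>lborel)"
    unfolding k_def
    by (subst nn_integral_real_affine[OF _ c, symmetric]) auto
  also have "\<dots> = (\<integral>\<^sup>+z. F z \<partial>lborel)"
    by (simp add: nn_integral_real2 H_def)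
  finally show ?thesis .
qed

text \<open>A nonzero determinant forces one of the two vectors to have a nonzero first coordinate;
  that vector takes the inner integral.\<close>

lemma nn_integral_affine_coordinates:
  fixes F :: "real^2 \<Rightarrow> ennreal" and s u v :: "real^2"
  assumes [measurable]: "F \<in> borel_measurable borel"
    and det: "u $ 1 * v $ 2 - u $ 2 * v $ 1 \<noteq> 0"
  shows "ennreal \<bar>u $ 1 * v $ 2 - u $ 2 * v $ 1\<bar> *
      (\<integral>\<^sup>+\<alpha>. \<integral>\<^sup>+\<beta>. F (s + \<alpha> *\<^sub>R u + \<beta> *\<^sub>R v) \<partial>lborel \<partial>lborel) = (\<integral>\<^sup>+z. F z \<partial>lborel)"
proof (cases "u $ 1 = 0")
  case False
  then show ?thesis
    by (subst lborel_pair.Fubini') (use nn_integral_affine_coordinates_aux[OF assms(1) False det] in auto)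
next
  case True
  with det have "v $ 1 \<noteq> 0" "v $ 1 * u $ 2 - v $ 2 * u $ 1 \<noteq> 0" by auto
  from nn_integral_affine_coordinates_aux[OF assms(1) this, of s]
  show ?thesis by (simp add: abs_minus_commute[of "v $ 1 * u $ 2"] add_ac mult.commute)
qed

text \<open>Jensen's inequality on the unit interval, read off from
  \<open>(g' t - m)^2 \<ge> 0\<close> with \<open>m\<close> the increment of \<open>g\<close>: the
  integral of \<open>2 * m * g' t - m^2\<close> is exactly \<open>m^2\<close>.\<close>

lemma square_diff_le_nn_integral_derivative:
  fixes g :: "real \<Rightarrow> real"
  assumes g: "\<And>t. (g has_real_derivative g' t) (at t)" and g': "\<And>t. isCont g' t"
  shows "ennreal ((g 1 - g 0)\<^sup>2) \<le> (\<integral>\<^sup>+t. indicator {0..1} t * ennreal ((g' t)\<^sup>2) \<partial>lborel)"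
proof -
  define m where "m = g 1 - g 0"
  have "ennreal ((2 * m * g 1 - m\<^sup>2 * 1) - (2 * m * g 0 - m\<^sup>2 * 0))
      \<le> (\<integral>\<^sup>+t. indicator {0..1} t * ennreal ((g' t)\<^sup>2) \<partial>lborel)"
  proof (rule FTC_le_nn_integral[where f = "\<lambda>t. 2 * m * g' t - m\<^sup>2"])
    show "2 * m * g' t - m\<^sup>2 \<le> (g' t)\<^sup>2" for t
      using sum_squares_bound[of m "g' t"] by simp
    show "((\<lambda>t. 2 * m * g t - m\<^sup>2 * t) has_real_derivative 2 * m * g' t - m\<^sup>2) (at t)" for t
      by (auto intro!: derivative_eq_intros g)
  qed (auto intro!: continuous_intros g')
  then show ?thesis by (simp add: m_def power2_eq_square algebra_simps)
qed

text \<open>One-dimensional trace inequality. The primitive carries the weight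
  \<open>- 2 * (1/2 - t)\<close>, which is 0 at 1/2 and -1 at 0, so that only the endpoint 0
  contributes. In the constant 3, the derivative of the weight gives 2 and the mixed term gives
  1.\<close>

lemma square_endpoint_le_nn_integral:
  fixes g :: "real \<Rightarrow> real"
  assumes g: "\<And>t. (g has_real_derivative g' t) (at t)" and g': "\<And>t. isCont g' t"
  shows "ennreal ((g 0)\<^sup>2) \<le> (\<integral>\<^sup>+t. indicator {0..1/2} t * ennreal (3 * ((g t)\<^sup>2 + (g' t)\<^sup>2)) \<partial>lborel)"
proof -
  have "ennreal (2 * (1/2 - 0) * (g 0)\<^sup>2) = ennreal (- 2 * (1/2 - 1/2) * (g (1/2))\<^sup>2 - (- 2 * (1/2 - 0) * (g 0)\<^sup>2))"
    by simp
  also have "\<dots> \<le> (\<integral>\<^sup>+t. indicator {0..1/2} t * ennreal (3 * ((g t)\<^sup>2 + (g' t)\<^sup>2)) \<partial>lborel)"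
  proof (rule FTC_le_nn_integral[where f = "\<lambda>t. 2 * (g t)\<^sup>2 - 4 * (1/2 - t) * g t * g' t"])
    show "((\<lambda>t. - 2 * (1/2 - t) * (g t)\<^sup>2) has_real_derivative
        2 * (g t)\<^sup>2 - 4 * (1/2 - t) * g t * g' t) (at t)" for t
      by (auto intro!: derivative_eq_intros g simp: algebra_simps power2_eq_square)
    show "2 * (g t)\<^sup>2 - 4 * (1/2 - t) * g t * g' t \<le> 3 * ((g t)\<^sup>2 + (g' t)\<^sup>2)" if t: "t \<in> {0..1/2}" for t
    proof -
      have "- (4 * (1/2 - t) * g t * g' t) \<le> 4 * (1/2 - t) * (\<bar>g t\<bar> * \<bar>g' t\<bar>)"
        using t mult_left_mono[OF abs_ge_minus_self[of "g t * g' t"], of "4 * (1/2 - t)"]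
        by (simp add: abs_mult mult.assoc)
      also have "\<dots> \<le> 4 * (1/2) * (\<bar>g t\<bar> * \<bar>g' t\<bar>)"
        using t by (intro mult_right_mono mult_left_mono) auto
      also have "\<dots> \<le> (g t)\<^sup>2 + (g' t)\<^sup>2"
        using sum_squares_bound[of "\<bar>g t\<bar>" "\<bar>g' t\<bar>"] by simp
      finally have "- (4 * (1/2 - t) * g t * g' t) \<le> (g t)\<^sup>2 + (g' t)\<^sup>2" .
      then show ?thesis using zero_le_power2[of "g' t"] by (smt (verit))
    qed
    have [simp]: "isCont g t" for t using g DERIV_isCont by blast
    show "isCont (\<lambda>t. 2 * (g t)\<^sup>2 - 4 * (1/2 - t) * g t * g' t) t"
       "isCont (\<lambda>t. 3 * ((g t)\<^sup>2 + (g' t)\<^sup>2)) t" for t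
      by (auto intro!: continuous_intros g')
  qed auto
  finally show ?thesis by simp
qed

section \<open>Arc length and the trace inequality on an edge\<close>

lemma edge_measure_cases:
  assumes "a \<noteq> b" "e = closed_segment a b"
  obtains a' b' where "a' \<noteq> b'" "e = closed_segment a' b'"
    "edge_measure e = distr (restrict_space lborel {0..dist a' b'}) borel (\<lambda>t. a' + (t / dist a' b') *\<^sub>R (b' - a'))"
proof -
  define p where "p = (SOME (a, b). e = closed_segment a b)"
  have "case p of (a, b) \<Rightarrow> e = closed_segment a b"
    unfolding p_def by (rule someI[where x = "(a, b)"]) (simp add: assms)
  then have p: "e = closed_segment (fst p) (snd p)" by (simp add: case_prod_beta)
  moreover from p have "fst p \<noteq> snd p"
    using assms by (metis closed_segment_idem closed_segment_eq_sing)
  moreover have "edge_measure e = distr (restrict_space lborel {0..dist (fst p) (snd p)}) borel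
      (\<lambda>t. fst p + (t / dist (fst p) (snd p)) *\<^sub>R (snd p - fst p))"
    by (simp add: edge_measure_def p_def[symmetric] case_prod_beta)
  ultimately show thesis using that by blast
qed

text \<open>The endpoints selected inside \<open>edge_measure\<close> come in an unknown order, so
  the parametrization by the unit interval is stated for some pair \<open>a'\<close>,
  \<open>b'\<close>.\<close>

lemma nn_integral_edge_measure:
  assumes "a \<noteq> b" "e = closed_segment a b"
  obtains a' b' where "a' \<noteq> b'" "e = closed_segment a' b'"
    "\<forall>F. F \<in> borel_measurable borel \<longrightarrow> (\<integral>\<^sup>+x. F x \<partial>edge_measure e) =
      ennreal (dist a' b') * (\<integral>\<^sup>+t. indicator {0..1} t * F (a' + t *\<^sub>R (b' - a')) \<partial>lborel)"
proof -
  obtain a' b' where ab: "a' \<noteq> b'" "e = closed_segment a' b'"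
    and em: "edge_measure e = distr (restrict_space lborel {0..dist a' b'}) borel (\<lambda>t. a' + (t / dist a' b') *\<^sub>R (b' - a'))"
    by (rule edge_measure_cases[OF assms])
  have "(\<integral>\<^sup>+x. F x \<partial>edge_measure e) =
      ennreal (dist a' b') * (\<integral>\<^sup>+t. indicator {0..1} t * F (a' + t *\<^sub>R (b' - a')) \<partial>lborel)"
    if [measurable]: "F \<in> borel_measurable borel" for F
  proof -
    have ind: "indicator {0..dist a' b'} (dist a' b' * t) = (indicator {0..1} t :: ennreal)" for t
      using ab(1) by (auto simp: indicator_def zero_le_mult_iff)
    have "(\<integral>\<^sup>+x. F x \<partial>edge_measure e) =
        (\<integral>\<^sup>+t. F (a' + (t / dist a' b') *\<^sub>R (b' - a')) * indicator {0..dist a' b'} t \<partial>lborel)"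
      unfolding em by (subst nn_integral_distr) (auto simp: nn_integral_restrict_space measurable_restrict_space1)
    also have "\<dots> = ennreal \<bar>dist a' b'\<bar> * (\<integral>\<^sup>+t. F (a' + ((0 + dist a' b' * t) / dist a' b') *\<^sub>R (b' - a'))
        * indicator {0..dist a' b'} (0 + dist a' b' * t) \<partial>lborel)"
      using ab(1) by (subst nn_integral_real_affine[where c = "dist a' b'" and t = 0]) auto
    also have "\<dots> = ennreal (dist a' b') * (\<integral>\<^sup>+t. indicator {0..1} t * F (a' + t *\<^sub>R (b' - a')) \<partial>lborel)"
      using ab(1) by (simp add: ind mult.commute[of "indicator _ _"])
    finally show ?thesis .
  qed
  with ab that show thesis by blast
qed

lemma sets_edge_measure [simp, measurable_cong]: "sets (edge_measure e) = sets borel"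
  by (simp add: edge_measure_def case_prod_beta)

lemma space_edge_measure [simp]: "space (edge_measure e) = UNIV"
  by (simp add: edge_measure_def case_prod_beta)

lemma borel_measurable_edge_measure [simp]:
  "(f \<in> borel_measurable (edge_measure e)) = (f \<in> borel_measurable borel)"
  by (rule measurable_cong_sets[THEN arg_cong[where f = "\<lambda>S. f \<in> S"]]) simp_all

lemma emeasure_edge_measure_UNIV:
  assumes "a \<noteq> b"
  shows "emeasure (edge_measure (closed_segment a b)) UNIV = ennreal (dist a b)"
proof -
  obtain a' b' where ab: "a' \<noteq> b'" "closed_segment a b = closed_segment a' b'"
    and nn: "\<forall>F. F \<in> borel_measurable borel \<longrightarrow> (\<integral>\<^sup>+x. F x \<partial>edge_measure (closed_segment a b)) =
      ennreal (dist a' b') * (\<integral>\<^sup>+t. indicator {0..1} t * F (a' + t *\<^sub>R (b' - a')) \<partial>lborel)"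
    by (rule nn_integral_edge_measure[OF assms refl])
  have "dist a' b' = dist a b"
    using ab(2) by (auto simp: closed_segment_eq doubleton_eq_iff dist_commute)
  with nn[rule_format, of "\<lambda>_. 1"] show ?thesis
    by simp
qed

lemma finite_edge_measure:
  assumes "a \<noteq> b"
  shows "finite_measure (edge_measure (closed_segment a b))"
  by (rule finite_measureI) (simp add: emeasure_edge_measure_UNIV[OF assms])

lemma AE_edge_measure_in:
  assumes "a \<noteq> b"
  shows "AE x in edge_measure (closed_segment a b). x \<in> closed_segment a b"
proof -
  define e where "e = closed_segment a b"
  obtain a' b' where ab: "a' \<noteq> b'" "e = closed_segment a' b'"
    and nn: "\<forall>F. F \<in> borel_measurable borel \<longrightarrow> (\<integral>\<^sup>+x. F x \<partial>edge_measure e) =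
      ennreal (dist a' b') * (\<integral>\<^sup>+t. indicator {0..1} t * F (a' + t *\<^sub>R (b' - a')) \<partial>lborel)"
    by (rule nn_integral_edge_measure[OF assms e_def])
  have [measurable]: "e \<in> sets borel" by (simp add: e_def)
  have in_e: "a' + t *\<^sub>R (b' - a') \<in> e" if "0 \<le> t" "t \<le> 1" for t
    using that unfolding ab(2) in_segment by (intro exI[of _ t]) (auto simp: algebra_simps)
  have "(\<integral>\<^sup>+x. indicator (- e) x \<partial>edge_measure e) =
      ennreal (dist a' b') * (\<integral>\<^sup>+t. indicator {0..1} t * indicator (- e) (a' + t *\<^sub>R (b' - a')) \<partial>lborel)"
    by (rule nn[rule_format]) measurable
  also have "(\<integral>\<^sup>+t. indicator {0..1} t * indicator (- e) (a' + t *\<^sub>R (b' - a')) \<partial>lborel) = (\<integral>\<^sup>+t. 0 \<partial>(lborel :: real measure))"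
    using in_e by (intro nn_integral_cong) (auto simp: indicator_def)
  finally have "emeasure (edge_measure e) (- e) = 0" by simp
  then have "AE x in edge_measure e. x \<notin> - e" by (intro AE_not_in) (auto simp: null_sets_def)
  then show ?thesis unfolding e_def by simp
qed

lemma AE_edge_measure_neq:
  assumes "a \<noteq> b"
  shows "AE x in edge_measure (closed_segment a b). x \<noteq> z"
proof -
  define e where "e = closed_segment a b"
  obtain a' b' where ab: "a' \<noteq> b'" "e = closed_segment a' b'"
    and nn: "\<forall>F. F \<in> borel_measurable borel \<longrightarrow> (\<integral>\<^sup>+x. F x \<partial>edge_measure e) =
      ennreal (dist a' b') * (\<integral>\<^sup>+t. indicator {0..1} t * F (a' + t *\<^sub>R (b' - a')) \<partial>lborel)"
    by (rule nn_integral_edge_measure[OF assms e_def])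
  define T where "T = {t. a' + t *\<^sub>R (b' - a') = z}"
  have T: "\<exists>r. T \<subseteq> {r}"
  proof (cases "T = {}")
    case False
    then obtain r where r: "r \<in> T" by auto
    have "t = r" if "t \<in> T" for t
    proof -
      have "t *\<^sub>R (b' - a') = r *\<^sub>R (b' - a')" using that r by (auto simp: T_def)
      then show ?thesis using ab(1) by simp
    qed
    then show ?thesis by blast
  qed blast
  then obtain r where r: "T \<subseteq> {r}" by blast
  have "(\<integral>\<^sup>+x. indicator {z} x \<partial>edge_measure e) =
      ennreal (dist a' b') * (\<integral>\<^sup>+t. indicator {0..1} t * indicator {z} (a' + t *\<^sub>R (b' - a')) \<partial>lborel)"
    by (rule nn[rule_format]) measurable
  also have "(\<integral>\<^sup>+t. indicator {0..1} t * indicator {z} (a' + t *\<^sub>R (b' - a')) \<partial>lborel) \<le> (\<integral>\<^sup>+t. indicator {r} t \<partial>lborel)"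
    using r by (intro nn_integral_mono) (auto simp: indicator_def T_def)
  finally have "emeasure (edge_measure e) {z} = 0" by (simp add: mult_left_mono)
  then have "AE x in edge_measure e. x \<notin> {z}" by (intro AE_not_in) (auto simp: null_sets_def)
  then show ?thesis unfolding e_def by simp
qed

text \<open>The point is a convex combination of a point of the segment, with weight 1 - \<beta>,
  and of the interior point \<open>b\<close>, with positive weight \<beta>.\<close>

lemma triangle_point_in_open_convex:
  fixes s t b :: "'a::euclidean_space"
  assumes S: "open S" "convex S" and e: "closed_segment s t \<subseteq> closure S" and b: "b \<in> S"
    and \<alpha>: "0 \<le> \<alpha>" and \<beta>: "0 < \<beta>" and le: "\<alpha> + \<beta> \<le> 1"
  shows "s + \<alpha> *\<^sub>R (t - s) + \<beta> *\<^sub>R (b - s) \<in> S"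
proof -
  \<comment> \<open>If \<beta> = 1 then \<alpha> = 0, and division by zero yields
    \<open>r = 0\<close>, for which all three properties of \<open>r\<close> still hold.\<close>
  define r where "r = \<alpha> / (1 - \<beta>)"
  have r: "0 \<le> r" "r \<le> 1" "r * (1 - \<beta>) = \<alpha>"
    using \<alpha> \<beta> le by (auto simp: r_def divide_le_eq_1)
  have "s + r *\<^sub>R (t - s) \<in> closed_segment s t"
    using r unfolding in_segment by (intro exI[of _ r]) (auto simp: algebra_simps)
  with e have "s + r *\<^sub>R (t - s) \<in> closure S" by blast
  then have "(s + r *\<^sub>R (t - s)) - \<beta> *\<^sub>R ((s + r *\<^sub>R (t - s)) - b) \<in> interior S"
    using b S \<alpha> \<beta> le by (intro mem_interior_closure_convex_shrink) (auto simp: interior_open)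
  also have "(s + r *\<^sub>R (t - s)) - \<beta> *\<^sub>R ((s + r *\<^sub>R (t - s)) - b) = s + (r * (1 - \<beta>)) *\<^sub>R (t - s) + \<beta> *\<^sub>R (b - s)"
    by (simp add: algebra_simps)
  finally show ?thesis using r S by (simp add: interior_open)
qed

text \<open>Each half of an edge spans with the direction to an interior point a parallelogram inside \<open>D\<close>.\<close>

lemma half_edge_trace_inequality:
  fixes s t a :: "real^2"
  assumes D: "open D" "convex D" and e: "closed_segment s t \<subseteq> closure D" and a: "a \<in> D"
    and det: "(t - s) $ 1 * (a - s) $ 2 - (t - s) $ 2 * (a - s) $ 1 \<noteq> 0"
  obtains K where "K \<ge> 0" "\<forall>\<phi> \<gamma>. C1_with_gradient \<phi> \<gamma> \<longrightarrow>
    (\<integral>\<^sup>+\<alpha>. indicator {0..1/2} \<alpha> * ennreal ((\<phi> (s + \<alpha> *\<^sub>R (t - s)))\<^sup>2) \<partial>lborel)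
    \<le> ennreal K * (\<integral>\<^sup>+x. indicator D x * ennreal ((\<phi> x)\<^sup>2 + (norm (\<gamma> x))\<^sup>2) \<partial>lborel)"
proof -
  define u v where "u = t - s" and "v = a - s"
  define d where "d = \<bar>u $ 1 * v $ 2 - u $ 2 * v $ 1\<bar>"
  have d: "d > 0" using det by (simp add: d_def u_def v_def)
  have inD: "s + \<alpha> *\<^sub>R u + \<beta> *\<^sub>R v \<in> D" if "0 \<le> \<alpha>" "\<alpha> \<le> 1/2" "0 < \<beta>" "\<beta> \<le> 1/2" for \<alpha> \<beta>
    unfolding u_def v_def using that by (intro triangle_point_in_open_convex D e a) auto
  \<comment> \<open>The factor 3 comes from the endpoint estimate, the maximum from bounding the
    derivative along \<open>v\<close> by the gradient, and \<open>1 / d\<close> from the Jacobian of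
    the coordinates.\<close>
  define K where "K = 3 * max 1 ((norm v)\<^sup>2) / d"
  have K: "K \<ge> 0" using d by (simp add: K_def)
  have "(\<integral>\<^sup>+\<alpha>. indicator {0..1/2} \<alpha> * ennreal ((\<phi> (s + \<alpha> *\<^sub>R u))\<^sup>2) \<partial>lborel)
    \<le> ennreal K * (\<integral>\<^sup>+x. indicator D x * ennreal ((\<phi> x)\<^sup>2 + (norm (\<gamma> x))\<^sup>2) \<partial>lborel)"
    if C1: "C1_with_gradient \<phi> \<gamma>" for \<phi> \<gamma>
  proof -
    note [measurable] = C1_with_gradient_measurable[OF C1]
    have [measurable]: "D \<in> sets borel" using D by simp
    define F where "F x = indicator D x * ennreal ((\<phi> x)\<^sup>2 + (norm (\<gamma> x))\<^sup>2)" for x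
    have [measurable]: "F \<in> borel_measurable borel" unfolding F_def[abs_def] by measurable
    have "indicator {0..1/2} \<alpha> * ennreal ((\<phi> (s + \<alpha> *\<^sub>R u))\<^sup>2)
       \<le> (\<integral>\<^sup>+\<beta>. ennreal (3 * max 1 ((norm v)\<^sup>2)) * F (s + \<alpha> *\<^sub>R u + \<beta> *\<^sub>R v) \<partial>lborel)" for \<alpha>
    proof (cases "\<alpha> \<in> {0..1/2}")
      case True
      have "indicator {0..1/2} \<alpha> * ennreal ((\<phi> (s + \<alpha> *\<^sub>R u))\<^sup>2) = ennreal ((\<phi> ((s + \<alpha> *\<^sub>R u) + 0 *\<^sub>R v))\<^sup>2)"
        using True by simp
      also have "\<dots> \<le> (\<integral>\<^sup>+\<beta>. indicator {0..1/2} \<beta> * ennreal (3 * ((\<phi> ((s + \<alpha> *\<^sub>R u) + \<beta> *\<^sub>R v))\<^sup>2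
          + (\<gamma> ((s + \<alpha> *\<^sub>R u) + \<beta> *\<^sub>R v) \<bullet> v)\<^sup>2)) \<partial>lborel)"
        by (rule square_endpoint_le_nn_integral[where g = "\<lambda>\<beta>. \<phi> ((s + \<alpha> *\<^sub>R u) + \<beta> *\<^sub>R v)"])
          (rule C1_with_gradient_line[OF C1])+
      also have "\<dots> \<le> (\<integral>\<^sup>+\<beta>. ennreal (3 * max 1 ((norm v)\<^sup>2)) * F (s + \<alpha> *\<^sub>R u + \<beta> *\<^sub>R v) \<partial>lborel)"
      \<comment> \<open>The single value \<beta> = 0 is discarded as a null set: the point then lies
        on the segment, which is only known to be in the closure of \<open>D\<close>.\<close>
      proof (rule nn_integral_mono_AE, rule AE_mp[OF AE_lborel_singleton[of 0]], rule AE_I2, rule impI)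
        fix \<beta> :: real assume "\<beta> \<noteq> 0"
        define x where "x = s + \<alpha> *\<^sub>R u + \<beta> *\<^sub>R v"
        show "indicator {0..1/2} \<beta> * ennreal (3 * ((\<phi> (s + \<alpha> *\<^sub>R u + \<beta> *\<^sub>R v))\<^sup>2
          + (\<gamma> (s + \<alpha> *\<^sub>R u + \<beta> *\<^sub>R v) \<bullet> v)\<^sup>2)) \<le> ennreal (3 * max 1 ((norm v)\<^sup>2)) * F (s + \<alpha> *\<^sub>R u + \<beta> *\<^sub>R v)"
        proof (cases "\<beta> \<in> {0..1/2}")
          case b: True
          then have xD: "x \<in> D" using inD[of \<alpha> \<beta>] True \<open>\<beta> \<noteq> 0\<close> by (simp add: x_def)
          have "(\<gamma> x \<bullet> v)\<^sup>2 \<le> (norm v)\<^sup>2 * (norm (\<gamma> x))\<^sup>2"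
            using Cauchy_Schwarz_ineq[of "\<gamma> x" v] by (simp add: power2_norm_eq_inner mult.commute)
          also have "\<dots> \<le> max 1 ((norm v)\<^sup>2) * (norm (\<gamma> x))\<^sup>2" by (intro mult_right_mono) auto
          finally have "3 * ((\<phi> x)\<^sup>2 + (\<gamma> x \<bullet> v)\<^sup>2) \<le> 3 * (max 1 ((norm v)\<^sup>2) * (\<phi> x)\<^sup>2 + max 1 ((norm v)\<^sup>2) * (norm (\<gamma> x))\<^sup>2)"
            using mult_right_mono[of 1 "max 1 ((norm v)\<^sup>2)" "(\<phi> x)\<^sup>2"] by simp
          then have "ennreal (3 * ((\<phi> x)\<^sup>2 + (\<gamma> x \<bullet> v)\<^sup>2)) \<le> ennreal (3 * max 1 ((norm v)\<^sup>2) * ((\<phi> x)\<^sup>2 + (norm (\<gamma> x))\<^sup>2))"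
            by (intro ennreal_leI) (simp add: algebra_simps)
          then show ?thesis using b xD by (simp add: F_def x_def[symmetric] ennreal_mult)
        qed simp
      qed
      finally show ?thesis .
    qed simp
    then have "(\<integral>\<^sup>+\<alpha>. indicator {0..1/2} \<alpha> * ennreal ((\<phi> (s + \<alpha> *\<^sub>R u))\<^sup>2) \<partial>lborel)
       \<le> (\<integral>\<^sup>+\<alpha>. \<integral>\<^sup>+\<beta>. ennreal (3 * max 1 ((norm v)\<^sup>2)) * F (s + \<alpha> *\<^sub>R u + \<beta> *\<^sub>R v) \<partial>lborel \<partial>lborel)"
      by (rule nn_integral_mono)
    also have "\<dots> = ennreal (3 * max 1 ((norm v)\<^sup>2)) * (\<integral>\<^sup>+\<alpha>. \<integral>\<^sup>+\<beta>. F (s + \<alpha> *\<^sub>R u + \<beta> *\<^sub>R v) \<partial>lborel \<partial>lborel)"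
      by (simp add: nn_integral_cmult)
    also have "ennreal (3 * max 1 ((norm v)\<^sup>2)) = ennreal K * ennreal d"
      using d K by (subst ennreal_mult[symmetric]) (auto simp: K_def)
    also have "ennreal K * ennreal d * (\<integral>\<^sup>+\<alpha>. \<integral>\<^sup>+\<beta>. F (s + \<alpha> *\<^sub>R u + \<beta> *\<^sub>R v) \<partial>lborel \<partial>lborel) = ennreal K * (\<integral>\<^sup>+z. F z \<partial>lborel)"
      using nn_integral_affine_coordinates[of F u v s] d unfolding d_def by (simp add: mult.assoc)
    finally show ?thesis by (simp add: F_def)
  qed
  with K that show thesis by (simp add: u_def)
qed

lemma nn_integral_split_half:
  fixes f :: "real \<Rightarrow> ennreal"
  assumes [measurable]: "f \<in> borel_measurable borel"
  shows "(\<integral>\<^sup>+t. indicator {0..1} t * f t \<partial>lborel) \<le>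
    (\<integral>\<^sup>+t. indicator {0..1/2} t * f t \<partial>lborel) + (\<integral>\<^sup>+t. indicator {0..1/2} t * f (1 - t) \<partial>lborel)"
proof -
  have "(\<integral>\<^sup>+t. indicator {0..1} t * f t \<partial>lborel) \<le>
    (\<integral>\<^sup>+t. indicator {0..1/2} t * f t + indicator {1/2..1} t * f t \<partial>(lborel :: real measure))"
    by (intro nn_integral_mono) (auto simp: indicator_def)
  also have "\<dots> = (\<integral>\<^sup>+t. indicator {0..1/2} t * f t \<partial>lborel) + (\<integral>\<^sup>+t. indicator {1/2..1} t * f t \<partial>lborel)"
    by (rule nn_integral_add) auto
  also have "(\<integral>\<^sup>+t. indicator {1/2..1} t * f t \<partial>lborel) =
      (\<integral>\<^sup>+t. indicator {1/2..1} (1 - t) * f (1 - t) \<partial>lborel)"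
    by (subst nn_integral_real_affine[where c = "-1" and t = 1]) auto
  also have "\<dots> = (\<integral>\<^sup>+t. indicator {0..1/2} t * f (1 - t) \<partial>lborel)"
    by (intro nn_integral_cong) (auto simp: indicator_def)
  finally show ?thesis .
qed

text \<open>The parallelogram at one endpoint reaches only half of the edge, so the endpoints are
  exchanged for the other half. The determinant condition holds for both orders of the endpoints
  because they span the same line.\<close>

lemma edge_trace_inequality:
  fixes s t a :: "real^2"
  assumes D: "open D" "convex D" and st: "s \<noteq> t" and e: "e = closed_segment s t" "e \<subseteq> closure D"
    and a: "a \<in> D" and det: "(t - s) $ 1 * (a - s) $ 2 - (t - s) $ 2 * (a - s) $ 1 \<noteq> 0"
  obtains K where "K \<ge> 0" "\<forall>\<phi> \<gamma>. C1_with_gradient \<phi> \<gamma> \<longrightarrow>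
    (\<integral>\<^sup>+x. ennreal ((\<phi> x)\<^sup>2) \<partial>edge_measure e)
    \<le> ennreal K * (\<integral>\<^sup>+x. indicator D x * ennreal ((\<phi> x)\<^sup>2 + (norm (\<gamma> x))\<^sup>2) \<partial>lborel)"
proof -
  obtain s' t' where st': "s' \<noteq> t'" "e = closed_segment s' t'"
    and nn: "\<forall>F. F \<in> borel_measurable borel \<longrightarrow> (\<integral>\<^sup>+x. F x \<partial>edge_measure e) =
      ennreal (dist s' t') * (\<integral>\<^sup>+r. indicator {0..1} r * F (s' + r *\<^sub>R (t' - s')) \<partial>lborel)"
    by (rule nn_integral_edge_measure[OF st e(1)])
  have "{s', t'} = {s, t}" using st' e by (simp add: closed_segment_eq)
  then consider "s' = s" "t' = t" | "s' = t" "t' = s" by (auto simp: doubleton_eq_iff)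
  then have det1: "(t' - s') $ 1 * (a - s') $ 2 - (t' - s') $ 2 * (a - s') $ 1 \<noteq> 0"
    and det2: "(s' - t') $ 1 * (a - t') $ 2 - (s' - t') $ 2 * (a - t') $ 1 \<noteq> 0"
    using det by (cases; simp add: algebra_simps)+
  have sub1: "closed_segment s' t' \<subseteq> closure D" and sub2: "closed_segment t' s' \<subseteq> closure D"
    using e(2) st'(2) by (simp_all add: closed_segment_commute)
  obtain K1 where K1: "K1 \<ge> 0" "\<forall>\<phi> \<gamma>. C1_with_gradient \<phi> \<gamma> \<longrightarrow>
    (\<integral>\<^sup>+\<alpha>. indicator {0..1/2} \<alpha> * ennreal ((\<phi> (s' + \<alpha> *\<^sub>R (t' - s')))\<^sup>2) \<partial>lborel)
    \<le> ennreal K1 * (\<integral>\<^sup>+x. indicator D x * ennreal ((\<phi> x)\<^sup>2 + (norm (\<gamma> x))\<^sup>2) \<partial>lborel)"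
    by (rule half_edge_trace_inequality[OF D sub1 a det1])
  obtain K2 where K2: "K2 \<ge> 0" "\<forall>\<phi> \<gamma>. C1_with_gradient \<phi> \<gamma> \<longrightarrow>
    (\<integral>\<^sup>+\<alpha>. indicator {0..1/2} \<alpha> * ennreal ((\<phi> (t' + \<alpha> *\<^sub>R (s' - t')))\<^sup>2) \<partial>lborel)
    \<le> ennreal K2 * (\<integral>\<^sup>+x. indicator D x * ennreal ((\<phi> x)\<^sup>2 + (norm (\<gamma> x))\<^sup>2) \<partial>lborel)"
    by (rule half_edge_trace_inequality[OF D sub2 a det2])
  define K where "K = dist s' t' * (K1 + K2)"
  have K: "K \<ge> 0" using K1(1) K2(1) by (simp add: K_def)
  have "(\<integral>\<^sup>+x. ennreal ((\<phi> x)\<^sup>2) \<partial>edge_measure e)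
    \<le> ennreal K * (\<integral>\<^sup>+x. indicator D x * ennreal ((\<phi> x)\<^sup>2 + (norm (\<gamma> x))\<^sup>2) \<partial>lborel)" (is "_ \<le> _ * ?I")
    if C1: "C1_with_gradient \<phi> \<gamma>" for \<phi> \<gamma>
  proof -
    note [measurable] = C1_with_gradient_measurable[OF C1]
    have flip: "s' + (1 - r) *\<^sub>R (t' - s') = t' + r *\<^sub>R (s' - t')" for r
      by (simp add: algebra_simps)
    have "(\<integral>\<^sup>+x. ennreal ((\<phi> x)\<^sup>2) \<partial>edge_measure e) = ennreal (dist s' t') *
        (\<integral>\<^sup>+r. indicator {0..1} r * ennreal ((\<phi> (s' + r *\<^sub>R (t' - s')))\<^sup>2) \<partial>lborel)"
      by (rule nn[rule_format]) simp
    also have "\<dots> \<le> ennreal (dist s' t') * (ennreal K1 * ?I + ennreal K2 * ?I)"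
      using nn_integral_split_half[of "\<lambda>r. ennreal ((\<phi> (s' + r *\<^sub>R (t' - s')))\<^sup>2)"] K1(2)[rule_format, OF C1] K2(2)[rule_format, OF C1]
      unfolding flip by (intro mult_left_mono) (auto intro: order_trans add_mono)
    also have "\<dots> = ennreal K * ?I"
      using K1(1) K2(1) by (simp add: K_def ennreal_mult ennreal_plus distrib_right distrib_left mult.assoc)
    finally show ?thesis .
  qed
  with K that show thesis by blast
qed

section \<open>The Poincare inequality on convex domains\<close>

text \<open>The contraction towards \<open>y\<close> maps the convex set \<open>D\<close> into
  itself and has Jacobian \<open>t^2 \<ge> 1/4\<close>; this is the origin of the factor 4.\<close>

lemma nn_integral_contraction_le:
  fixes q :: "real^2 \<Rightarrow> ennreal"
  assumes D: "open D" "convex D" and q [measurable]: "q \<in> borel_measurable borel"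
    and t: "1/2 \<le> t" "t \<le> 1" and y: "y \<in> D"
  shows "(\<integral>\<^sup>+x. indicator D x * q (y + t *\<^sub>R (x - y)) \<partial>lborel) \<le> 4 * (\<integral>\<^sup>+x. indicator D x * q x \<partial>lborel)"
proof -
  have [measurable]: "D \<in> sets borel" using D by simp
  define G where "G x = indicator D x * q x" for x
  have [measurable]: "G \<in> borel_measurable borel" unfolding G_def[abs_def] by measurable
  define X where "X = (\<integral>\<^sup>+x. G ((1 - t) *\<^sub>R y + t *\<^sub>R x) \<partial>lborel)"
  have "(\<integral>\<^sup>+x. indicator D x * q (y + t *\<^sub>R (x - y)) \<partial>lborel) \<le> X"
    unfolding X_def
  proof (rule nn_integral_mono)
    fix x
    have "(1 - t) *\<^sub>R y + t *\<^sub>R x \<in> D" if "x \<in> D"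
      using convexD[OF D(2) y that, of "1 - t" t] t by auto
    moreover have "(1 - t) *\<^sub>R y + t *\<^sub>R x = y + t *\<^sub>R (x - y)" by (simp add: algebra_simps)
    ultimately show "indicator D x * q (y + t *\<^sub>R (x - y)) \<le> G ((1 - t) *\<^sub>R y + t *\<^sub>R x)"
      by (auto simp: G_def indicator_def)
  qed
  also have "X \<le> ennreal (4 * t\<^sup>2) * X"
  proof -
    have "(1/2)\<^sup>2 \<le> t\<^sup>2" using t by (intro power_mono) auto
    then have "1 \<le> ennreal (4 * t\<^sup>2)" by (simp add: power2_eq_square)
    then have "1 * X \<le> ennreal (4 * t\<^sup>2) * X" by (rule mult_right_mono) simp
    then show ?thesis by simp
  qed
  also have "ennreal (4 * t\<^sup>2) * X = 4 * (ennreal (t\<^sup>2) * X)"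
    by (simp add: ennreal_mult mult.assoc)
  also have "ennreal (t\<^sup>2) * X = (\<integral>\<^sup>+x. G x \<partial>lborel)"
    using t unfolding X_def
    by (subst (2) lborel_affine[of t "(1 - t) *\<^sub>R y"])
      (auto simp: nn_integral_density nn_integral_distr nn_integral_cmult)
  finally show ?thesis by (simp add: G_def)
qed

text \<open>\<open>\<phi> x - \<phi> y\<close> is the integral of the gradient over \<open>y + t (x - y)\<close>. Substituting for \<open>x\<close> when \<open>t \<ge> 1/2\<close>
  and for \<open>y\<close> when \<open>t < 1/2\<close> keeps the Jacobian bounded away from zero.\<close>

lemma Poincare_double_integral:
  fixes \<phi> :: "real^2 \<Rightarrow> real"
  assumes D: "open D" "convex D" and d: "\<And>x y. x \<in> D \<Longrightarrow> y \<in> D \<Longrightarrow> dist x y \<le> d"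
    and C1: "C1_with_gradient \<phi> \<gamma>"
  shows "(\<integral>\<^sup>+x. \<integral>\<^sup>+y. indicator D x * (indicator D y * ennreal ((\<phi> x - \<phi> y)\<^sup>2)) \<partial>lborel \<partial>lborel)
    \<le> ennreal (4 * d\<^sup>2) * (emeasure lborel D * (\<integral>\<^sup>+x. indicator D x * ennreal ((norm (\<gamma> x))\<^sup>2) \<partial>lborel))"
proof -
  note [measurable] = C1_with_gradient_measurable[OF C1]
  have [measurable]: "D \<in> sets borel" using D by simp
  define q where "q x = ennreal ((norm (\<gamma> x))\<^sup>2)" for x
  have [measurable]: "q \<in> borel_measurable borel" unfolding q_def[abs_def] by measurable
  define I where "I = (\<integral>\<^sup>+x. indicator D x * q x \<partial>lborel)"
  define W where "W t x y = indicator D x * (indicator D y * q (y + t *\<^sub>R (x - y)))" for t x y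
  have pt: "indicator D x * (indicator D y * ennreal ((\<phi> x - \<phi> y)\<^sup>2))
      \<le> (\<integral>\<^sup>+t. indicator {0..1} t * (ennreal (d\<^sup>2) * W t x y) \<partial>lborel)" for x y
  proof (cases "x \<in> D \<and> y \<in> D")
    case True
    have "ennreal ((\<phi> (y + 1 *\<^sub>R (x - y)) - \<phi> (y + 0 *\<^sub>R (x - y)))\<^sup>2)
        \<le> (\<integral>\<^sup>+t. indicator {0..1} t * ennreal ((\<gamma> (y + t *\<^sub>R (x - y)) \<bullet> (x - y))\<^sup>2) \<partial>lborel)"
      by (rule square_diff_le_nn_integral_derivative) (rule C1_with_gradient_line[OF C1])+
    also have "\<dots> \<le> (\<integral>\<^sup>+t. indicator {0..1} t * (ennreal (d\<^sup>2) * W t x y) \<partial>lborel)"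
    proof (intro nn_integral_mono mult_left_mono)
      fix t :: real
      define z where "z = y + t *\<^sub>R (x - y)"
      have "(\<gamma> z \<bullet> (x - y))\<^sup>2 \<le> (norm (x - y))\<^sup>2 * (norm (\<gamma> z))\<^sup>2"
        using Cauchy_Schwarz_ineq[of "\<gamma> z" "x - y"] by (simp add: power2_norm_eq_inner mult.commute)
      also have "\<dots> \<le> d\<^sup>2 * (norm (\<gamma> z))\<^sup>2"
        using d[of x y] True by (intro mult_right_mono power_mono) (auto simp: dist_norm)
      finally have "ennreal ((\<gamma> z \<bullet> (x - y))\<^sup>2) \<le> ennreal (d\<^sup>2) * ennreal ((norm (\<gamma> z))\<^sup>2)"
        by (simp add: ennreal_mult[symmetric] ennreal_leI)
      then show "ennreal ((\<gamma> (y + t *\<^sub>R (x - y)) \<bullet> (x - y))\<^sup>2) \<le> ennreal (d\<^sup>2) * W t x y"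
        using True by (simp add: W_def q_def z_def)
    qed simp
    finally show ?thesis using True by simp
  qed auto
  have Wm [measurable]: "(\<lambda>(t, x, y). W t x y) \<in> borel_measurable (borel \<Otimes>\<^sub>M borel \<Otimes>\<^sub>M borel)"
    unfolding W_def by measurable
  have W: "(\<integral>\<^sup>+x. \<integral>\<^sup>+y. W t x y \<partial>lborel \<partial>lborel) \<le> 4 * (emeasure lborel D * I)" if t: "0 \<le> t" "t \<le> 1" for t
  proof (cases "1/2 \<le> t")
    case True
    have "(\<integral>\<^sup>+x. \<integral>\<^sup>+y. W t x y \<partial>lborel \<partial>lborel) = (\<integral>\<^sup>+y. \<integral>\<^sup>+x. W t x y \<partial>lborel \<partial>lborel)"
      by (rule lborel_pair.Fubini'[symmetric]) (simp add: W_def)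
    also have "\<dots> = (\<integral>\<^sup>+y. indicator D y * (\<integral>\<^sup>+x. indicator D x * q (y + t *\<^sub>R (x - y)) \<partial>lborel) \<partial>lborel)"
      by (subst nn_integral_cmult[symmetric]) (auto simp: W_def mult_ac)
    also have "\<dots> \<le> (\<integral>\<^sup>+y. indicator D y * (4 * I) \<partial>lborel)"
    proof (rule nn_integral_mono)
      fix y show "indicator D y * (\<integral>\<^sup>+x. indicator D x * q (y + t *\<^sub>R (x - y)) \<partial>lborel) \<le> indicator D y * (4 * I)"
        using nn_integral_contraction_le[OF D _ True t(2), of q y] by (cases "y \<in> D") (auto simp: I_def)
    qed
    also have "\<dots> = 4 * (emeasure lborel D * I)"
      by (subst nn_integral_multc) (auto simp: mult_ac)
    finally show ?thesis .
  next
    case False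
    have flip: "y + t *\<^sub>R (x - y) = x + (1 - t) *\<^sub>R (y - x)" for x y :: "real^2"
      by (simp add: algebra_simps)
    have "(\<integral>\<^sup>+x. \<integral>\<^sup>+y. W t x y \<partial>lborel \<partial>lborel) =
        (\<integral>\<^sup>+x. indicator D x * (\<integral>\<^sup>+y. indicator D y * q (x + (1 - t) *\<^sub>R (y - x)) \<partial>lborel) \<partial>lborel)"
      unfolding W_def[abs_def] flip by (simp add: nn_integral_cmult)
    also have "\<dots> \<le> (\<integral>\<^sup>+x. indicator D x * (4 * I) \<partial>lborel)"
    proof (rule nn_integral_mono)
      fix x show "indicator D x * (\<integral>\<^sup>+y. indicator D y * q (x + (1 - t) *\<^sub>R (y - x)) \<partial>lborel) \<le> indicator D x * (4 * I)"
        using nn_integral_contraction_le[OF D, of q "1 - t" x] False t by (cases "x \<in> D") (auto simp: I_def)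
    qed
    also have "\<dots> = 4 * (emeasure lborel D * I)"
      by (subst nn_integral_multc) (auto simp: mult_ac)
    finally show ?thesis .
  qed
  define V where "V t x y = indicator {0..1} t * (ennreal (d\<^sup>2) * W t x y)" for t x y
  have Vm [measurable]: "(\<lambda>(t, x, y). V t x y) \<in> borel_measurable (borel \<Otimes>\<^sub>M borel \<Otimes>\<^sub>M borel)"
    unfolding V_def W_def by measurable
  have "(\<integral>\<^sup>+x. \<integral>\<^sup>+y. indicator D x * (indicator D y * ennreal ((\<phi> x - \<phi> y)\<^sup>2)) \<partial>lborel \<partial>lborel)
    \<le> (\<integral>\<^sup>+x. \<integral>\<^sup>+y. \<integral>\<^sup>+t. V t x y \<partial>lborel \<partial>lborel \<partial>lborel)"
    unfolding V_def by (intro nn_integral_mono pt)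
  \<comment> \<open>Fubini moves \<open>t\<close> to the outside, since the bound on
    \<open>W\<close> holds for each fixed \<open>t\<close> and chooses the variable to substitute
    according to \<open>t\<close>.\<close>
  also have "\<dots> = (\<integral>\<^sup>+x. \<integral>\<^sup>+t. \<integral>\<^sup>+y. V t x y \<partial>lborel \<partial>lborel \<partial>lborel)"
    by (intro nn_integral_cong lborel_pair.Fubini') (simp add: V_def W_def)
  also have "\<dots> = (\<integral>\<^sup>+t. \<integral>\<^sup>+x. \<integral>\<^sup>+y. V t x y \<partial>lborel \<partial>lborel \<partial>lborel)"
    by (rule lborel_pair.Fubini') (simp add: V_def[abs_def] W_def)
  also have "\<dots> = (\<integral>\<^sup>+t. indicator {0..1} t * (ennreal (d\<^sup>2) * (\<integral>\<^sup>+x. \<integral>\<^sup>+y. W t x y \<partial>lborel \<partial>lborel)) \<partial>lborel)"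
    unfolding V_def by (simp add: nn_integral_cmult W_def)
  also have "\<dots> \<le> (\<integral>\<^sup>+t. indicator {0..1} t * (ennreal (d\<^sup>2) * (4 * (emeasure lborel D * I))) \<partial>(lborel :: real measure))"
  proof (rule nn_integral_mono)
    fix t :: real
    show "indicator {0..1} t * (ennreal (d\<^sup>2) * (\<integral>\<^sup>+x. \<integral>\<^sup>+y. W t x y \<partial>lborel \<partial>lborel))
      \<le> indicator {0..1} t * (ennreal (d\<^sup>2) * (4 * (emeasure lborel D * I)))"
      using W[of t] by (cases "t \<in> {0..1}") (auto intro: mult_left_mono)
  qed
  also have "\<dots> = ennreal (4 * d\<^sup>2) * (emeasure lborel D * I)"
    by (subst nn_integral_multc) (auto simp: ennreal_mult mult_ac)
  finally show ?thesis by (simp add: I_def q_def)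
qed

text \<open>A suitable constant is found among the values \<open>\<phi> y\<close>: if none were
  good, integrating over \<open>y\<close> would exceed the bound on the double integral. The slack
  \<open>e\<close> makes the contradiction numerical, \<open>r * (L + e) \<le> r * L\<close> with
  \<open>r\<close> the positive finite area of \<open>D\<close>.\<close>

lemma Poincare_inequality_C1:
  fixes \<phi> :: "real^2 \<Rightarrow> real"
  assumes D: "open D" "convex D" "D \<noteq> {}" "bounded D"
    and d: "\<And>x y. x \<in> D \<Longrightarrow> y \<in> D \<Longrightarrow> dist x y \<le> d"
    and C1: "C1_with_gradient \<phi> \<gamma>" and e: "e > 0"
    and fin: "(\<integral>\<^sup>+x. indicator D x * ennreal ((norm (\<gamma> x))\<^sup>2) \<partial>lborel) < \<infinity>"
  shows "\<exists>c. (\<integral>\<^sup>+x. indicator D x * ennreal ((\<phi> x - c)\<^sup>2) \<partial>lborel)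
    \<le> ennreal (4 * d\<^sup>2) * (\<integral>\<^sup>+x. indicator D x * ennreal ((norm (\<gamma> x))\<^sup>2) \<partial>lborel) + ennreal e"
proof (rule ccontr)
  assume neg: "\<not> ?thesis"
  note [measurable] = C1_with_gradient_measurable[OF C1]
  have [measurable]: "D \<in> sets borel" using D by simp
  define I where "I = (\<integral>\<^sup>+x. indicator D x * ennreal ((norm (\<gamma> x))\<^sup>2) \<partial>lborel)"
  define m where "m = emeasure lborel D"
  have m: "m \<noteq> 0" "m < \<infinity>"
    using D emeasure_bounded_finite[of D] open_not_negligible[of D]
    by (auto simp: m_def negligible_iff_emeasure0)
  have "m * (ennreal (4 * d\<^sup>2) * I + ennreal e) = (\<integral>\<^sup>+y. indicator D y * (ennreal (4 * d\<^sup>2) * I + ennreal e) \<partial>lborel)"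
    by (simp add: nn_integral_multc m_def)
  also have "\<dots> \<le> (\<integral>\<^sup>+y. indicator D y * (\<integral>\<^sup>+x. indicator D x * ennreal ((\<phi> x - \<phi> y)\<^sup>2) \<partial>lborel) \<partial>lborel)"
    using neg by (intro nn_integral_mono mult_left_mono) (auto simp: I_def not_le less_imp_le)
  also have "\<dots> = (\<integral>\<^sup>+y. \<integral>\<^sup>+x. indicator D y * (indicator D x * ennreal ((\<phi> x - \<phi> y)\<^sup>2)) \<partial>lborel \<partial>lborel)"
    by (simp add: nn_integral_cmult)
  also have "\<dots> = (\<integral>\<^sup>+y. \<integral>\<^sup>+x. indicator D y * (indicator D x * ennreal ((\<phi> y - \<phi> x)\<^sup>2)) \<partial>lborel \<partial>lborel)"
    by (simp add: power2_commute)
  also have "\<dots> \<le> ennreal (4 * d\<^sup>2) * (m * I)"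
    unfolding I_def m_def by (rule Poincare_double_integral[OF D(1,2) d C1])
  finally have le: "m * (ennreal (4 * d\<^sup>2) * I + ennreal e) \<le> m * (ennreal (4 * d\<^sup>2) * I)"
    by (simp add: mult_ac)
  define L where "L = enn2real (ennreal (4 * d\<^sup>2) * I)"
  have L: "ennreal (4 * d\<^sup>2) * I = ennreal L" "L \<ge> 0"
    using fin by (auto simp: L_def I_def[symmetric] ennreal_mult_less_top less_top)
  obtain r where r: "m = ennreal r" "r > 0"
    using m by (cases m) (auto simp: top_unique)
  have "r * (L + e) \<le> r * L"
    using le e r L by (simp add: L ennreal_mult[symmetric] ennreal_plus[symmetric] del: ennreal_plus)
  then show False using r e by (simp add: algebra_simps mult_le_0_iff)
qed

section \<open>Continuously differentiable functions\<close>

lemma C1_with_gradient_const: "C1_with_gradient (\<lambda>x. c) (\<lambda>x. 0)"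
  by (simp add: C1_with_gradient_def GDERIV_const)

lemma C1_with_gradient_add:
  assumes "C1_with_gradient \<phi> g" "C1_with_gradient \<psi> h"
  shows "C1_with_gradient (\<lambda>x. \<phi> x + \<psi> x) (\<lambda>x. g x + h x)"
  using assms by (auto simp: C1_with_gradient_def intro!: GDERIV_add continuous_intros)

lemma C1_with_gradient_mult:
  assumes "C1_with_gradient \<phi> g" "C1_with_gradient \<psi> h"
  shows "C1_with_gradient (\<lambda>x. \<phi> x * \<psi> x) (\<lambda>x. \<phi> x *\<^sub>R h x + \<psi> x *\<^sub>R g x)"
  using assms C1_with_gradient_continuous[OF assms(1)] C1_with_gradient_continuous[OF assms(2)]
  by (auto simp: C1_with_gradient_def intro!: GDERIV_mult continuous_intros)

lemma C1_with_gradient_compose: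
  assumes C1: "C1_with_gradient \<phi> g"
    and d: "\<And>t. (\<theta> has_real_derivative \<theta>' t) (at t)" "continuous_on UNIV \<theta>'"
  shows "C1_with_gradient (\<lambda>x. \<theta> (\<phi> x)) (\<lambda>x. \<theta>' (\<phi> x) *\<^sub>R g x)"
  using C1 C1_with_gradient_continuous[OF C1]
  by (auto simp: C1_with_gradient_def intro!: GDERIV_DERIV_compose[where g = \<theta>] d continuous_intros
      continuous_on_compose2[OF d(2)])

lemma C1_with_gradient_affine: "C1_with_gradient (\<lambda>x. c + x \<bullet> v) (\<lambda>x. v)"
  unfolding C1_with_gradient_def gderiv_def by (auto intro!: derivative_eq_intros)

lemma C1_with_gradient_zero_on_open:
  assumes C1: "C1_with_gradient \<phi> g" and "open S" "x \<in> S" and z: "\<And>y. y \<in> S \<Longrightarrow> \<phi> y = 0"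
  shows "g x = 0"
proof -
  have "(\<phi> has_derivative (\<lambda>h. h \<bullet> g x)) (at x)"
    using C1 by (simp add: C1_with_gradient_def gderiv_def)
  moreover have "(\<phi> has_derivative (\<lambda>h. 0)) (at x)"
    using has_derivative_transform_within_open[OF has_derivative_const[of 0 "at x"] assms(2,3)] z
    by metis
  ultimately have "(\<lambda>h. h \<bullet> g x) = (\<lambda>h. 0)" by (rule has_derivative_unique)
  then show ?thesis by (metis inner_eq_zero_iff)
qed

lemma test_function_zero_outside:
  assumes "test_function D \<phi> g" "x \<notin> D"
  shows "\<phi> x = 0" "g x = 0"
proof -
  define K where "K = closure {x. \<phi> x \<noteq> 0}"
  have K: "K \<subseteq> D" "C1_with_gradient \<phi> g" using assms(1) by (auto simp: test_function_def K_def)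
  have z: "\<phi> y = 0" if "y \<in> - K" for y
    using that closure_subset[of "{x. \<phi> x \<noteq> 0}"] by (auto simp: K_def)
  have x: "x \<in> - K" using K assms(2) by auto
  show "\<phi> x = 0" using z x by blast
  have "open (- K)" unfolding K_def by (intro open_Compl closed_closure)
  from C1_with_gradient_zero_on_open[OF K(2) this x z] show "g x = 0" by blast
qed

lemma C1_with_gradient_bounded:
  assumes C1: "C1_with_gradient \<phi> g" and "bounded S"
  obtains B where "B \<ge> 0" "\<And>x. x \<in> S \<Longrightarrow> \<bar>\<phi> x\<bar> \<le> B" "\<And>x. x \<in> S \<Longrightarrow> norm (g x) \<le> B"
proof -
  have cp: "compact (closure S)" using assms(2) by simp
  have "bounded (\<phi> ` closure S)" "bounded (g ` closure S)"
    using C1_with_gradient_continuous[OF C1] cp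
    by (auto intro!: compact_imp_bounded compact_continuous_image intro: continuous_on_subset)
  then obtain B1 B2 where B: "\<forall>x\<in>closure S. norm (\<phi> x) \<le> B1" "\<forall>x\<in>closure S. norm (g x) \<le> B2"
    by (auto simp: bounded_iff)
  have "x \<in> closure S" if "x \<in> S" for x using that closure_subset by blast
  then have "\<bar>\<phi> x\<bar> \<le> max 0 (max B1 B2)" "norm (g x) \<le> max 0 (max B1 B2)" if "x \<in> S" for x
    using B that by (force simp: le_max_iff_disj)+
  with that[of "max 0 (max B1 B2)"] show thesis by simp
qed

text \<open>Source of all integrations by parts. The directional derivative is the limit of the
  difference quotients \<open>q n\<close>, and each of these has integral zero by translation
  invariance.\<close>

lemma integral_lborel_gradient_eq_0:
  fixes \<beta> :: "real^2 \<Rightarrow> real"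
  assumes C1: "C1_with_gradient \<beta> g" and cp: "compact (closure {x. \<beta> x \<noteq> 0})"
  shows "(LINT x|lborel. g x \<bullet> v) = 0"
proof -
  note [measurable] = C1_with_gradient_measurable[OF C1]
  define K where "K = closure {x. \<beta> x \<noteq> 0}"
  have T: "test_function K \<beta> g" using C1 cp by (simp add: test_function_def K_def)
  note zero = test_function_zero_outside[OF T]
  obtain B where B: "B \<ge> 0" "\<And>x. x \<in> K \<Longrightarrow> norm (g x) \<le> B"
    using C1_with_gradient_bounded[OF C1 compact_imp_bounded[OF cp]] unfolding K_def by metis
  have B': "norm (g x) \<le> B" for x using B zero[of x] by (cases "x \<in> K") auto
  obtain R where R: "\<And>x. x \<in> K \<Longrightarrow> norm x \<le> R"
    using compact_imp_bounded[OF cp] by (auto simp: K_def bounded_iff)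
  \<comment> \<open>All shifts have length at most \<open>norm v\<close>, so this ball contains the
    supports of all difference quotients and carries an integrable majorant.\<close>
  define C where "C = cball (0::real^2) (R + norm v)"
  define q where "q n x = (\<beta> (x + (1 / real (Suc n)) *\<^sub>R v) - \<beta> x) * real (Suc n)" for n x
  have lip: "\<bar>\<beta> x - \<beta> y\<bar> \<le> B * norm (x - y)" for x y
  proof -
    have "norm (\<beta> x - \<beta> y) \<le> B * norm (x - y)"
    proof (rule differentiable_bound[where S = UNIV and f' = "\<lambda>x h. h \<bullet> g x"])
      show "onorm (\<lambda>h. h \<bullet> g x) \<le> B" for x
        using B(1) B'[of x] by (intro onorm_bound) (auto intro!: order_trans[OF Cauchy_Schwarz_ineq2]
            simp: mult.commute[of B] mult_left_mono)
    qed (use C1 in \<open>auto simp: C1_with_gradient_def gderiv_def\<close>)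
    then show ?thesis by simp
  qed
  have \<beta>i: "integrable lborel \<beta>"
  proof -
    have "integrable lborel (\<lambda>x. indicator K x *\<^sub>R \<beta> x)"
      using C1_with_gradient_continuous[OF C1] cp
      by (intro borel_integrable_compact) (auto simp: K_def intro: continuous_on_subset)
    moreover have "(\<lambda>x. indicator K x *\<^sub>R \<beta> x) = \<beta>"
      using zero by (auto simp: indicator_def fun_eq_iff)
    ultimately show ?thesis by simp
  qed
  have int0: "(LINT x|lborel. q n x) = 0" for n
  proof -
    define w where "w = (1 / real (Suc n)) *\<^sub>R v"
    have i: "integrable lborel (\<lambda>x. \<beta> (w + x))" "(LINT x|lborel. \<beta> (w + x)) = (LINT x|lborel. \<beta> x)"
    proof -
      have "integrable (distr lborel borel ((+) w)) \<beta>" using \<beta>i by (simp add: lborel_distr_plus)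
      then show "integrable lborel (\<lambda>x. \<beta> (w + x))" by (subst (asm) integrable_distr_eq) auto
      have "(LINT x|distr lborel borel ((+) w). \<beta> x) = (LINT x|lborel. \<beta> (w + x))"
        by (rule integral_distr) auto
      then show "(LINT x|lborel. \<beta> (w + x)) = (LINT x|lborel. \<beta> x)" by (simp add: lborel_distr_plus)
    qed
    have "(LINT x|lborel. (\<beta> (w + x) - \<beta> x) * real (Suc n)) = 0"
      using i \<beta>i by simp
    then show ?thesis by (simp add: q_def w_def add.commute)
  qed
  have "(\<lambda>n. LINT x|lborel. q n x) \<longlonglongrightarrow> (LINT x|lborel. g x \<bullet> v)"
  proof (rule integral_dominated_convergence[where w = "\<lambda>x. indicator C x *\<^sub>R (B * norm v)"])
    show "integrable lborel (\<lambda>x. indicator C x *\<^sub>R (B * norm v))"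
      by (auto simp: C_def intro!: integrable_indicator emeasure_lborel_cball_finite)
    show "AE x in lborel. (\<lambda>n. q n x) \<longlonglongrightarrow> g x \<bullet> v"
    proof (rule AE_I2)
      fix x
      have "((\<lambda>t. \<beta> (x + t *\<^sub>R v)) has_real_derivative g (x + 0 *\<^sub>R v) \<bullet> v) (at 0)"
        by (rule C1_with_gradient_line[OF C1])
      then have "((\<lambda>h. (\<beta> (x + h *\<^sub>R v) - \<beta> x) / h) \<longlongrightarrow> g x \<bullet> v) (at 0)"
        by (simp add: DERIV_def)
      moreover have "filterlim (\<lambda>n. 1 / real (Suc n)) (at 0) sequentially"
        using LIMSEQ_inverse_real_of_nat by (auto simp: filterlim_at inverse_eq_divide)
      ultimately have "(\<lambda>n. (\<beta> (x + (1 / real (Suc n)) *\<^sub>R v) - \<beta> x) / (1 / real (Suc n))) \<longlonglongrightarrow> g x \<bullet> v"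
        by (rule filterlim_compose)
      then show "(\<lambda>n. q n x) \<longlonglongrightarrow> g x \<bullet> v" by (simp add: q_def)
    qed
    show "AE x in lborel. norm (q n x) \<le> indicator C x *\<^sub>R (B * norm v)" for n
    proof (rule AE_I2)
      fix x
      have s: "norm ((1 / real (Suc n)) *\<^sub>R v) \<le> norm v" by (simp add: field_simps)
      have "\<bar>q n x\<bar> \<le> B * norm ((1 / real (Suc n)) *\<^sub>R v) * real (Suc n)"
        using lip[of "x + (1 / real (Suc n)) *\<^sub>R v" x] unfolding q_def abs_mult
        by (intro mult_mono) auto
      also have "\<dots> = B * norm v" by simp
      finally have b: "\<bar>q n x\<bar> \<le> B * norm v" .
      have "q n x = 0" if "x \<notin> C"
      proof -
        have nx: "norm x > R + norm v" using that by (simp add: C_def)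
        then have "x \<notin> K" using R norm_ge_zero[of v] by fastforce
        moreover have "norm x \<le> norm (x + (1 / real (Suc n)) *\<^sub>R v) + norm ((1 / real (Suc n)) *\<^sub>R v)"
          using norm_triangle_ineq4[of "x + (1 / real (Suc n)) *\<^sub>R v" "(1 / real (Suc n)) *\<^sub>R v"] by simp
        then have "x + (1 / real (Suc n)) *\<^sub>R v \<notin> K" using R nx s by fastforce
        ultimately show ?thesis using zero by (simp add: q_def)
      qed
      with b show "norm (q n x) \<le> indicator C x *\<^sub>R (B * norm v)" by (cases "x \<in> C") auto
    qed
  qed (auto simp: q_def)
  then show ?thesis by (simp add: int0 LIMSEQ_const_iff)
qed

section \<open>Integrals over a domain, and C1 functions as elements of H1\<close>

lemma integral_lebesgue_on_borel:
  fixes f :: "'a::euclidean_space \<Rightarrow> 'b::{banach, second_countable_topology}"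
  assumes "D \<in> sets borel" "f \<in> borel_measurable borel" "\<And>x. x \<notin> D \<Longrightarrow> f x = 0"
  shows "(LINT x|lebesgue_on D. f x) = (LINT x|lborel. f x)"
proof -
  have "(LINT x|lebesgue_on D. f x) = (LINT x|lebesgue. indicator D x *\<^sub>R f x)"
    using assms(1) by (subst integral_restrict_space) auto
  also have "\<dots> = (LINT x|lebesgue. f x)"
    using assms(3) by (intro Bochner_Integration.integral_cong) (auto simp: indicator_def)
  also have "\<dots> = (LINT x|lborel. f x)"
    using assms(2) by (intro integral_completion) simp
  finally show ?thesis .
qed

lemma nn_integral_lebesgue_on:
  assumes "D \<in> sets borel"
  shows "(\<integral>\<^sup>+x. f x \<partial>lebesgue_on D) = (\<integral>\<^sup>+x. indicator D x * f x \<partial>(lborel :: 'a::euclidean_space measure))"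
  using assms by (simp add: nn_integral_restrict_space nn_integral_completion mult.commute)

lemma finite_measure_lebesgue_on_bounded:
  fixes D :: "'a::euclidean_space set"
  assumes "D \<in> sets borel" "bounded D"
  shows "finite_measure (lebesgue_on D)"
proof (rule finite_measureI)
  have "emeasure (lebesgue_on D) (space (lebesgue_on D)) = emeasure lborel D"
    using assms(1) by (simp add: emeasure_restrict_space space_restrict_space emeasure_completion)
  then show "emeasure (lebesgue_on D) (space (lebesgue_on D)) \<noteq> \<infinity>"
    using emeasure_bounded_finite[OF assms(2)] by simp
qed

lemma borel_measurable_lebesgue_on:
  "f \<in> borel_measurable borel \<Longrightarrow> f \<in> borel_measurable (lebesgue_on D)"
  by (intro measurable_restrict_space1 measurable_completion) simp

lemma L2_C1:
  assumes D: "D \<in> sets borel" "bounded D" and C1: "C1_with_gradient \<phi> g"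
  shows "L2 (lebesgue_on D) \<phi>" "L2 (lebesgue_on D) g"
proof -
  obtain B where B: "B \<ge> 0" "\<And>x. x \<in> D \<Longrightarrow> \<bar>\<phi> x\<bar> \<le> B" "\<And>x. x \<in> D \<Longrightarrow> norm (g x) \<le> B"
    using C1_with_gradient_bounded[OF C1 D(2)] by metis
  show "L2 (lebesgue_on D) \<phi>" "L2 (lebesgue_on D) g"
    using B C1_with_gradient_measurable[OF C1]
    by (auto intro!: L2_bounded[of _ _ B] finite_measure_lebesgue_on_bounded D borel_measurable_lebesgue_on
        AE_I2 simp: space_restrict_space)
qed

lemma integral_inner_eq_imp_eq:
  fixes f g :: "'a \<Rightarrow> 'b::euclidean_space"
  assumes "integrable M f" "integrable M g" "\<And>v. (LINT x|M. f x \<bullet> v) = (LINT x|M. g x \<bullet> v)"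
  shows "integral\<^sup>L M f = integral\<^sup>L M g"
proof (rule euclidean_eqI)
  fix b :: 'b
  from assms(3)[of b] show "integral\<^sup>L M f \<bullet> b = integral\<^sup>L M g \<bullet> b"
    by (simp add: assms(1,2))
qed

lemma integrable_scaleR_L2:
  fixes \<phi> :: "'a \<Rightarrow> real" and G :: "'a \<Rightarrow> 'b::euclidean_space"
  assumes "L2 M \<phi>" "L2 M G"
  shows "integrable M (\<lambda>x. \<phi> x *\<^sub>R G x)"
proof (rule Bochner_Integration.integrable_bound)
  show "integrable M (\<lambda>x. (norm (\<phi> x))\<^sup>2 + (norm (G x))\<^sup>2)"
    using assms by (simp add: L2_def)
  show "(\<lambda>x. \<phi> x *\<^sub>R G x) \<in> borel_measurable M"
    using assms by (auto simp: L2_def)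
  have "\<bar>\<phi> x\<bar> * norm (G x) \<le> (norm (\<phi> x))\<^sup>2 + (norm (G x))\<^sup>2" for x
  proof -
    have "0 \<le> \<bar>\<phi> x\<bar> * norm (G x)" by simp
    moreover have "2 * (\<bar>\<phi> x\<bar> * norm (G x)) \<le> (norm (\<phi> x))\<^sup>2 + (norm (G x))\<^sup>2"
      using sum_squares_bound[of "\<bar>\<phi> x\<bar>" "norm (G x)"] by (simp add: mult.assoc)
    ultimately show ?thesis by linarith
  qed
  then show "AE x in M. norm (\<phi> x *\<^sub>R G x) \<le> norm ((norm (\<phi> x))\<^sup>2 + (norm (G x))\<^sup>2)"
    by simp
qed

text \<open>The product with a test function is a compactly supported C1 function on the whole
  plane, so its gradient has integral zero, and the boundary of \<open>D\<close> never
  enters.\<close>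

lemma C1_imp_H1_with_gradient:
  assumes D: "open D" "bounded D" and C1: "C1_with_gradient \<phi> \<gamma>"
  shows "H1_with_gradient D \<phi> \<gamma>"
  unfolding H1_with_gradient_def
proof (intro conjI allI impI)
  have D': "D \<in> sets borel" using D by simp
  show "L2 (lebesgue_on D) \<phi>" "L2 (lebesgue_on D) \<gamma>" using L2_C1[OF D' D(2) C1] by auto
  fix \<psi> g assume T: "test_function D \<psi> g"
  then have C1': "C1_with_gradient \<psi> g" and cp: "compact (closure {x. \<psi> x \<noteq> 0})"
    by (auto simp: test_function_def)
  note zero = test_function_zero_outside[OF T]
  note [measurable] = C1_with_gradient_measurable[OF C1] C1_with_gradient_measurable[OF C1']
  have L2: "L2 (lebesgue_on D) \<psi>" "L2 (lebesgue_on D) g" "L2 (lebesgue_on D) \<phi>" "L2 (lebesgue_on D) \<gamma>"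
    using L2_C1[OF D' D(2) C1] L2_C1[OF D' D(2) C1'] by auto
  have i: "integrable (lebesgue_on D) (\<lambda>x. \<phi> x *\<^sub>R g x)" "integrable (lebesgue_on D) (\<lambda>x. \<psi> x *\<^sub>R \<gamma> x)"
    using L2 by (auto intro: integrable_scaleR_L2)
  have "(LINT x|lebesgue_on D. \<phi> x *\<^sub>R g x + \<psi> x *\<^sub>R \<gamma> x) = (LINT x|lebesgue_on D. 0)"
  proof (rule integral_inner_eq_imp_eq)
    fix v
    have cp': "compact (closure {x. \<phi> x * \<psi> x \<noteq> 0})"
    proof (rule compact_closure[THEN iffD2], rule bounded_subset)
      show "bounded {x. \<psi> x \<noteq> 0}" using cp by simp
    qed auto
    have "(LINT x|lebesgue_on D. (\<phi> x *\<^sub>R g x + \<psi> x *\<^sub>R \<gamma> x) \<bullet> v) = (LINT x|lborel. (\<phi> x *\<^sub>R g x + \<psi> x *\<^sub>R \<gamma> x) \<bullet> v)"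
      using zero by (intro integral_lebesgue_on_borel D') auto
    also have "\<dots> = 0"
      by (rule integral_lborel_gradient_eq_0[OF C1_with_gradient_mult[OF C1 C1'] cp'])
    finally show "(LINT x|lebesgue_on D. (\<phi> x *\<^sub>R g x + \<psi> x *\<^sub>R \<gamma> x) \<bullet> v) = (LINT x|lebesgue_on D. 0 \<bullet> v)" by simp
  qed (use i in auto)
  with i show "(LINT x|lebesgue_on D. \<phi> x *\<^sub>R g x) = - (LINT x|lebesgue_on D. \<psi> x *\<^sub>R \<gamma> x)"
    by (simp add: eq_neg_iff_add_eq_0)
qed

text \<open>The shift by \<open>1 / (n + 1)\<close> in the definition of \<open>\<theta>\<close> keeps the closed supports inside the open box.\<close>

lemma box_bump_functions:
  fixes a b :: "real^2"
  obtains \<phi> g where "\<And>n::nat. test_function (box a b) (\<phi> n) (g n)"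
    "\<And>n x. 0 \<le> \<phi> n x \<and> \<phi> n x \<le> 1" "\<And>x. (\<lambda>n. \<phi> n x) \<longlonglongrightarrow> indicator (box a b) x"
proof -
  \<comment> \<open>The square makes the positive part differentiable at 0 with a continuous
    derivative, while \<rho> stays positive exactly for positive arguments.\<close>
  define \<rho> :: "real \<Rightarrow> real" where "\<rho> t = (max 0 t)\<^sup>2" for t
  define \<rho>' :: "real \<Rightarrow> real" where "\<rho>' t = 2 * max 0 t" for t
  have d\<rho>: "(\<rho> has_real_derivative \<rho>' t) (at t)" for t
  proof -
    consider "t > 0" | "t < 0" | "t = 0" by linarith
    then show ?thesis
    proof cases
      case 1
      have "((\<lambda>t. t\<^sup>2) has_real_derivative 2 * t) (at t)" by (auto intro!: derivative_eq_intros)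
      then show ?thesis
        using 1 by (subst DERIV_cong_ev[where g = "\<lambda>t. t\<^sup>2"])
          (auto simp: \<rho>_def \<rho>'_def eventually_nhds intro!: exI[of _ "{0<..}"])
    next
      case 2
      then show ?thesis
        by (subst DERIV_cong_ev[where g = "\<lambda>t. 0"])
          (auto simp: \<rho>_def \<rho>'_def eventually_nhds intro!: exI[of _ "{..<0}"])
    next
      case 3
      have "((\<lambda>h. \<rho> h / h) \<longlongrightarrow> 0) (at 0)"
      proof (rule Lim_null_comparison)
        show "\<forall>\<^sub>F h in at 0. norm (\<rho> h / h) \<le> \<bar>h\<bar>"
          by (rule always_eventually) (auto simp: \<rho>_def max_def power2_eq_square)
        show "((\<lambda>h. \<bar>h\<bar>) \<longlongrightarrow> (0::real)) (at 0)" by (auto intro!: tendsto_eq_intros)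
      qed
      then show ?thesis using 3 by (simp add: DERIV_def \<rho>_def \<rho>'_def)
    qed
  qed
  have c\<rho>: "continuous_on UNIV \<rho>'" unfolding \<rho>'_def by (intro continuous_intros)
  have \<rho>: "0 \<le> \<rho> t" "0 < \<rho> t \<longleftrightarrow> 0 < t" for t by (auto simp: \<rho>_def max_def)
  \<comment> \<open>Signed distances to the four sides; all four are positive exactly on the open
    box, hence so is the product \<beta>.\<close>
  define l1 l2 l3 l4 :: "real^2 \<Rightarrow> real" where
    "l1 x = - a $ 1 + x \<bullet> axis 1 1" and "l2 x = b $ 1 + x \<bullet> (- axis 1 1)" and
    "l3 x = - a $ 2 + x \<bullet> axis 2 1" and "l4 x = b $ 2 + x \<bullet> (- axis 2 1)" for x
  have l: "\<exists>g. C1_with_gradient (\<lambda>x. \<rho> (l1 x)) g" "\<exists>g. C1_with_gradient (\<lambda>x. \<rho> (l2 x)) g"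
    "\<exists>g. C1_with_gradient (\<lambda>x. \<rho> (l3 x)) g" "\<exists>g. C1_with_gradient (\<lambda>x. \<rho> (l4 x)) g"
    unfolding l1_def l2_def l3_def l4_def
    by (blast intro: C1_with_gradient_compose[OF C1_with_gradient_affine d\<rho> c\<rho>])+
  define \<beta> where "\<beta> x = (\<rho> (l1 x) * \<rho> (l2 x)) * (\<rho> (l3 x) * \<rho> (l4 x))" for x
  obtain g1 g2 g3 g4 where g:
    "C1_with_gradient (\<lambda>x. \<rho> (l1 x)) g1" "C1_with_gradient (\<lambda>x. \<rho> (l2 x)) g2"
    "C1_with_gradient (\<lambda>x. \<rho> (l3 x)) g3" "C1_with_gradient (\<lambda>x. \<rho> (l4 x)) g4"
    using l by blast
  have "\<exists>g. C1_with_gradient \<beta> g"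
    unfolding \<beta>_def[abs_def]
    by (rule exI, rule C1_with_gradient_mult[OF C1_with_gradient_mult[OF g(1,2)] C1_with_gradient_mult[OF g(3,4)]])
  then obtain g\<beta> where g\<beta>: "C1_with_gradient \<beta> g\<beta>" by blast
  have \<beta>0: "\<beta> x \<ge> 0" for x by (simp add: \<beta>_def \<rho>)
  have \<beta>: "\<beta> x > 0 \<longleftrightarrow> x \<in> box a b" for x
  proof -
    have aux: "0 < r * s \<longleftrightarrow> 0 < r \<and> 0 < s" if "0 \<le> r" "0 \<le> s" for r s :: real
      using that by (auto simp: zero_less_mult_iff)
    have "\<beta> x > 0 \<longleftrightarrow> \<rho> (l1 x) > 0 \<and> \<rho> (l2 x) > 0 \<and> \<rho> (l3 x) > 0 \<and> \<rho> (l4 x) > 0"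
      by (simp add: \<beta>_def aux \<rho>(1))
    then show ?thesis
      by (auto simp: \<rho> l1_def l2_def l3_def l4_def mem_box_cart forall_2 inner_axis)
  qed
  \<comment> \<open>The growing factor \<open>real n\<close> drives \<theta> to 1 at every positive
    argument, although \<beta> itself may be small, and the exponential form keeps the values in
    [0,1).\<close>
  define \<theta> where "\<theta> n r = 1 - exp (- (real n * \<rho> (r - 1 / real (Suc n))))" for n r
  define \<theta>' where "\<theta>' n r = exp (- (real n * \<rho> (r - 1 / real (Suc n)))) * (real n * \<rho>' (r - 1 / real (Suc n)))" for n r
  have d: "(\<theta> n has_real_derivative \<theta>' n r) (at r)" for n r
  proof -
    have *: "((\<lambda>r. \<rho> (r - 1 / real (Suc n))) has_real_derivative \<rho>' (r - 1 / real (Suc n)) * 1) (at r)"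
      by (rule DERIV_chain2[OF d\<rho>]) (auto intro!: derivative_eq_intros)
    show ?thesis
      unfolding \<theta>_def[abs_def] \<theta>'_def by (rule derivative_eq_intros * refl | simp)+
  qed
  have c: "continuous_on UNIV (\<theta>' n)" for n
  proof -
    have "continuous_on UNIV \<rho>" using d\<rho> DERIV_isCont by (blast intro: continuous_at_imp_continuous_on)
    then show ?thesis
      unfolding \<theta>'_def[abs_def] by (auto intro!: continuous_intros continuous_on_compose2[OF c\<rho>]
        continuous_on_compose2[of UNIV \<rho>])
  qed
  define \<phi> where "\<phi> n x = \<theta> n (\<beta> x)" for n x
  have C1: "\<exists>g. C1_with_gradient (\<phi> n) g" for n
    unfolding \<phi>_def[abs_def] by (blast intro: C1_with_gradient_compose[OF g\<beta> d c])
  then obtain g where g: "\<And>n. C1_with_gradient (\<phi> n) (g n)" by metis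
  have cl: "closure {x. \<phi> n x \<noteq> 0} \<subseteq> box a b" for n
  proof -
    have "closure {x. \<phi> n x \<noteq> 0} \<subseteq> {x. \<beta> x \<ge> 1 / real (Suc n)}"
    proof (rule closure_minimal)
      show "{x. \<phi> n x \<noteq> 0} \<subseteq> {x. \<beta> x \<ge> 1 / real (Suc n)}"
        by (auto simp: \<phi>_def \<theta>_def \<rho>_def max_def not_le less_imp_le split: if_splits)
      show "closed {x. 1 / real (Suc n) \<le> \<beta> x}"
        using C1_with_gradient_continuous[OF g\<beta>] by (intro closed_Collect_le) auto
    qed
    also have "\<dots> \<subseteq> box a b"
    proof
      fix x assume "x \<in> {x. \<beta> x \<ge> 1 / real (Suc n)}"
      then have "1 / real (Suc n) \<le> \<beta> x" by simp
      then have "\<beta> x > 0" by (rule less_le_trans[rotated]) simp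
      then show "x \<in> box a b" using \<beta> by simp
    qed
    finally show ?thesis .
  qed
  show thesis
  proof (rule that[of \<phi> g])
    show "test_function (box a b) (\<phi> n) (g n)" for n
      using g cl[of n] bounded_subset[OF bounded_box cl, of n]
      by (auto simp: test_function_def compact_eq_bounded_closed)
    show "0 \<le> \<phi> n x \<and> \<phi> n x \<le> 1" for n x
      by (auto simp: \<phi>_def \<theta>_def \<rho>)
    show "(\<lambda>n. \<phi> n x) \<longlonglongrightarrow> indicator (box a b) x" for x
    proof (cases "x \<in> box a b")
      case True
      then have pos: "\<beta> x > 0" using \<beta> by simp
      have "(\<lambda>n. \<rho> (\<beta> x - 1 / real (Suc n))) \<longlonglongrightarrow> (max 0 (\<beta> x - 0))\<^sup>2"
        unfolding \<rho>_def using LIMSEQ_inverse_real_of_nat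
        by (intro tendsto_intros) (simp add: inverse_eq_divide)
      then have "filterlim (\<lambda>n. \<rho> (\<beta> x - 1 / real (Suc n)) * real n) at_top sequentially"
        by (rule filterlim_tendsto_pos_mult_at_top[OF _ _ filterlim_real_sequentially]) (use pos in simp)
      then have "filterlim (\<lambda>n. - (\<rho> (\<beta> x - 1 / real (Suc n)) * real n)) at_bot sequentially"
        by (simp add: filterlim_uminus_at_top)
      then have "(\<lambda>n. exp (- (\<rho> (\<beta> x - 1 / real (Suc n)) * real n))) \<longlonglongrightarrow> 0"
        by (rule filterlim_compose[OF exp_at_bot])
      from tendsto_diff[OF tendsto_const[of 1] this] show ?thesis
        using True by (simp add: \<phi>_def \<theta>_def mult.commute)
    next
      case False
      then have "\<beta> x = 0" using \<beta>[of x] \<beta>0[of x] by simp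
      then show ?thesis using False by (simp add: \<phi>_def \<theta>_def \<rho>_def max_def)
    qed
  qed
qed

section \<open>The fundamental lemma and weak derivatives\<close>

text \<open>The positive and the negative part of \<open>k\<close> are densities of two finite
  measures that agree on boxes. Boxes form an intersection-stable generator, so the measures are
  equal, and comparing them on \<open>{x. k x > 0}\<close> and \<open>{x. k x < 0}\<close> shows
  that both parts vanish.\<close>

lemma AE_zero_of_box_integrals:
  fixes k :: "real^2 \<Rightarrow> real"
  assumes M: "sets M = sets borel" and k: "integrable M k"
    and box: "\<And>a b. (LINT x|M. indicator (box a b) x * k x) = 0"
  shows "AE x in M. k x = 0"
proof -
  have km [measurable]: "k \<in> borel_measurable M" using k by simp
  have sp: "space M = UNIV" using sets_eq_imp_space_eq[OF M] by simp
  note M[measurable_cong]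
  have B: "A \<in> sets M" if "A \<in> sets borel" for A using that M by simp
  \<comment> \<open>\<open>ennreal\<close> maps negative numbers to 0, so these densities are the
    positive and the negative part of \<open>k\<close>.\<close>
  define \<mu> \<nu> where "\<mu> = density M (\<lambda>x. ennreal (k x))" and "\<nu> = density M (\<lambda>x. ennreal (- k x))"
  have fin: "(\<integral>\<^sup>+x. ennreal (k x) \<partial>M) < \<infinity>" "(\<integral>\<^sup>+x. ennreal (- k x) \<partial>M) < \<infinity>"
    using k unfolding real_integrable_def infinity_ennreal_def less_top by blast+
  have em: "emeasure \<mu> A = emeasure \<nu> A"
    if A: "A \<in> sets borel" and 0: "(LINT x|M. indicator A x * k x) = 0" for A
  proof -
    have pos: "(\<integral>\<^sup>+x. ennreal (indicator A x * k x) \<partial>M) = emeasure \<mu> A"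
      unfolding \<mu>_def using A by (subst emeasure_density) (auto simp: indicator_def intro!: nn_integral_cong)
    have neg: "(\<integral>\<^sup>+x. ennreal (- (indicator A x * k x)) \<partial>M) = emeasure \<nu> A"
      unfolding \<nu>_def using A by (subst emeasure_density) (auto simp: indicator_def intro!: nn_integral_cong)
    have i: "integrable M (\<lambda>x. indicator A x * k x)"
      using integrable_mult_indicator[OF B[OF A] k] by simp
    have "enn2real (emeasure \<mu> A) - enn2real (emeasure \<nu> A) = 0"
      using real_lebesgue_integral_def[OF i] 0 by (simp add: pos neg)
    then have eq: "enn2real (emeasure \<mu> A) = enn2real (emeasure \<nu> A)" by simp
    have "emeasure \<mu> A < top" "emeasure \<nu> A < top"
      using i unfolding real_integrable_def pos neg infinity_ennreal_def less_top by blast+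
    then have "ennreal (enn2real (emeasure \<mu> A)) = emeasure \<mu> A" "ennreal (enn2real (emeasure \<nu> A)) = emeasure \<nu> A"
      by simp_all
    then show ?thesis unfolding eq by simp
  qed
  have "\<mu> = \<nu>"
  proof (rule measure_eqI_generator_eq)
    show "Int_stable (range (\<lambda>(a, b). box a b :: (real^2) set))"
      by (auto simp: Int_stable_def box_Int_box)
    show "range (\<lambda>(a, b). box a b :: (real^2) set) \<subseteq> Pow UNIV" by simp
    have "sets borel = sigma_sets UNIV (range (\<lambda>(a, b). box a b :: (real^2) set))"
      by (subst borel_eq_box) simp
    then show "sets \<mu> = sigma_sets UNIV (range (\<lambda>(a, b). box a b))" "sets \<nu> = sigma_sets UNIV (range (\<lambda>(a, b). box a b))"
      by (simp_all add: \<mu>_def \<nu>_def M)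
    show "range (\<lambda>n::nat. box (- (real n *\<^sub>R One)) (real n *\<^sub>R One)) \<subseteq> range (\<lambda>(a, b). box a b :: (real^2) set)" by auto
    show "(\<Union>n::nat. box (- (real n *\<^sub>R One)) (real n *\<^sub>R One)) = (UNIV :: (real^2) set)"
      by (rule UN_box_eq_UNIV)
    show "emeasure \<mu> (box (- (real n *\<^sub>R One)) (real n *\<^sub>R One)) \<noteq> \<infinity>" for n
    proof -
      have "emeasure \<mu> (box (- (real n *\<^sub>R One)) (real n *\<^sub>R One)) \<le> emeasure \<mu> (space \<mu>)"
        by (rule emeasure_space)
      also have "\<dots> = (\<integral>\<^sup>+x. ennreal (k x) \<partial>M)"
        unfolding \<mu>_def by (subst emeasure_density) (auto simp: sp)
      also note fin(1)
      finally show ?thesis by (rule less_imp_neq)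
    qed
    show "emeasure \<mu> X = emeasure \<nu> X" if "X \<in> range (\<lambda>(a, b). box a b)" for X
      using that box em by auto
  qed
  have pos: "AE x in M. k x \<le> 0"
  proof -
    define A where "A = {x. k x > 0}"
    have A: "A = k -` {0<..} \<inter> space M" unfolding A_def sp by auto
    have [measurable]: "A \<in> sets M" unfolding A by (rule measurable_sets[OF km]) simp
    have "(\<integral>\<^sup>+x. ennreal (k x) * indicator A x \<partial>M) = (\<integral>\<^sup>+x. ennreal (- k x) * indicator A x \<partial>M)"
      using \<open>\<mu> = \<nu>\<close> emeasure_density[of "\<lambda>x. ennreal (k x)" M A] emeasure_density[of "\<lambda>x. ennreal (- k x)" M A]
      by (simp add: \<mu>_def \<nu>_def)
    also have "\<dots> = (\<integral>\<^sup>+x. 0 \<partial>M)"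
      by (intro nn_integral_cong) (auto simp: A_def indicator_def ennreal_neg)
    finally have "(\<integral>\<^sup>+x. ennreal (k x) * indicator A x \<partial>M) = 0" by simp
    then have "AE x in M. ennreal (k x) * indicator A x = 0"
      by (subst (asm) nn_integral_0_iff_AE) simp_all
    then show ?thesis by eventually_elim (auto simp: A_def indicator_def ennreal_eq_0_iff split: if_splits)
  qed
  moreover have "AE x in M. - k x \<le> 0"
  proof -
    define A where "A = {x. k x < 0}"
    have A: "A = k -` {..<0} \<inter> space M" unfolding A_def sp by auto
    have [measurable]: "A \<in> sets M" unfolding A by (rule measurable_sets[OF km]) simp
    have "(\<integral>\<^sup>+x. ennreal (- k x) * indicator A x \<partial>M) = (\<integral>\<^sup>+x. ennreal (k x) * indicator A x \<partial>M)"
      using \<open>\<mu> = \<nu>\<close> emeasure_density[of "\<lambda>x. ennreal (k x)" M A] emeasure_density[of "\<lambda>x. ennreal (- k x)" M A]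
      by (simp add: \<mu>_def \<nu>_def)
    also have "\<dots> = (\<integral>\<^sup>+x. 0 \<partial>M)"
      by (intro nn_integral_cong) (auto simp: A_def indicator_def ennreal_neg)
    finally have "(\<integral>\<^sup>+x. ennreal (- k x) * indicator A x \<partial>M) = 0" by simp
    then have "AE x in M. ennreal (- k x) * indicator A x = 0"
      by (subst (asm) nn_integral_0_iff_AE) simp_all
    then show ?thesis by eventually_elim (auto simp: A_def indicator_def ennreal_eq_0_iff split: if_splits)
  qed
  ultimately show ?thesis by eventually_elim simp
qed

lemma test_function_mono:
  "test_function D \<phi> g \<Longrightarrow> D \<subseteq> D' \<Longrightarrow> test_function D' \<phi> g"
  by (auto simp: test_function_def)

text \<open>The measure is arbitrary because both the Lebesgue measure and the arc length on an edge are needed.\<close>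

lemma AE_zero_of_test_functions:
  fixes h :: "real^2 \<Rightarrow> real"
  assumes M: "sets M = sets borel" and h: "integrable M h" and D: "open D"
    and test: "\<And>\<phi> g. test_function D \<phi> g \<Longrightarrow> (LINT x|M. \<phi> x * h x) = 0"
  shows "AE x in M. x \<in> D \<longrightarrow> h x = 0"
proof -
  have [measurable]: "h \<in> borel_measurable M" using h by simp
  note M[measurable_cong]
  have B: "A \<in> sets M" if "A \<in> sets borel" for A using that M by simp
  have Bm: "f \<in> borel_measurable M" if "f \<in> borel_measurable borel" for f :: "real^2 \<Rightarrow> real"
    using that measurable_cong_sets[OF M refl] by blast
  have box0: "(LINT x|M. indicator (box a b) x * h x) = 0" if "box a b \<subseteq> D" for a b
  proof -
    obtain \<phi> g where \<phi>: "\<And>n::nat. test_function (box a b) (\<phi> n) (g n)"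
      "\<And>n x. 0 \<le> \<phi> n x \<and> \<phi> n x \<le> 1" "\<And>x. (\<lambda>n. \<phi> n x) \<longlonglongrightarrow> indicator (box a b) x"
      using box_bump_functions by blast
    have C1: "C1_with_gradient (\<phi> n) (g n)" for n using \<phi>(1) by (simp add: test_function_def)
    have "(\<lambda>n. LINT x|M. \<phi> n x * h x) \<longlonglongrightarrow> (LINT x|M. indicator (box a b) x * h x)"
    proof (rule integral_dominated_convergence[where w = "\<lambda>x. norm (h x)"])
      show "(\<lambda>x. \<phi> n x * h x) \<in> borel_measurable M" for n
        using Bm[OF C1_with_gradient_measurable(1)[OF C1[of n]]] by simp
      show "(\<lambda>x. indicator (box a b) x * h x) \<in> borel_measurable M"
        by (intro borel_measurable_times Bm) auto
      show "AE x in M. norm (\<phi> n x * h x) \<le> norm (h x)" for n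
        using \<phi>(2) by (intro AE_I2) (simp add: abs_mult mult_left_le_one_le)
      show "AE x in M. (\<lambda>n. \<phi> n x * h x) \<longlonglongrightarrow> indicator (box a b) x * h x"
        using \<phi>(3) by (intro AE_I2 tendsto_mult_right)
    qed (use h in auto)
    moreover have "(LINT x|M. \<phi> n x * h x) = 0" for n
      using test test_function_mono[OF \<phi>(1) that] by blast
    ultimately show ?thesis by (simp add: LIMSEQ_const_iff)
  qed
  have box: "AE x in M. x \<in> box c d \<longrightarrow> h x = 0" if sub: "box c d \<subseteq> D" for c d
  proof -
    \<comment> \<open>Cutting \<open>h\<close> off to \<open>box c d\<close> reduces integrals over
      arbitrary boxes to boxes contained in \<open>D\<close>, where the bump functions are allowed
      as test functions.\<close>
    have "AE x in M. indicator (box c d) x * h x = 0"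
    proof (rule AE_zero_of_box_integrals[OF M])
      show "integrable M (\<lambda>x. indicator (box c d) x * h x)"
        using integrable_mult_indicator[OF _ h, of "box c d"] by simp
      fix a b :: "real^2"
      obtain a' b' where ab: "box a b \<inter> box c d = box a' b'"
        using box_Int_box by blast
      have "(LINT x|M. indicator (box a b) x * (indicator (box c d) x * h x)) = (LINT x|M. indicator (box a b \<inter> box c d) x * h x)"
        by (simp add: indicator_inter_arith mult.assoc)
      also have "\<dots> = 0" unfolding ab using ab sub by (intro box0) auto
      finally show "(LINT x|M. indicator (box a b) x * (indicator (box c d) x * h x)) = 0" .
    qed
    then show ?thesis by eventually_elim (auto simp: indicator_def)
  qed
  \<comment> \<open>Countably many boxes exhaust \<open>D\<close>, so their exceptional null sets
    can be united.\<close>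
  obtain \<B> where \<B>: "countable \<B>" "\<B> \<subseteq> Pow D" "\<And>X. X \<in> \<B> \<Longrightarrow> \<exists>a b. X = box a b" "\<Union>\<B> = D"
    using open_countable_Union_open_box[OF D] by metis
  have "AE x in M. \<forall>X\<in>\<B>. x \<in> X \<longrightarrow> h x = 0"
  proof (subst AE_ball_countable[OF \<B>(1)], rule ballI)
    fix X assume "X \<in> \<B>"
    with \<B> obtain a b where "X = box a b" "box a b \<subseteq> D" by (metis PowD subsetD)
    then show "AE x in M. x \<in> X \<longrightarrow> h x = 0" using box by blast
  qed
  then show ?thesis by eventually_elim (use \<B>(4) in blast)
qed

text \<open>Here \<open>h\<close> is only Lebesgue measurable. It is extended by zero and replaced
  by a Borel representative, to which the version for Borel measures applies.\<close>

lemma AE_zero_lebesgue_on_of_test_functions: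
  fixes h :: "real^2 \<Rightarrow> real"
  assumes D: "open D" and h: "integrable (lebesgue_on D) h"
    and test: "\<And>\<phi> g. test_function D \<phi> g \<Longrightarrow> (LINT x|lebesgue_on D. \<phi> x * h x) = 0"
  shows "AE x in lebesgue_on D. h x = 0"
proof -
  have D': "D \<in> sets borel" "D \<inter> space lebesgue \<in> sets lebesgue" using D by auto
  define h1 where "h1 x = indicator D x * h x" for x
  have h1: "integrable lebesgue h1"
    using h integrable_restrict_space[OF D'(2), of h] by (simp add: h1_def[abs_def])
  then obtain h2 where h2: "h2 \<in> borel_measurable lborel" "AE x in lborel. h1 x = h2 x"
    using completion_ex_borel_measurable_real[of h1 lborel] by auto
  have AE: "AE x in lebesgue. h1 x = h2 x" using h2(2) by (rule AE_completion)
  have h2': "integrable lborel h2"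
  proof -
    have "integrable lebesgue h2"
      using h1 h2(1) AE by (subst integrable_cong_AE[of _ _ h1]) (auto intro: measurable_completion)
    then show ?thesis using h2(1) by (simp add: integrable_completion)
  qed
  have "AE x in lborel. x \<in> D \<longrightarrow> h2 x = 0"
  proof (rule AE_zero_of_test_functions[OF _ h2' D])
    fix \<phi> g assume T: "test_function D \<phi> g"
    then have [measurable]: "\<phi> \<in> borel_measurable borel"
      using C1_with_gradient_measurable by (auto simp: test_function_def)
    have \<phi>l: "\<phi> \<in> borel_measurable lebesgue" by (intro measurable_completion) simp
    have "(LINT x|lborel. \<phi> x * h2 x) = (LINT x|lebesgue. \<phi> x * h2 x)"
      using h2(1) by (intro integral_completion[symmetric]) simp
    also have "\<dots> = (LINT x|lebesgue. \<phi> x * h1 x)"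
    proof (rule integral_cong_AE)
      show "AE x in lebesgue. \<phi> x * h2 x = \<phi> x * h1 x" using AE by eventually_elim simp
    qed (use \<phi>l h2(1) h1 in \<open>auto intro!: borel_measurable_times measurable_completion\<close>)
    also have "\<dots> = (LINT x|lebesgue. indicator D x *\<^sub>R (\<phi> x * h x))"
      by (intro Bochner_Integration.integral_cong) (auto simp: h1_def)
    also have "\<dots> = (LINT x|lebesgue_on D. \<phi> x * h x)"
      by (rule integral_restrict_space[OF D'(2), symmetric])
    also have "\<dots> = 0" by (rule test[OF T])
    finally show "(LINT x|lborel. \<phi> x * h2 x) = 0" .
  qed simp
  then have "AE x in lebesgue. x \<in> D \<longrightarrow> h2 x = 0" by (rule AE_completion)
  with AE have "AE x in lebesgue. x \<in> D \<longrightarrow> h x = 0"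
    by eventually_elim (auto simp: h1_def)
  then show ?thesis using D'(2) by (simp add: AE_restrict_space_iff)
qed

section \<open>Uniqueness and linearity of weak derivatives\<close>

lemma L2_inner:
  fixes f :: "'a \<Rightarrow> 'b::euclidean_space"
  assumes f: "L2 M f"
  shows "L2 M (\<lambda>x. f x \<bullet> v)"
proof -
  note [measurable] = L2_measurable[OF f]
  have "integrable M (\<lambda>x. (norm (f x \<bullet> v))\<^sup>2)"
  proof (rule Bochner_Integration.integrable_bound)
    show "integrable M (\<lambda>x. (norm v)\<^sup>2 * (norm (f x))\<^sup>2)" using f by (simp add: L2_def)
    show "(\<lambda>x. (norm (f x \<bullet> v))\<^sup>2) \<in> borel_measurable M" by measurable
    have "(norm (f x \<bullet> v))\<^sup>2 \<le> (norm v)\<^sup>2 * (norm (f x))\<^sup>2" for x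
      using Cauchy_Schwarz_ineq[of "f x" v] by (simp add: power2_norm_eq_inner mult.commute)
    then show "AE x in M. norm ((norm (f x \<bullet> v))\<^sup>2) \<le> norm ((norm v)\<^sup>2 * (norm (f x))\<^sup>2)" by simp
  qed
  then show ?thesis by (simp add: L2_def)
qed

lemma L2_imp_integrable:
  fixes f :: "'a \<Rightarrow> 'b::euclidean_space"
  assumes "finite_measure M" "L2 M f"
  shows "integrable M f"
  using integrable_scaleR_L2[OF L2_const[OF assms(1), of "1::real"] assms(2)] by simp

text \<open>Each notion built on H1 hides its own gradient behind an existential quantifier; this
  allows the witnesses to be exchanged. The proof applies the fundamental lemma to each component of
  the difference.\<close>

lemma H1_gradient_unique:
  assumes D: "open D" "bounded D" and G: "H1_with_gradient D v G" "H1_with_gradient D v G'"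
  shows "AE x in lebesgue_on D. G x = G' x"
proof -
  have D': "D \<in> sets borel" using D by simp
  have fin: "finite_measure (lebesgue_on D)" by (rule finite_measure_lebesgue_on_bounded[OF D' D(2)])
  have L: "L2 (lebesgue_on D) G" "L2 (lebesgue_on D) G'" using G by (auto simp: H1_with_gradient_def)
  have b: "AE x in lebesgue_on D. (G x - G' x) \<bullet> b = 0" for b
  proof (rule AE_zero_lebesgue_on_of_test_functions[OF D(1)])
    show "integrable (lebesgue_on D) (\<lambda>x. (G x - G' x) \<bullet> b)"
      by (intro L2_imp_integrable fin L2_inner L2_diff L)
    fix \<phi> g assume T: "test_function D \<phi> g"
    then have "L2 (lebesgue_on D) \<phi>" using L2_C1[OF D' D(2)] by (auto simp: test_function_def)
    then have i: "integrable (lebesgue_on D) (\<lambda>x. \<phi> x *\<^sub>R G x)" "integrable (lebesgue_on D) (\<lambda>x. \<phi> x *\<^sub>R G' x)"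
      using L by (auto intro: integrable_scaleR_L2)
    have "(LINT x|lebesgue_on D. v x *\<^sub>R g x) = - (LINT x|lebesgue_on D. \<phi> x *\<^sub>R G x)"
      "(LINT x|lebesgue_on D. v x *\<^sub>R g x) = - (LINT x|lebesgue_on D. \<phi> x *\<^sub>R G' x)"
      using G T by (auto simp: H1_with_gradient_def)
    then have "(LINT x|lebesgue_on D. \<phi> x *\<^sub>R G x) = (LINT x|lebesgue_on D. \<phi> x *\<^sub>R G' x)"
      by simp
    then have "(LINT x|lebesgue_on D. \<phi> x *\<^sub>R G x - \<phi> x *\<^sub>R G' x) \<bullet> b = 0"
      using i by simp
    then have "(LINT x|lebesgue_on D. (\<phi> x *\<^sub>R G x - \<phi> x *\<^sub>R G' x) \<bullet> b) = 0"
      using i by (subst integral_inner_left) auto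
    then show "(LINT x|lebesgue_on D. \<phi> x * ((G x - G' x) \<bullet> b)) = 0"
      by (simp add: inner_diff_left right_diff_distrib)
  qed
  have "AE x in lebesgue_on D. \<forall>b\<in>Basis. (G x - G' x) \<bullet> b = 0"
    using b by (subst AE_ball_countable) (auto intro: countable_finite)
  then show ?thesis
    by eventually_elim (metis euclidean_eqI inner_zero_left right_minus_eq)
qed

lemma weak_laplacian_unique:
  assumes D: "open D" "bounded D" and l: "has_weak_laplacian D v l" "has_weak_laplacian D v l'"
  shows "AE x in lebesgue_on D. l x = l' x"
proof -
  have D': "D \<in> sets borel" using D by simp
  have fin: "finite_measure (lebesgue_on D)" by (rule finite_measure_lebesgue_on_bounded[OF D' D(2)])
  have L: "L2 (lebesgue_on D) l" "L2 (lebesgue_on D) l'" using l by (auto simp: has_weak_laplacian_def)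
  obtain G where G: "H1_with_gradient D v G"
    "\<forall>\<phi> g. test_function D \<phi> g \<longrightarrow> (LINT x|lebesgue_on D. G x \<bullet> g x) = - (LINT x|lebesgue_on D. l x * \<phi> x)"
    using l(1) by (auto simp: has_weak_laplacian_def)
  obtain G' where G': "H1_with_gradient D v G'"
    "\<forall>\<phi> g. test_function D \<phi> g \<longrightarrow> (LINT x|lebesgue_on D. G' x \<bullet> g x) = - (LINT x|lebesgue_on D. l' x * \<phi> x)"
    using l(2) by (auto simp: has_weak_laplacian_def)
  note eq = H1_gradient_unique[OF D G(1) G'(1)]
  have "AE x in lebesgue_on D. l x - l' x = 0"
  proof (rule AE_zero_lebesgue_on_of_test_functions[OF D(1)])
    show "integrable (lebesgue_on D) (\<lambda>x. l x - l' x)"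
      by (intro L2_imp_integrable fin L2_diff L)
    fix \<phi> g assume T: "test_function D \<phi> g"
    then have L2: "L2 (lebesgue_on D) \<phi>" "L2 (lebesgue_on D) g"
      using L2_C1[OF D' D(2)] by (auto simp: test_function_def)
    have "(LINT x|lebesgue_on D. G x \<bullet> g x) = (LINT x|lebesgue_on D. G' x \<bullet> g x)"
      using eq G(1) G'(1) L2
      by (intro integral_cong_AE) (auto simp: H1_with_gradient_def L2_def)
    then have "(LINT x|lebesgue_on D. l x * \<phi> x) = (LINT x|lebesgue_on D. l' x * \<phi> x)"
      using G(2) G'(2) T by simp
    then show "(LINT x|lebesgue_on D. \<phi> x * (l x - l' x)) = 0"
      using integrable_scaleR_L2[OF L2(1) L(1)] integrable_scaleR_L2[OF L2(1) L(2)]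
      by (simp add: right_diff_distrib mult.commute)
  qed
  then show ?thesis by simp
qed

lemma H1_with_gradient_add_scaleR:
  assumes D: "open D" "bounded D" and v: "H1_with_gradient D v G" "H1_with_gradient D v' G'"
  shows "H1_with_gradient D (\<lambda>x. v x + c * v' x) (\<lambda>x. G x + c *\<^sub>R G' x)"
  unfolding H1_with_gradient_def
proof (intro conjI allI impI)
  have D': "D \<in> sets borel" using D by simp
  have L: "L2 (lebesgue_on D) v" "L2 (lebesgue_on D) G" "L2 (lebesgue_on D) v'" "L2 (lebesgue_on D) G'"
    using v by (auto simp: H1_with_gradient_def)
  then show "L2 (lebesgue_on D) (\<lambda>x. v x + c * v' x)" "L2 (lebesgue_on D) (\<lambda>x. G x + c *\<^sub>R G' x)"
    by (auto intro: L2_add L2_cmult L2_scaleR)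
  fix \<phi> g assume T: "test_function D \<phi> g"
  then have L2: "L2 (lebesgue_on D) \<phi>" "L2 (lebesgue_on D) g"
    using L2_C1[OF D' D(2)] by (auto simp: test_function_def)
  have i: "integrable (lebesgue_on D) (\<lambda>x. v x *\<^sub>R g x)" "integrable (lebesgue_on D) (\<lambda>x. v' x *\<^sub>R g x)"
    "integrable (lebesgue_on D) (\<lambda>x. \<phi> x *\<^sub>R G x)" "integrable (lebesgue_on D) (\<lambda>x. \<phi> x *\<^sub>R G' x)"
    using L L2 by (auto intro: integrable_scaleR_L2)
  have e: "(LINT x|lebesgue_on D. v x *\<^sub>R g x) = - (LINT x|lebesgue_on D. \<phi> x *\<^sub>R G x)"
    "(LINT x|lebesgue_on D. v' x *\<^sub>R g x) = - (LINT x|lebesgue_on D. \<phi> x *\<^sub>R G' x)"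
    using v T by (auto simp: H1_with_gradient_def)
  have "(LINT x|lebesgue_on D. (v x + c * v' x) *\<^sub>R g x) = (LINT x|lebesgue_on D. v x *\<^sub>R g x + c *\<^sub>R (v' x *\<^sub>R g x))"
    by (simp add: algebra_simps)
  also have "\<dots> = (LINT x|lebesgue_on D. v x *\<^sub>R g x) + c *\<^sub>R (LINT x|lebesgue_on D. v' x *\<^sub>R g x)"
    by (subst Bochner_Integration.integral_add) (use i in \<open>auto simp del: scaleR_scaleR\<close>)
  also have "\<dots> = - ((LINT x|lebesgue_on D. \<phi> x *\<^sub>R G x) + c *\<^sub>R (LINT x|lebesgue_on D. \<phi> x *\<^sub>R G' x))"
    unfolding e by simp
  also have "\<dots> = - (LINT x|lebesgue_on D. \<phi> x *\<^sub>R G x + c *\<^sub>R (\<phi> x *\<^sub>R G' x))"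
    by (subst Bochner_Integration.integral_add) (use i in \<open>auto simp del: scaleR_scaleR\<close>)
  finally show "(LINT x|lebesgue_on D. (v x + c * v' x) *\<^sub>R g x) = - (LINT x|lebesgue_on D. \<phi> x *\<^sub>R (G x + c *\<^sub>R G' x))"
    by (simp add: algebra_simps)
qed

lemma has_weak_laplacian_add_scaleR:
  assumes D: "open D" "bounded D" and v: "has_weak_laplacian D v l" "has_weak_laplacian D v' l'"
  shows "has_weak_laplacian D (\<lambda>x. v x + c * v' x) (\<lambda>x. l x + c * l' x)"
proof -
  have D': "D \<in> sets borel" using D by simp
  have L: "L2 (lebesgue_on D) l" "L2 (lebesgue_on D) l'" using v by (auto simp: has_weak_laplacian_def)
  obtain G where G: "H1_with_gradient D v G"
    "\<forall>\<phi> g. test_function D \<phi> g \<longrightarrow> (LINT x|lebesgue_on D. G x \<bullet> g x) = - (LINT x|lebesgue_on D. l x * \<phi> x)"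
    using v(1) by (auto simp: has_weak_laplacian_def)
  obtain G' where G': "H1_with_gradient D v' G'"
    "\<forall>\<phi> g. test_function D \<phi> g \<longrightarrow> (LINT x|lebesgue_on D. G' x \<bullet> g x) = - (LINT x|lebesgue_on D. l' x * \<phi> x)"
    using v(2) by (auto simp: has_weak_laplacian_def)
  have LG: "L2 (lebesgue_on D) G" "L2 (lebesgue_on D) G'"
    using G G' by (auto simp: H1_with_gradient_def)
  have "(LINT x|lebesgue_on D. (G x + c *\<^sub>R G' x) \<bullet> g x) = - (LINT x|lebesgue_on D. (l x + c * l' x) * \<phi> x)"
    if T: "test_function D \<phi> g" for \<phi> g
  proof -
    have L2: "L2 (lebesgue_on D) \<phi>" "L2 (lebesgue_on D) g"
      using T L2_C1[OF D' D(2)] by (auto simp: test_function_def)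
    have i: "integrable (lebesgue_on D) (\<lambda>x. G x \<bullet> g x)" "integrable (lebesgue_on D) (\<lambda>x. G' x \<bullet> g x)"
      using LG L2 by (auto intro: integrable_inner_L2)
    have j: "integrable (lebesgue_on D) (\<lambda>x. l x * \<phi> x)" "integrable (lebesgue_on D) (\<lambda>x. l' x * \<phi> x)"
      using integrable_inner_L2[OF L(1) L2(1)] integrable_inner_L2[OF L(2) L2(1)] by auto
    have "(LINT x|lebesgue_on D. (G x + c *\<^sub>R G' x) \<bullet> g x) = (LINT x|lebesgue_on D. G x \<bullet> g x) + c * (LINT x|lebesgue_on D. G' x \<bullet> g x)"
      using i by (simp add: inner_add_left)
    also have "\<dots> = - ((LINT x|lebesgue_on D. l x * \<phi> x) + c * (LINT x|lebesgue_on D. l' x * \<phi> x))"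
      using G(2) G'(2) T by simp
    also have "(LINT x|lebesgue_on D. l x * \<phi> x) + c * (LINT x|lebesgue_on D. l' x * \<phi> x) = (LINT x|lebesgue_on D. (l x + c * l' x) * \<phi> x)"
      using j by (simp add: distrib_right mult.assoc)
    finally show ?thesis .
  qed
  then show ?thesis
    unfolding has_weak_laplacian_def using H1_with_gradient_add_scaleR[OF D G(1) G'(1)] L
    by (auto intro!: L2_add L2_cmult)
qed

lemma solves_pde_add_scaleR:
  assumes D: "open D" "bounded D" and v: "solves_pde \<eta> D f v" "solves_pde \<eta> D f' v'"
  shows "solves_pde \<eta> D (\<lambda>x. f x + c * f' x) (\<lambda>x. v x + c * v' x)"
proof -
  obtain l l' where l: "has_weak_laplacian D v l" "AE x in lebesgue_on D. \<eta> * v x - l x = f x"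
    "has_weak_laplacian D v' l'" "AE x in lebesgue_on D. \<eta> * v' x - l' x = f' x"
    using v by (auto simp: solves_pde_def)
  have "AE x in lebesgue_on D. \<eta> * (v x + c * v' x) - (l x + c * l' x) = f x + c * f' x"
    using l(2,4)
  proof eventually_elim
    case (elim x)
    have "\<eta> * (v x + c * v' x) - (l x + c * l' x) = (\<eta> * v x - l x) + c * (\<eta> * v' x - l' x)"
      by (simp add: algebra_simps)
    then show ?case by (simp only: elim)
  qed
  then show ?thesis using has_weak_laplacian_add_scaleR[OF D l(1,3)] by (auto simp: solves_pde_def)
qed

section \<open>Traces on a polygonal cell\<close>

locale polygonal_cell =
  fixes D :: "(real^2) set"
  assumes open_cell: "open D" and convex_cell: "convex D" and bounded_cell: "bounded D"
    and nonempty_cell: "D \<noteq> {}" and polytope_cell: "polytope (closure D)"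
begin

section \<open>Geometry of one cell and of its edges\<close>

abbreviation \<mu> :: "(real^2) measure" where
  "\<mu> \<equiv> lebesgue_on D"

lemma borel_cell: "D \<in> sets borel"
  using open_cell by simp

lemma finite_measure_cell: "finite_measure \<mu>"
  by (rule finite_measure_lebesgue_on_bounded[OF borel_cell bounded_cell])

lemma interior_closure_cell: "interior (closure D) = D"
  using convex_interior_closure[OF convex_cell] open_cell by (simp add: interior_open)

lemma aff_dim_cell: "aff_dim (closure D) = 2"
  using aff_dim_open[OF open_cell nonempty_cell] by simp

lemma finite_edges: "finite {e. e edge_of closure D}"
  by (rule finite_subset[OF _ finite_polytope_faces[OF polytope_cell]]) (auto simp: edge_of_def)

lemma edge_cases:
  assumes "e edge_of closure D"
  obtains s t where "s \<noteq> t" "e = closed_segment s t"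
proof -
  have f: "e face_of closure D" and d: "aff_dim e = 1" using assms by (auto simp: edge_of_def)
  have ne: "e \<noteq> {}" using d by auto
  have "compact e" using face_of_imp_compact[OF _ _ f] convex_cell bounded_cell
    by (simp add: convex_closure)
  moreover have "convex e" using f by (rule face_of_imp_convex)
  moreover have "collinear e" using d by (simp add: collinear_aff_dim)
  ultimately obtain s t where e: "e = closed_segment s t"
    using compact_convex_collinear_segment ne by metis
  moreover have "s \<noteq> t" using e d by auto
  ultimately show thesis using that by blast
qed

lemma edge_disjoint_cell:
  assumes "e edge_of closure D"
  shows "e \<inter> D = {}"
proof -
  have "e face_of closure D" "e \<noteq> closure D" using assms aff_dim_cell by (auto simp: edge_of_def)
  then show ?thesis using face_of_disjoint_interior interior_closure_cell by metis
qed

lemma edge_subset: "e edge_of closure D \<Longrightarrow> e \<subseteq> closure D"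
  by (rule edge_of_imp_subset)

lemma edge_subset_frontier:
  assumes "e edge_of closure D"
  shows "e \<subseteq> frontier D"
  using edge_disjoint_cell[OF assms] edge_subset[OF assms] open_cell
  by (auto simp: frontier_def interior_open)

lemma finite_edge_measure_edge: "e edge_of closure D \<Longrightarrow> finite_measure (edge_measure e)"
  using edge_cases finite_edge_measure by metis

lemma AE_edge_in: "e edge_of closure D \<Longrightarrow> AE x in edge_measure e. x \<in> e"
  using edge_cases AE_edge_measure_in by metis

lemma measure_edge_pos: "e edge_of closure D \<Longrightarrow> 0 < measure (edge_measure e) UNIV"
  using edge_cases[of e] emeasure_edge_measure_UNIV by (metis measure_def enn2real_ennreal zero_less_dist_iff zero_le_dist)

text \<open>A face is the intersection of the closed cell with its own affine hull, so a point of
  the cell on the line of \<open>e\<close> would lie on \<open>e\<close>, while edges avoid the open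
  cell.\<close>

lemma edge_noncollinear:
  assumes e: "e edge_of closure D" "e = closed_segment s t" "s \<noteq> t" and a: "a \<in> D"
  shows "(t - s) $ 1 * (a - s) $ 2 - (t - s) $ 2 * (a - s) $ 1 \<noteq> 0"
proof
  assume det: "(t - s) $ 1 * (a - s) $ 2 - (t - s) $ 2 * (a - s) $ 1 = 0"
  define w z where "w = t - s" and "z = a - s"
  have w: "w \<noteq> 0" using e by (simp add: w_def)
  have det': "w $ 1 * z $ 2 = w $ 2 * z $ 1" using det by (simp add: w_def z_def)
  have "\<exists>r. z = r *\<^sub>R w"
  proof (cases "w $ 1 = 0")
    case True
    then have "w $ 2 \<noteq> 0" using w by (auto simp: vec_eq_iff forall_2)
    then show ?thesis using det' True
      by (intro exI[of _ "z $ 2 / w $ 2"]) (auto simp: vec_eq_iff forall_2)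
  next
    case False
    then show ?thesis using det'
      by (intro exI[of _ "z $ 1 / w $ 1"]) (auto simp: vec_eq_iff forall_2 field_simps)
  qed
  then obtain r where "z = r *\<^sub>R w" by blast
  then have ar: "a = (1 - r) *\<^sub>R s + r *\<^sub>R t" by (simp add: z_def w_def algebra_simps)
  have f: "e face_of closure D" using e by (simp add: edge_of_def)
  have "s \<in> e" "t \<in> e" using e by auto
  then have "a \<in> affine hull e"
    unfolding ar by (intro mem_affine[OF affine_affine_hull]) (auto simp: hull_inc)
  moreover have "a \<in> closure D" using a closure_subset by blast
  ultimately have "a \<in> e"
    using face_of_imp_eq_affine_Int[OF _ f] convex_closure[OF convex_cell] by blast
  then show False using edge_disjoint_cell[OF e(1)] a by blast
qed

text \<open>The intersection is a face of both edges and a proper one of at least one of them, hence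
  of dimension at most 0.\<close>

lemma edges_intersect_in_point:
  assumes e: "e edge_of closure D" and e': "e' edge_of closure D" and ne: "e \<noteq> e'"
  shows "\<exists>z. e \<inter> e' \<subseteq> {z}"
proof -
  have f: "e face_of closure D" "e' face_of closure D" and d: "aff_dim e = 1" "aff_dim e' = 1"
    using e e' by (auto simp: edge_of_def)
  have i: "e \<inter> e' face_of closure D" by (rule face_of_Int[OF f])
  have ce: "convex e" "convex e'" using f face_of_imp_convex by auto
  have "e \<inter> e' \<noteq> e \<or> e \<inter> e' \<noteq> e'" using ne by auto
  then have "aff_dim (e \<inter> e') < 1"
  proof
    assume ne: "e \<inter> e' \<noteq> e"
    have "e \<inter> e' face_of e" by (rule face_of_subset[OF i]) (use f in \<open>auto dest: face_of_imp_subset\<close>)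
    from face_of_aff_dim_lt[OF ce(1) this ne] d show ?thesis by simp
  next
    assume ne: "e \<inter> e' \<noteq> e'"
    have "e \<inter> e' face_of e'" by (rule face_of_subset[OF i]) (use f in \<open>auto dest: face_of_imp_subset\<close>)
    from face_of_aff_dim_lt[OF ce(2) this ne] d show ?thesis by simp
  qed
  then have "aff_dim (e \<inter> e') = 0 \<or> aff_dim (e \<inter> e') = -1"
    using aff_dim_geq[of "e \<inter> e'"] by linarith
  then show ?thesis
    by (auto simp: aff_dim_eq_0 simp flip: aff_dim_empty)
qed

lemma AE_edge_not_in_other_edges:
  assumes e: "e edge_of closure D"
  shows "AE x in edge_measure e. x \<notin> \<Union>{e'. e' edge_of closure D \<and> e' \<noteq> e}"
proof -
  have "AE x in edge_measure e. \<forall>e'\<in>{e'. e' edge_of closure D \<and> e' \<noteq> e}. x \<notin> e'"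
  proof (subst AE_ball_countable)
    show "countable {e'. e' edge_of closure D \<and> e' \<noteq> e}"
      by (rule countable_finite, rule finite_subset[OF _ finite_edges]) auto
    show "\<forall>e'\<in>{e'. e' edge_of closure D \<and> e' \<noteq> e}. AE x in edge_measure e. x \<notin> e'"
    proof (rule ballI)
      fix e' assume "e' \<in> {e'. e' edge_of closure D \<and> e' \<noteq> e}"
      then have e': "e' edge_of closure D" "e' \<noteq> e" by auto
      obtain z where z: "e \<inter> e' \<subseteq> {z}" using edges_intersect_in_point[OF e e'(1)] e'(2) by metis
      obtain s t where st: "s \<noteq> t" "e = closed_segment s t" using edge_cases[OF e] by metis
      have "AE x in edge_measure e. x \<noteq> z" unfolding st(2) by (rule AE_edge_measure_neq[OF st(1)])
      with AE_edge_in[OF e] show "AE x in edge_measure e. x \<notin> e'"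
        by eventually_elim (use z in auto)
    qed
  qed
  then show ?thesis by eventually_elim auto
qed

section \<open>Trace and Poincare inequalities for C1 functions on a cell\<close>

lemma L2_edge_C1:
  assumes e: "e edge_of closure D" and C1: "C1_with_gradient \<phi> g"
  shows "L2 (edge_measure e) \<phi>"
proof -
  obtain s t where st: "s \<noteq> t" "e = closed_segment s t" using edge_cases[OF e] by metis
  have "bounded e" unfolding st(2) by (rule bounded_closed_segment)
  then obtain B where B: "\<And>x. x \<in> e \<Longrightarrow> \<bar>\<phi> x\<bar> \<le> B"
    using C1_with_gradient_bounded[OF C1] by metis
  show ?thesis
  proof (rule L2_bounded[OF finite_edge_measure_edge[OF e]])
    show "AE x in edge_measure e. norm (\<phi> x) \<le> B"
      using AE_edge_in[OF e] by eventually_elim (simp add: B)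
  qed (use C1_with_gradient_measurable[OF C1] in simp)
qed

lemma L2_cell_C1:
  assumes "C1_with_gradient \<phi> g"
  shows "L2 \<mu> \<phi>" "L2 \<mu> g"
  using L2_C1[OF borel_cell bounded_cell assms] by auto

lemma trace_inequality_C1:
  obtains T where "T \<ge> 0" "\<forall>e \<phi> \<gamma>. e edge_of closure D \<longrightarrow> C1_with_gradient \<phi> \<gamma> \<longrightarrow>
    L2_norm (edge_measure e) \<phi> \<le> T * (L2_norm \<mu> \<phi> + L2_norm \<mu> \<gamma>)"
proof -
  have "\<exists>K\<ge>0. \<forall>\<phi> \<gamma>. C1_with_gradient \<phi> \<gamma> \<longrightarrow>
    L2_norm (edge_measure e) \<phi> \<le> K * (L2_norm \<mu> \<phi> + L2_norm \<mu> \<gamma>)"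
    if e: "e edge_of closure D" for e
  proof -
    obtain a where a: "a \<in> D" using nonempty_cell by blast
    obtain s t where st: "s \<noteq> t" "e = closed_segment s t" using edge_cases[OF e] by metis
    obtain K where K: "K \<ge> 0" "\<forall>\<phi> \<gamma>. C1_with_gradient \<phi> \<gamma> \<longrightarrow>
      (\<integral>\<^sup>+x. ennreal ((\<phi> x)\<^sup>2) \<partial>edge_measure e)
        \<le> ennreal K * (\<integral>\<^sup>+x. indicator D x * ennreal ((\<phi> x)\<^sup>2 + (norm (\<gamma> x))\<^sup>2) \<partial>lborel)"
      by (rule edge_trace_inequality[OF open_cell convex_cell st edge_subset[OF e] a
            edge_noncollinear[OF e st(2,1) a]])
    show ?thesis
    proof (intro exI[of _ "sqrt K"] conjI allI impI)
      fix \<phi> \<gamma> assume C1: "C1_with_gradient \<phi> \<gamma>"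
      define A B where "A = L2_norm \<mu> \<phi>" and "B = L2_norm \<mu> \<gamma>"
      have AB: "A \<ge> 0" "B \<ge> 0" by (auto simp: A_def B_def)
      note [measurable] = C1_with_gradient_measurable[OF C1]
      have m: "(\<lambda>x. ennreal ((norm (\<phi> x))\<^sup>2)) \<in> borel_measurable \<mu>"
        "(\<lambda>x. ennreal ((norm (\<gamma> x))\<^sup>2)) \<in> borel_measurable \<mu>"
        using L2_measurable[OF L2_cell_C1(1)[OF C1]] L2_measurable[OF L2_cell_C1(2)[OF C1]] by measurable
      have "(\<integral>\<^sup>+x. ennreal ((norm (\<phi> x))\<^sup>2) \<partial>edge_measure e)
        \<le> ennreal K * (\<integral>\<^sup>+x. ennreal ((norm (\<phi> x))\<^sup>2) + ennreal ((norm (\<gamma> x))\<^sup>2) \<partial>\<mu>)"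
        using K C1 by (simp add: nn_integral_lebesgue_on[OF borel_cell])
      also have "\<dots> = ennreal K * (ennreal (A\<^sup>2) + ennreal (B\<^sup>2))"
        by (simp only: nn_integral_add[OF m] nn_integral_L2_norm[OF L2_cell_C1(1)[OF C1]]
            nn_integral_L2_norm[OF L2_cell_C1(2)[OF C1]] A_def B_def)
      also have "\<dots> = ennreal (K * (A\<^sup>2 + B\<^sup>2))"
        using K(1) by (simp add: ennreal_mult)
      also have "\<dots> \<le> ennreal ((sqrt K * (A + B))\<^sup>2)"
        using K(1) AB by (intro ennreal_leI) (simp add: power_mult_distrib power2_sum mult_left_mono)
      finally show "L2_norm (edge_measure e) \<phi> \<le> sqrt K * (A + B)"
        using AB K(1) by (intro L2_norm_le_nn_integral L2_edge_C1[OF e C1]) auto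
    qed (use K(1) in simp)
  qed
  then obtain K where K: "\<And>e. e edge_of closure D \<Longrightarrow> K e \<ge> 0"
    "\<And>e \<phi> \<gamma>. e edge_of closure D \<Longrightarrow> C1_with_gradient \<phi> \<gamma> \<Longrightarrow>
    L2_norm (edge_measure e) \<phi> \<le> K e * (L2_norm \<mu> \<phi> + L2_norm \<mu> \<gamma>)"
    by metis
  \<comment> \<open>One constant for all edges: the sum of the finitely many nonnegative constants
    dominates each of them.\<close>
  define T where "T = (\<Sum>e | e edge_of closure D. K e)"
  have "T \<ge> 0" unfolding T_def using K(1) by (intro sum_nonneg) auto
  moreover have "L2_norm (edge_measure e) \<phi> \<le> T * (L2_norm \<mu> \<phi> + L2_norm \<mu> \<gamma>)"
    if e: "e edge_of closure D" and C1: "C1_with_gradient \<phi> \<gamma>" for e \<phi> \<gamma>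
  proof -
    have "K e \<le> T" unfolding T_def using K(1) e by (intro member_le_sum finite_edges) auto
    then have "K e * (L2_norm \<mu> \<phi> + L2_norm \<mu> \<gamma>) \<le> T * (L2_norm \<mu> \<phi> + L2_norm \<mu> \<gamma>)"
      by (intro mult_right_mono) auto
    with K(2)[OF e C1] show ?thesis by linarith
  qed
  ultimately show thesis using that by blast
qed

lemma Poincare_inequality_cell_C1:
  obtains P where "P \<ge> 0" "\<forall>\<phi> \<gamma> \<epsilon>. C1_with_gradient \<phi> \<gamma> \<longrightarrow> \<epsilon> > 0 \<longrightarrow>
    (\<exists>c. L2_norm \<mu> (\<lambda>x. \<phi> x - c) \<le> P * L2_norm \<mu> \<gamma> + \<epsilon>)"
proof -
  define d where "d = diameter D"
  have d: "dist x y \<le> d" if "x \<in> D" "y \<in> D" for x y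
    unfolding d_def using that diameter_bounded_bound[OF bounded_cell] by blast
  have d0: "d \<ge> 0" unfolding d_def by (rule diameter_ge_0[OF bounded_cell])
  have "\<exists>c. L2_norm \<mu> (\<lambda>x. \<phi> x - c) \<le> (2 * d) * L2_norm \<mu> \<gamma> + \<epsilon>"
    if C1: "C1_with_gradient \<phi> \<gamma>" and eps: "\<epsilon> > 0" for \<phi> \<gamma> \<epsilon>
  proof -
    define B where "B = L2_norm \<mu> \<gamma>"
    have B: "B \<ge> 0" by (simp add: B_def)
    have I: "(\<integral>\<^sup>+x. indicator D x * ennreal ((norm (\<gamma> x))\<^sup>2) \<partial>lborel) = ennreal (B\<^sup>2)"
      using nn_integral_L2_norm[OF L2_cell_C1(2)[OF C1]] by (simp add: nn_integral_lebesgue_on[OF borel_cell] B_def)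
    \<comment> \<open>With slack \<open>\<epsilon>^2\<close> under the square,
      \<open>a^2 + \<epsilon>^2 \<le> (a + \<epsilon>)^2\<close> leaves exactly \<epsilon> after the
      square root; likewise \<open>4 * d^2\<close> becomes \<open>2 * d\<close>.\<close>
    obtain c where c: "(\<integral>\<^sup>+x. indicator D x * ennreal ((\<phi> x - c)\<^sup>2) \<partial>lborel) \<le> ennreal (4 * d\<^sup>2) * ennreal (B\<^sup>2) + ennreal (\<epsilon>\<^sup>2)"
      using Poincare_inequality_C1[OF open_cell convex_cell nonempty_cell bounded_cell d C1, of "\<epsilon>\<^sup>2"] eps
      unfolding I by auto
    have "(\<integral>\<^sup>+x. ennreal ((norm (\<phi> x - c))\<^sup>2) \<partial>\<mu>) \<le> ennreal (4 * d\<^sup>2 * B\<^sup>2 + \<epsilon>\<^sup>2)"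
      using c by (simp add: nn_integral_lebesgue_on[OF borel_cell] ennreal_mult)
    also have "\<dots> \<le> ennreal ((2 * d * B + \<epsilon>)\<^sup>2)"
      using d0 B eps by (intro ennreal_leI) (simp add: power2_sum power_mult_distrib)
    finally have "L2_norm \<mu> (\<lambda>x. \<phi> x - c) \<le> 2 * d * B + \<epsilon>"
      using d0 B eps
      by (intro L2_norm_le_nn_integral L2_diff L2_cell_C1(1)[OF C1] L2_const finite_measure_cell) auto
    then show ?thesis unfolding B_def by blast
  qed
  with that[of "2 * d"] d0 show thesis by simp
qed

section \<open>Traces of H1 functions and the inequalities that they inherit\<close>

lemma has_trace_L2:
  assumes "has_trace D v g" "e edge_of closure D"
  shows "L2 (edge_measure e) g"
  using assms by (simp add: has_trace_def)

lemma has_trace_C1: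
  assumes "C1_with_gradient \<phi> \<gamma>"
  shows "has_trace D \<phi> \<phi>"
  unfolding has_trace_def
  using L2_edge_C1 assms C1_imp_H1_with_gradient[OF open_cell bounded_cell assms]
  by (auto intro!: exI[of _ \<gamma>] exI[of _ "\<lambda>n. \<phi>"] exI[of _ "\<lambda>n. \<gamma>"])

lemma has_trace_trace: "has_trace D v g \<Longrightarrow> has_trace D v (trace D v)"
  unfolding trace_def by (rule someI[of "has_trace D v"])

lemma has_trace_add_scaleR:
  assumes v: "has_trace D v g" and v': "has_trace D v' g'"
  shows "has_trace D (\<lambda>x. v x + c * v' x) (\<lambda>x. g x + c * g' x)"
proof -
  obtain G \<phi> \<gamma> where 1: "H1_with_gradient D v G" "\<And>n::nat. C1_with_gradient (\<phi> n) (\<gamma> n)"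
    "(\<lambda>n. L2_norm \<mu> (\<lambda>x. \<phi> n x - v x)) \<longlonglongrightarrow> 0"
    "(\<lambda>n. L2_norm \<mu> (\<lambda>x. \<gamma> n x - G x)) \<longlonglongrightarrow> 0"
    "\<And>e. e edge_of closure D \<Longrightarrow> (\<lambda>n. L2_norm (edge_measure e) (\<lambda>x. \<phi> n x - g x)) \<longlonglongrightarrow> 0"
    using v unfolding has_trace_def by blast
  obtain G' \<phi>' \<gamma>' where 2: "H1_with_gradient D v' G'" "\<And>n::nat. C1_with_gradient (\<phi>' n) (\<gamma>' n)"
    "(\<lambda>n. L2_norm \<mu> (\<lambda>x. \<phi>' n x - v' x)) \<longlonglongrightarrow> 0"
    "(\<lambda>n. L2_norm \<mu> (\<lambda>x. \<gamma>' n x - G' x)) \<longlonglongrightarrow> 0"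
    "\<And>e. e edge_of closure D \<Longrightarrow> (\<lambda>n. L2_norm (edge_measure e) (\<lambda>x. \<phi>' n x - g' x)) \<longlonglongrightarrow> 0"
    using v' unfolding has_trace_def by blast
  have L: "L2 \<mu> v" "L2 \<mu> G" "L2 \<mu> v'" "L2 \<mu> G'"
    using 1(1) 2(1) by (auto simp: H1_with_gradient_def)
  have C1: "C1_with_gradient (\<lambda>x. \<phi> n x + c * \<phi>' n x) (\<lambda>x. \<gamma> n x + c *\<^sub>R \<gamma>' n x)" for n
    using C1_with_gradient_add[OF 1(2)[of n] C1_with_gradient_mult[OF C1_with_gradient_const[of c] 2(2)[of n]]]
    by simp
  show ?thesis
    unfolding has_trace_def
  proof (intro conjI allI impI exI)
    show "L2 (edge_measure e) (\<lambda>x. g x + c * g' x)" if "e edge_of closure D" for e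
      using has_trace_L2[OF v that] has_trace_L2[OF v' that] by (intro L2_add L2_cmult)
    show "H1_with_gradient D (\<lambda>x. v x + c * v' x) (\<lambda>x. G x + c *\<^sub>R G' x)"
      by (rule H1_with_gradient_add_scaleR[OF open_cell bounded_cell 1(1) 2(1)])
    show "C1_with_gradient (\<lambda>x. \<phi> n x + c * \<phi>' n x) (\<lambda>x. \<gamma> n x + c *\<^sub>R \<gamma>' n x)" for n by (rule C1)
    show "(\<lambda>n. L2_norm \<mu> (\<lambda>x. \<phi> n x + c * \<phi>' n x - (v x + c * v' x))) \<longlonglongrightarrow> 0"
      using tendsto_L2_norm_add[OF L(1,3) L2_cell_C1(1)[OF 1(2)] L2_cell_C1(1)[OF 2(2)] 1(3) 2(3), of c] by simp
    show "(\<lambda>n. L2_norm \<mu> (\<lambda>x. \<gamma> n x + c *\<^sub>R \<gamma>' n x - (G x + c *\<^sub>R G' x))) \<longlonglongrightarrow> 0"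
      by (rule tendsto_L2_norm_add[OF L(2,4) L2_cell_C1(2)[OF 1(2)] L2_cell_C1(2)[OF 2(2)] 1(4) 2(4)])
    show "(\<lambda>n. L2_norm (edge_measure e) (\<lambda>x. \<phi> n x + c * \<phi>' n x - (g x + c * g' x))) \<longlonglongrightarrow> 0"
      if e: "e edge_of closure D" for e
      using tendsto_L2_norm_add[OF has_trace_L2[OF v e] has_trace_L2[OF v' e] L2_edge_C1[OF e 1(2)] L2_edge_C1[OF e 2(2)] 1(5)[OF e] 2(5)[OF e], of c]
      by simp
  qed
qed

text \<open>The gradient inside \<open>has_trace\<close> need not be \<open>G\<close> itself but
  equals it almost everywhere. As there are finitely many edges, one index of the approximating
  sequence serves all of them.\<close>

lemma has_trace_approximation:
  assumes v: "H1_with_gradient D v G" "has_trace D v g" and eps: "\<epsilon> > 0"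
  obtains \<phi> \<gamma> where "C1_with_gradient \<phi> \<gamma>" "L2_norm \<mu> (\<lambda>x. \<phi> x - v x) < \<epsilon>"
    "L2_norm \<mu> (\<lambda>x. \<gamma> x - G x) < \<epsilon>"
    "\<forall>e. e edge_of closure D \<longrightarrow> L2_norm (edge_measure e) (\<lambda>x. \<phi> x - g x) < \<epsilon>"
proof -
  obtain G' \<phi> \<gamma> where 1: "H1_with_gradient D v G'" "\<And>n::nat. C1_with_gradient (\<phi> n) (\<gamma> n)"
    "(\<lambda>n. L2_norm \<mu> (\<lambda>x. \<phi> n x - v x)) \<longlonglongrightarrow> 0"
    "(\<lambda>n. L2_norm \<mu> (\<lambda>x. \<gamma> n x - G' x)) \<longlonglongrightarrow> 0"
    "\<And>e. e edge_of closure D \<Longrightarrow> (\<lambda>n. L2_norm (edge_measure e) (\<lambda>x. \<phi> n x - g x)) \<longlonglongrightarrow> 0"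
    using v(2) unfolding has_trace_def by blast
  have "\<forall>\<^sub>F n in sequentially. L2_norm \<mu> (\<lambda>x. \<phi> n x - v x) < \<epsilon> \<and>
      L2_norm \<mu> (\<lambda>x. \<gamma> n x - G' x) < \<epsilon> \<and>
      (\<forall>e\<in>{e. e edge_of closure D}. L2_norm (edge_measure e) (\<lambda>x. \<phi> n x - g x) < \<epsilon>)"
    using 1(3-5) eps by (intro eventually_conj eventually_ball_finite finite_edges ballI order_tendstoD(2)) auto
  then obtain n where n: "L2_norm \<mu> (\<lambda>x. \<phi> n x - v x) < \<epsilon>"
      "L2_norm \<mu> (\<lambda>x. \<gamma> n x - G' x) < \<epsilon>"
      "\<forall>e. e edge_of closure D \<longrightarrow> L2_norm (edge_measure e) (\<lambda>x. \<phi> n x - g x) < \<epsilon>"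
    by (auto simp: eventually_sequentially)
  have "L2_norm \<mu> (\<lambda>x. \<gamma> n x - G' x) = L2_norm \<mu> (\<lambda>x. \<gamma> n x - G x)"
    using H1_gradient_unique[OF open_cell bounded_cell 1(1) v(1)] 1(1) v(1) L2_cell_C1(2)[OF 1(2)[of n]]
    by (intro L2_norm_cong_AE) (auto simp: L2_def H1_with_gradient_def)
  with n that[OF 1(2)] show thesis by simp
qed

lemma trace_inequality:
  obtains T where "T \<ge> 0" "\<forall>e v G g. e edge_of closure D \<longrightarrow> H1_with_gradient D v G \<longrightarrow> has_trace D v g \<longrightarrow>
    L2_norm (edge_measure e) g \<le> T * (L2_norm \<mu> v + L2_norm \<mu> G)"
proof -
  obtain T where T: "T \<ge> 0" "\<forall>e \<phi> \<gamma>. e edge_of closure D \<longrightarrow> C1_with_gradient \<phi> \<gamma> \<longrightarrow>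
    L2_norm (edge_measure e) \<phi> \<le> T * (L2_norm \<mu> \<phi> + L2_norm \<mu> \<gamma>)"
    by (rule trace_inequality_C1)
  have "L2_norm (edge_measure e) g \<le> T * (L2_norm \<mu> v + L2_norm \<mu> G) + \<epsilon>"
    if e: "e edge_of closure D" and v: "H1_with_gradient D v G" "has_trace D v g" and eps: "\<epsilon> > 0" for e v G g \<epsilon>
  proof -
    \<comment> \<open>Approximating \<open>v\<close> and \<open>G\<close> costs
      \<open>2 * T * d\<close>, and approximating the trace costs another \<open>d\<close>.\<close>
    define d where "d = \<epsilon> / (2 * T + 1)"
    have d: "d > 0" "(2 * T + 1) * d = \<epsilon>" using T(1) eps by (simp_all add: d_def)
    obtain \<phi> \<gamma> where \<phi>: "C1_with_gradient \<phi> \<gamma>" "L2_norm \<mu> (\<lambda>x. \<phi> x - v x) < d"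
      "L2_norm \<mu> (\<lambda>x. \<gamma> x - G x) < d"
      "\<forall>e. e edge_of closure D \<longrightarrow> L2_norm (edge_measure e) (\<lambda>x. \<phi> x - g x) < d"
      by (rule has_trace_approximation[OF v d(1)])
    have L: "L2 \<mu> v" "L2 \<mu> G" using v(1) by (auto simp: H1_with_gradient_def)
    have "L2_norm \<mu> \<phi> + L2_norm \<mu> \<gamma> \<le> L2_norm \<mu> v + L2_norm \<mu> G + 2 * d"
      using L2_norm_le_add_diff[OF L2_cell_C1(1)[OF \<phi>(1)] L(1)] L2_norm_le_add_diff[OF L2_cell_C1(2)[OF \<phi>(1)] L(2)] \<phi>(2,3)
      by linarith
    from mult_left_mono[OF this T(1)]
    have "T * (L2_norm \<mu> \<phi> + L2_norm \<mu> \<gamma>) \<le> T * (L2_norm \<mu> v + L2_norm \<mu> G) + 2 * T * d"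
      by (simp add: algebra_simps)
    moreover have "L2_norm (edge_measure e) \<phi> \<le> T * (L2_norm \<mu> \<phi> + L2_norm \<mu> \<gamma>)"
      using T(2) e \<phi>(1) by blast
    moreover have "L2_norm (edge_measure e) g \<le> L2_norm (edge_measure e) \<phi> + d"
      using L2_norm_le_add_diff[OF has_trace_L2[OF v(2) e] L2_edge_C1[OF e \<phi>(1)]] \<phi>(4) e
      by (auto simp: L2_norm_minus_commute[of _ g])
    moreover have "2 * T * d + d = \<epsilon>" using d(2) by (simp add: algebra_simps)
    ultimately show ?thesis by linarith
  qed
  with T(1) that show thesis by (meson field_le_epsilon)
qed

text \<open>\<open>has_trace\<close> is assumed because it supplies the C1 functions converging to
  \<open>v\<close> together with their gradients. The constant \<open>c\<close> is the one of a
  nearby C1 function, hence the slack \<epsilon>.\<close>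

lemma Poincare_inequality:
  obtains P where "P \<ge> 0" "\<forall>v G g \<epsilon>. H1_with_gradient D v G \<longrightarrow> has_trace D v g \<longrightarrow> \<epsilon> > 0 \<longrightarrow>
    (\<exists>c. L2_norm \<mu> (\<lambda>x. v x - c) \<le> P * L2_norm \<mu> G + \<epsilon>)"
proof -
  obtain P where P: "P \<ge> 0" "\<forall>\<phi> \<gamma> \<epsilon>. C1_with_gradient \<phi> \<gamma> \<longrightarrow> \<epsilon> > 0 \<longrightarrow>
    (\<exists>c. L2_norm \<mu> (\<lambda>x. \<phi> x - c) \<le> P * L2_norm \<mu> \<gamma> + \<epsilon>)"
    by (rule Poincare_inequality_cell_C1)
  have "\<exists>c. L2_norm \<mu> (\<lambda>x. v x - c) \<le> P * L2_norm \<mu> G + \<epsilon>"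
    if v: "H1_with_gradient D v G" "has_trace D v g" and eps: "\<epsilon> > 0" for v G g \<epsilon>
  proof -
    \<comment> \<open>Three errors add up: \<open>P * d\<close> for the gradient, \<open>d\<close>
      for the slack of the C1 inequality and \<open>d\<close> for the distance from \<phi> to
      \<open>v\<close>.\<close>
    define d where "d = \<epsilon> / (P + 2)"
    have d: "d > 0" "(P + 2) * d = \<epsilon>" using P(1) eps by (simp_all add: d_def)
    obtain \<phi> \<gamma> where \<phi>: "C1_with_gradient \<phi> \<gamma>" "L2_norm \<mu> (\<lambda>x. \<phi> x - v x) < d"
      "L2_norm \<mu> (\<lambda>x. \<gamma> x - G x) < d"
      "\<forall>e. e edge_of closure D \<longrightarrow> L2_norm (edge_measure e) (\<lambda>x. \<phi> x - g x) < d"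
      by (rule has_trace_approximation[OF v d(1)])
    have L: "L2 \<mu> v" "L2 \<mu> G" using v(1) by (auto simp: H1_with_gradient_def)
    obtain c where c: "L2_norm \<mu> (\<lambda>x. \<phi> x - c) \<le> P * L2_norm \<mu> \<gamma> + d"
      using P(2) \<phi>(1) d by blast
    have "L2_norm \<mu> \<gamma> \<le> L2_norm \<mu> G + d"
      using L2_norm_le_add_diff[OF L2_cell_C1(2)[OF \<phi>(1)] L(2)] \<phi>(3) by linarith
    from mult_left_mono[OF this P(1)]
    have "P * L2_norm \<mu> \<gamma> \<le> P * L2_norm \<mu> G + P * d"
      by (simp add: algebra_simps)
    moreover have "L2_norm \<mu> (\<lambda>x. v x - c) \<le> d + L2_norm \<mu> (\<lambda>x. \<phi> x - c)"
      using L2_norm_triangle_diff[OF L(1) L2_cell_C1(1)[OF \<phi>(1)] L2_const[OF finite_measure_cell, of c]] \<phi>(2)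
      by (simp add: L2_norm_minus_commute[of _ v])
    moreover have "P * d + 2 * d = \<epsilon>" using d(2) by (simp add: algebra_simps)
    ultimately show ?thesis using c by (intro exI[of _ c]) linarith
  qed
  with P(1) that show thesis by blast
qed

text \<open>By linearity the difference is a trace of the zero function, and the trace inequality
  forces its norm to be zero.\<close>

lemma has_trace_unique:
  assumes t: "has_trace D v g" "has_trace D v g'" and e: "e edge_of closure D"
  shows "AE x in edge_measure e. g x = g' x"
proof -
  obtain T where T: "T \<ge> 0" "\<forall>e v G g. e edge_of closure D \<longrightarrow> H1_with_gradient D v G \<longrightarrow> has_trace D v g \<longrightarrow>
    L2_norm (edge_measure e) g \<le> T * (L2_norm \<mu> v + L2_norm \<mu> G)"
    by (rule trace_inequality)
  have 0: "has_trace D (\<lambda>x. 0) (\<lambda>x. g x - g' x)"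
    using has_trace_add_scaleR[OF t, of "-1"] by simp
  have "H1_with_gradient D (\<lambda>x. 0) (\<lambda>x. 0)"
    by (rule C1_imp_H1_with_gradient[OF open_cell bounded_cell C1_with_gradient_const])
  with T(2) 0 e have "L2_norm (edge_measure e) (\<lambda>x. g x - g' x)
      \<le> T * (L2_norm \<mu> (\<lambda>x. 0::real) + L2_norm \<mu> (\<lambda>x. 0::real^2))" by blast
  then have "L2_norm (edge_measure e) (\<lambda>x. g x - g' x) = 0"
    using L2_norm_nonneg[of "edge_measure e" "\<lambda>x. g x - g' x"] by simp
  from L2_norm_zero_imp_AE[OF has_trace_L2[OF 0 e] this] show ?thesis by simp
qed

lemma vanishes_on_add_scaleR:
  assumes "vanishes_on D S v" "vanishes_on D S v'"
  shows "vanishes_on D S (\<lambda>x. v x + c * v' x)"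
proof -
  obtain g where g: "has_trace D v g" "\<And>e. e edge_of closure D \<Longrightarrow> AE x in edge_measure e. x \<in> S \<longrightarrow> g x = 0"
    using assms(1) unfolding vanishes_on_def by blast
  obtain g' where g': "has_trace D v' g'" "\<And>e. e edge_of closure D \<Longrightarrow> AE x in edge_measure e. x \<in> S \<longrightarrow> g' x = 0"
    using assms(2) unfolding vanishes_on_def by blast
  have "AE x in edge_measure e. x \<in> S \<longrightarrow> g x + c * g' x = 0" if "e edge_of closure D" for e
    using g(2)[OF that] g'(2)[OF that] by eventually_elim auto
  with has_trace_add_scaleR[OF g(1) g'(1)] show ?thesis unfolding vanishes_on_def by blast
qed

lemma vanishes_on_imp_has_trace: "vanishes_on D S v \<Longrightarrow> has_trace D v (trace D v)"
  using has_trace_trace by (auto simp: vanishes_on_def)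

text \<open>The trace inequality is applied to \<open>v - c\<close>, which has the same gradient as
  \<open>v\<close>. One and the same \<open>c\<close> has to serve inside the cell and on all its
  edges, since it is later read off on one interface and carried to another.\<close>

lemma nearly_constant:
  obtains K where "K \<ge> 0" "\<forall>v G g \<epsilon>. H1_with_gradient D v G \<longrightarrow> has_trace D v g \<longrightarrow> \<epsilon> > 0 \<longrightarrow>
    (\<exists>c. L2_norm \<mu> (\<lambda>x. v x - c) \<le> K * L2_norm \<mu> G + \<epsilon> \<and>
      (\<forall>e. e edge_of closure D \<longrightarrow> L2_norm (edge_measure e) (\<lambda>x. g x - c) \<le> K * L2_norm \<mu> G + \<epsilon>))"
proof -
  obtain T where T: "T \<ge> 0" "\<forall>e v G g. e edge_of closure D \<longrightarrow> H1_with_gradient D v G \<longrightarrow> has_trace D v g \<longrightarrow>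
    L2_norm (edge_measure e) g \<le> T * (L2_norm \<mu> v + L2_norm \<mu> G)"
    by (rule trace_inequality)
  obtain P where P: "P \<ge> 0" "\<forall>v G g \<epsilon>. H1_with_gradient D v G \<longrightarrow> has_trace D v g \<longrightarrow> \<epsilon> > 0 \<longrightarrow>
    (\<exists>c. L2_norm \<mu> (\<lambda>x. v x - c) \<le> P * L2_norm \<mu> G + \<epsilon>)"
    by (rule Poincare_inequality)
  \<comment> \<open>Both bounds have the form \<open>r * (P * B + d + B)\<close>, with
    \<open>r = 1\<close> in the cell and \<open>r = T\<close> on the edges;
    \<open>r \<le> T + 1\<close> covers the two cases.\<close>
  define K where "K = (T + 1) * (P + 1)"
  have "\<exists>c. L2_norm \<mu> (\<lambda>x. v x - c) \<le> K * L2_norm \<mu> G + \<epsilon> \<and>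
      (\<forall>e. e edge_of closure D \<longrightarrow> L2_norm (edge_measure e) (\<lambda>x. g x - c) \<le> K * L2_norm \<mu> G + \<epsilon>)"
    if v: "H1_with_gradient D v G" and g: "has_trace D v g" and eps: "\<epsilon> > 0" for v G g \<epsilon>
  proof -
    define B where "B = L2_norm \<mu> G"
    define d where "d = \<epsilon> / (T + 1)"
    have d: "d > 0" "(T + 1) * d = \<epsilon>" using T(1) eps by (simp_all add: d_def)
    obtain c where c: "L2_norm \<mu> (\<lambda>x. v x - c) \<le> P * B + d"
      unfolding B_def using P(2) v g d(1) by blast
    note const = C1_with_gradient_const[of c]
    have v': "H1_with_gradient D (\<lambda>x. v x - c) G" "has_trace D (\<lambda>x. v x - c) (\<lambda>x. g x - c)"
      using H1_with_gradient_add_scaleR[OF open_cell bounded_cell v C1_imp_H1_with_gradient[OF open_cell bounded_cell const], of "-1"]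
        has_trace_add_scaleR[OF g has_trace_C1[OF const], of "-1"] by simp_all
    have le: "r * (P * B + d + B) \<le> K * B + \<epsilon>" if "0 \<le> r" "r \<le> T + 1" for r
    proof -
      have "r * (P * B + d + B) \<le> (T + 1) * (P * B + d + B)"
        using that P(1) d(1) by (intro mult_right_mono) (auto simp: B_def)
      also have "\<dots> = K * B + (T + 1) * d" by (simp add: K_def algebra_simps)
      finally show ?thesis using d(2) by simp
    qed
    have "L2_norm \<mu> (\<lambda>x. v x - c) \<le> 1 * (P * B + d + B)"
      using add_mono[OF c, of 0 B] by (simp add: B_def)
    also have "\<dots> \<le> K * B + \<epsilon>" using T(1) by (intro le) auto
    finally have A: "L2_norm \<mu> (\<lambda>x. v x - c) \<le> K * B + \<epsilon>" .
    have "L2_norm (edge_measure e) (\<lambda>x. g x - c) \<le> K * B + \<epsilon>" if e: "e edge_of closure D" for e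
    proof -
      have "L2_norm (edge_measure e) (\<lambda>x. g x - c) \<le> T * (L2_norm \<mu> (\<lambda>x. v x - c) + B)"
        unfolding B_def using T(2) e v' by blast
      also have "\<dots> \<le> T * (P * B + d + B)" using c T(1) by (intro mult_left_mono) auto
      also have "\<dots> \<le> K * B + \<epsilon>" using T(1) by (intro le) auto
      finally show ?thesis .
    qed
    with A show ?thesis unfolding B_def by blast
  qed
  with that[of K] T(1) P(1) show thesis by (simp add: K_def)
qed

end

section \<open>Normal derivatives and energy\<close>

context polygonal_cell
begin

lemma has_normal_derivative_L2:
  assumes "has_normal_derivative D \<Gamma> v h" "e edge_of closure D" "e \<subseteq> \<Gamma>"
  shows "L2 (edge_measure e) h"
  using assms by (simp add: has_normal_derivative_def)

text \<open>\<open>has_normal_derivative\<close> speaks of one hidden gradient, one hidden Laplacian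
  and the trace selected by \<open>SOME\<close>; uniqueness almost everywhere extends its formula to
  any other choice.\<close>

lemma Green_formula:
  assumes h: "has_normal_derivative D \<Gamma> v h"
    and G: "H1_with_gradient D v G" and l: "has_weak_laplacian D v l"
    and w: "H1_with_gradient D w W" "vanishes_on D (frontier D - \<Gamma>) w" and g: "has_trace D w g"
  shows "(LINT x|\<mu>. G x \<bullet> W x) + (LINT x|\<mu>. l x * w x) =
    (\<Sum>e | e edge_of closure D \<and> e \<subseteq> \<Gamma>. LINT x|edge_measure e. h x * g x)"
proof -
  obtain G' l' where 1: "H1_with_gradient D v G'" "has_weak_laplacian D v l'"
    and eq: "\<forall>w W. H1_with_gradient D w W \<and> vanishes_on D (frontier D - \<Gamma>) w \<longrightarrow>
           (LINT x|\<mu>. G' x \<bullet> W x + l' x * w x) =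
           (\<Sum>e | e edge_of closure D \<and> e \<subseteq> \<Gamma>. LINT x|edge_measure e. h x * trace D w x)"
    using h unfolding has_normal_derivative_def by blast
  have L: "L2 \<mu> G" "L2 \<mu> G'" "L2 \<mu> l" "L2 \<mu> l'"
    "L2 \<mu> w" "L2 \<mu> W"
    using G l w(1) 1 by (auto simp: H1_with_gradient_def has_weak_laplacian_def)
  have GG: "AE x in \<mu>. G' x = G x"
    by (rule H1_gradient_unique[OF open_cell bounded_cell 1(1) G])
  have ll: "AE x in \<mu>. l' x = l x"
    by (rule weak_laplacian_unique[OF open_cell bounded_cell 1(2) l])
  have i: "integrable \<mu> (\<lambda>x. G x \<bullet> W x)" "integrable \<mu> (\<lambda>x. l x * w x)"
    using integrable_inner_L2[OF L(1,6)] integrable_inner_L2[OF L(3,5)] by auto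
  have tr: "(LINT x|edge_measure e. h x * trace D w x) = (LINT x|edge_measure e. h x * g x)"
    if e: "e edge_of closure D" "e \<subseteq> \<Gamma>" for e
  proof -
    have m: "h \<in> borel_measurable (edge_measure e)" "g \<in> borel_measurable (edge_measure e)"
      "trace D w \<in> borel_measurable (edge_measure e)"
      using has_normal_derivative_L2[OF h e] has_trace_L2[OF g e(1)] has_trace_L2[OF has_trace_trace[OF g] e(1)]
      by (simp_all only: L2_def)
    have "AE x in edge_measure e. h x * trace D w x = h x * g x"
      using has_trace_unique[OF has_trace_trace[OF g] g e(1)] by eventually_elim simp
    then show ?thesis
      by (rule integral_cong_AE[rotated 2]) (intro borel_measurable_times m)+
  qed
  have "(LINT x|\<mu>. G x \<bullet> W x) + (LINT x|\<mu>. l x * w x)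
      = (LINT x|\<mu>. G x \<bullet> W x + l x * w x)"
    using i by simp
  also have "\<dots> = (LINT x|\<mu>. G' x \<bullet> W x + l' x * w x)"
  proof (rule integral_cong_AE)
    show "AE x in \<mu>. G x \<bullet> W x + l x * w x = G' x \<bullet> W x + l' x * w x"
      using GG ll by eventually_elim simp
  qed (use L in \<open>auto simp: L2_def\<close>)
  also have "\<dots> = (\<Sum>e | e edge_of closure D \<and> e \<subseteq> \<Gamma>. LINT x|edge_measure e. h x * trace D w x)"
    using eq w by blast
  also have "\<dots> = (\<Sum>e | e edge_of closure D \<and> e \<subseteq> \<Gamma>. LINT x|edge_measure e. h x * g x)"
    by (rule sum.cong) (auto simp: tr)
  finally show ?thesis .
qed

text \<open>An open set that carries the full arc length of \<open>e\<close>, because two edges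
  share at most a point. Bumps supported in it vanish on every other edge but need not vanish inside
  the cell.\<close>

definition away_from_other_edges :: "(real^2) set \<Rightarrow> (real^2) set" where
  "away_from_other_edges e = - \<Union>{e'. e' edge_of closure D \<and> e' \<noteq> e}"

lemma open_away: "open (away_from_other_edges e)"
  unfolding away_from_other_edges_def
proof (intro open_Compl closed_Union)
  show "finite {e'. e' edge_of closure D \<and> e' \<noteq> e}"
    by (rule finite_subset[OF _ finite_edges]) auto
  show "\<forall>e'\<in>{e'. e' edge_of closure D \<and> e' \<noteq> e}. closed e'"
  proof
    fix e' assume "e' \<in> {e'. e' edge_of closure D \<and> e' \<noteq> e}"
    then have "e' edge_of closure D" by simp
    then obtain s t where "e' = closed_segment s t" by (rule edge_cases)
    then show "closed e'" by simp
  qed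
qed

lemma AE_away:
  assumes "e edge_of closure D"
  shows "AE x in edge_measure e. x \<in> away_from_other_edges e"
  using AE_edge_not_in_other_edges[OF assms] by eventually_elim (auto simp: away_from_other_edges_def)

text \<open>The bump vanishes on all edges other than \<open>e\<close>, so it satisfies the boundary
  condition required in Green's formula, and a single term of the sum over edges survives.\<close>

lemma Green_formula_bump:
  assumes h: "has_normal_derivative D \<Gamma> v h"
    and G: "H1_with_gradient D v G" and l: "has_weak_laplacian D v l"
    and e: "e edge_of closure D" "e \<subseteq> \<Gamma>" and T: "test_function (away_from_other_edges e) \<phi> \<gamma>"
  shows "(LINT x|\<mu>. G x \<bullet> \<gamma> x) + (LINT x|\<mu>. l x * \<phi> x) = (LINT x|edge_measure e. h x * \<phi> x)"
proof -
  have C1: "C1_with_gradient \<phi> \<gamma>" using T by (simp add: test_function_def)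
  have z: "\<phi> x = 0" if "e' edge_of closure D" "e' \<noteq> e" "x \<in> e'" for x e'
    using test_function_zero_outside(1)[OF T, of x] that by (auto simp: away_from_other_edges_def)
  have "vanishes_on D (frontier D - \<Gamma>) \<phi>"
    unfolding vanishes_on_def
  proof (intro exI[of _ \<phi>] conjI allI impI has_trace_C1[OF C1])
    fix e' assume e': "e' edge_of closure D"
    show "AE x in edge_measure e'. x \<in> frontier D - \<Gamma> \<longrightarrow> \<phi> x = 0"
      using AE_edge_in[OF e'] by eventually_elim (use e z[OF e'] in blast)
  qed
  from Green_formula[OF h G l C1_imp_H1_with_gradient[OF open_cell bounded_cell C1] this has_trace_C1[OF C1]]
  have "(LINT x|\<mu>. G x \<bullet> \<gamma> x) + (LINT x|\<mu>. l x * \<phi> x) =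
    (\<Sum>e' | e' edge_of closure D \<and> e' \<subseteq> \<Gamma>. LINT x|edge_measure e'. h x * \<phi> x)" .
  also have "\<dots> = (\<Sum>e' | e' edge_of closure D \<and> e' \<subseteq> \<Gamma>. if e' = e then LINT x|edge_measure e. h x * \<phi> x else 0)"
  proof (rule sum.cong)
    fix e' assume "e' \<in> {e'. e' edge_of closure D \<and> e' \<subseteq> \<Gamma>}"
    then have e': "e' edge_of closure D" by simp
    have "(LINT x|edge_measure e'. h x * \<phi> x) = 0" if "e' \<noteq> e"
    proof (rule integral_eq_zero_AE)
      show "AE x in edge_measure e'. h x * \<phi> x = 0"
        using AE_edge_in[OF e'] by eventually_elim (use z[OF e' that] in simp)
    qed
    then show "(LINT x|edge_measure e'. h x * \<phi> x) = (if e' = e then LINT x|edge_measure e. h x * \<phi> x else 0)"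
      by simp
  qed simp
  also have "\<dots> = (LINT x|edge_measure e. h x * \<phi> x)"
  proof -
    have "finite {e'. e' edge_of closure D \<and> e' \<subseteq> \<Gamma>}"
      by (rule finite_subset[OF _ finite_edges]) auto
    then show ?thesis using e by simp
  qed
  finally show ?thesis .
qed

text \<open>The left side of Green's formula depends on \<open>v\<close> alone, so \<open>h\<close>
  and \<open>h'\<close> have the same integrals against all bumps at \<open>e\<close>; the
  fundamental lemma for arc length concludes.\<close>

lemma has_normal_derivative_unique:
  assumes h: "has_normal_derivative D \<Gamma> v h" "has_normal_derivative D \<Gamma> v h'"
    and e: "e edge_of closure D" "e \<subseteq> \<Gamma>"
  shows "AE x in edge_measure e. h x = h' x"
proof -
  obtain G l where Gl: "H1_with_gradient D v G" "has_weak_laplacian D v l"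
    using h(1) unfolding has_normal_derivative_def by blast
  note L = has_normal_derivative_L2[OF h(1) e] has_normal_derivative_L2[OF h(2) e]
  have "AE x in edge_measure e. x \<in> away_from_other_edges e \<longrightarrow> h x - h' x = 0"
  proof (rule AE_zero_of_test_functions[OF _ _ open_away])
    show "integrable (edge_measure e) (\<lambda>x. h x - h' x)"
      by (intro L2_imp_integrable finite_edge_measure_edge e L2_diff L)
    fix \<phi> \<gamma> assume T: "test_function (away_from_other_edges e) \<phi> \<gamma>"
    then have "L2 (edge_measure e) \<phi>"
      using L2_edge_C1[OF e(1)] by (auto simp: test_function_def)
    then have i: "integrable (edge_measure e) (\<lambda>x. h x * \<phi> x)" "integrable (edge_measure e) (\<lambda>x. h' x * \<phi> x)"
      using integrable_inner_L2[OF L(1)] integrable_inner_L2[OF L(2)] by auto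
    have "(LINT x|edge_measure e. h x * \<phi> x) = (LINT x|edge_measure e. h' x * \<phi> x)"
      using Green_formula_bump[OF h(1) Gl e T] Green_formula_bump[OF h(2) Gl e T] by simp
    then show "(LINT x|edge_measure e. \<phi> x * (h x - h' x)) = 0"
      using i by (simp add: right_diff_distrib mult.commute)
  qed simp
  with AE_away[OF e(1)] show ?thesis by eventually_elim simp
qed

lemma has_normal_derivative_normal_derivative:
  "has_normal_derivative D \<Gamma> v h \<Longrightarrow> has_normal_derivative D \<Gamma> v (normal_derivative D \<Gamma> v)"
  unfolding normal_derivative_def by (rule someI[of "has_normal_derivative D \<Gamma> v"])

lemma has_normal_derivative_add_scaleR:
  assumes h: "has_normal_derivative D \<Gamma> v h" and h': "has_normal_derivative D \<Gamma> v' h'"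
  shows "has_normal_derivative D \<Gamma> (\<lambda>x. v x + c * v' x) (\<lambda>x. h x + c * h' x)"
proof -
  obtain G l where Gl: "H1_with_gradient D v G" "has_weak_laplacian D v l"
    using h unfolding has_normal_derivative_def by blast
  obtain G' l' where Gl': "H1_with_gradient D v' G'" "has_weak_laplacian D v' l'"
    using h' unfolding has_normal_derivative_def by blast
  have L: "L2 \<mu> G" "L2 \<mu> G'" "L2 \<mu> l" "L2 \<mu> l'"
    using Gl Gl' by (auto simp: H1_with_gradient_def has_weak_laplacian_def)
  have "(LINT x|\<mu>. (G x + c *\<^sub>R G' x) \<bullet> W x + (l x + c * l' x) * w x) =
      (\<Sum>e | e edge_of closure D \<and> e \<subseteq> \<Gamma>. LINT x|edge_measure e. (h x + c * h' x) * trace D w x)"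
    if w: "H1_with_gradient D w W" "vanishes_on D (frontier D - \<Gamma>) w" for w W
  proof -
    have tr: "has_trace D w (trace D w)" by (rule vanishes_on_imp_has_trace[OF w(2)])
    have Lw: "L2 \<mu> w" "L2 \<mu> W"
      using w(1) by (auto simp: H1_with_gradient_def)
    have i: "integrable \<mu> (\<lambda>x. G x \<bullet> W x)" "integrable \<mu> (\<lambda>x. G' x \<bullet> W x)"
      "integrable \<mu> (\<lambda>x. l x * w x)" "integrable \<mu> (\<lambda>x. l' x * w x)"
      using integrable_inner_L2[OF L(1) Lw(2)] integrable_inner_L2[OF L(2) Lw(2)]
        integrable_inner_L2[OF L(3) Lw(1)] integrable_inner_L2[OF L(4) Lw(1)] by auto
    have j: "(LINT x|edge_measure e. (h x + c * h' x) * trace D w x) =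
        (LINT x|edge_measure e. h x * trace D w x) + c * (LINT x|edge_measure e. h' x * trace D w x)"
      if e: "e edge_of closure D" "e \<subseteq> \<Gamma>" for e
      using integrable_inner_L2[OF has_normal_derivative_L2[OF h e] has_trace_L2[OF tr e(1)]]
        integrable_inner_L2[OF has_normal_derivative_L2[OF h' e] has_trace_L2[OF tr e(1)]]
      by (simp add: distrib_right mult.assoc)
    have "(LINT x|\<mu>. (G x + c *\<^sub>R G' x) \<bullet> W x + (l x + c * l' x) * w x) =
        (LINT x|\<mu>. (G x \<bullet> W x + c * (G' x \<bullet> W x)) + (l x * w x + c * (l' x * w x)))"
      by (simp add: inner_add_left distrib_right mult.assoc)
    also have "\<dots> = ((LINT x|\<mu>. G x \<bullet> W x) + (LINT x|\<mu>. l x * w x)) +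
        c * ((LINT x|\<mu>. G' x \<bullet> W x) + (LINT x|\<mu>. l' x * w x))"
      using i by (simp add: distrib_left)
    also have "\<dots> = (\<Sum>e | e edge_of closure D \<and> e \<subseteq> \<Gamma>. LINT x|edge_measure e. h x * trace D w x) +
        c * (\<Sum>e | e edge_of closure D \<and> e \<subseteq> \<Gamma>. LINT x|edge_measure e. h' x * trace D w x)"
      unfolding Green_formula[OF h Gl w tr] Green_formula[OF h' Gl' w tr] ..
    also have "\<dots> = (\<Sum>e | e edge_of closure D \<and> e \<subseteq> \<Gamma>. LINT x|edge_measure e. (h x + c * h' x) * trace D w x)"
      unfolding sum_distrib_left sum.distrib[symmetric] by (rule sum.cong) (auto simp: j)
    finally show ?thesis .
  qed
  moreover have "L2 (edge_measure e) (\<lambda>x. h x + c * h' x)" if "e edge_of closure D" "e \<subseteq> \<Gamma>" for e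
    using has_normal_derivative_L2[OF h that] has_normal_derivative_L2[OF h' that] by (intro L2_add L2_cmult)
  ultimately show ?thesis
    unfolding has_normal_derivative_def
    using H1_with_gradient_add_scaleR[OF open_cell bounded_cell Gl(1) Gl'(1)]
      has_weak_laplacian_add_scaleR[OF open_cell bounded_cell Gl(2) Gl'(2)]
    by blast
qed

section \<open>Energy and Robin data of homogeneous solutions\<close>

lemma solves_homogeneous_laplacian:
  assumes "solves_pde \<eta> D (\<lambda>x. 0) v" "H1_with_gradient D v G"
  shows "has_weak_laplacian D v (\<lambda>x. \<eta> * v x)"
proof -
  obtain l where l: "has_weak_laplacian D v l" "AE x in \<mu>. \<eta> * v x - l x = 0"
    using assms(1) by (auto simp: solves_pde_def)
  have Lv: "L2 \<mu> (\<lambda>x. \<eta> * v x)" using assms(2) by (auto simp: H1_with_gradient_def intro: L2_cmult)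
  have Ll: "L2 \<mu> l" using l(1) by (simp add: has_weak_laplacian_def)
  have eq: "(LINT x|\<mu>. l x * \<phi> x) = (LINT x|\<mu>. \<eta> * v x * \<phi> x)"
    if "test_function D \<phi> g" for \<phi> g
  proof (rule integral_cong_AE)
    show "AE x in \<mu>. l x * \<phi> x = \<eta> * v x * \<phi> x" using l(2) by eventually_elim simp
    have "\<phi> \<in> borel_measurable \<mu>"
      using L2_cell_C1(1)[of \<phi> g] that by (auto simp: test_function_def L2_def)
    then show "(\<lambda>x. l x * \<phi> x) \<in> borel_measurable \<mu>" "(\<lambda>x. \<eta> * v x * \<phi> x) \<in> borel_measurable \<mu>"
      using L2_measurable[OF Ll] L2_measurable[OF Lv] by (auto intro: borel_measurable_times)
  qed
  from l(1) Lv show ?thesis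
    unfolding has_weak_laplacian_def by (auto simp: eq)
qed

lemma energy_identity:
  assumes v: "solves_pde \<eta> D (\<lambda>x. 0) v" "H1_with_gradient D v G" "vanishes_on D (frontier D - \<Gamma>) v"
    and h: "has_normal_derivative D \<Gamma> v h" and g: "has_trace D v g"
  shows "(L2_norm \<mu> G)\<^sup>2 + \<eta> * (L2_norm \<mu> v)\<^sup>2 =
    (\<Sum>e | e edge_of closure D \<and> e \<subseteq> \<Gamma>. LINT x|edge_measure e. h x * g x)"
proof -
  have "(LINT x|\<mu>. \<eta> * v x * v x) = \<eta> * (L2_norm \<mu> v)\<^sup>2"
    unfolding L2_norm_square by (simp add: power2_eq_square mult.assoc)
  moreover have "(LINT x|\<mu>. G x \<bullet> G x) = (L2_norm \<mu> G)\<^sup>2"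
    by (simp add: L2_norm_square power2_norm_eq_inner)
  ultimately show ?thesis
    using Green_formula[OF h v(2) solves_homogeneous_laplacian[OF v(1,2)] v(2,3) g] by simp
qed

text \<open>Edge by edge, \<open>(h + p * g)^2 - (- h + p * g)^2 = 4 * p * h * g\<close>; summed
  over the edges, the right side is the energy by Green's formula. The two squares are the Robin
  data read from inside the cell and from across the edge.\<close>

lemma robin_energy_identity:
  assumes v: "solves_pde \<eta> D (\<lambda>x. 0) v" "H1_with_gradient D v G" "vanishes_on D (frontier D - \<Gamma>) v"
    and h: "has_normal_derivative D \<Gamma> v h" and g: "has_trace D v g"
  shows "(\<Sum>e | e edge_of closure D \<and> e \<subseteq> \<Gamma>. (L2_norm (edge_measure e) (\<lambda>x. h x + p * g x))\<^sup>2) =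
    (\<Sum>e | e edge_of closure D \<and> e \<subseteq> \<Gamma>. (L2_norm (edge_measure e) (\<lambda>x. - h x + p * g x))\<^sup>2) +
    4 * p * ((L2_norm \<mu> G)\<^sup>2 + \<eta> * (L2_norm \<mu> v)\<^sup>2)"
proof -
  have "(L2_norm (edge_measure e) (\<lambda>x. h x + p * g x))\<^sup>2 =
      (L2_norm (edge_measure e) (\<lambda>x. - h x + p * g x))\<^sup>2 + 4 * p * (LINT x|edge_measure e. h x * g x)"
    if e: "e edge_of closure D" "e \<subseteq> \<Gamma>" for e
  proof -
    have L: "L2 (edge_measure e) h" "L2 (edge_measure e) (\<lambda>x. - h x)" "L2 (edge_measure e) (\<lambda>x. p * g x)"
      using has_normal_derivative_L2[OF h e] L2_cmult[OF has_normal_derivative_L2[OF h e], of "-1"]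
        has_trace_L2[OF g e(1)] by (auto intro: L2_cmult)
    have "L2_norm (edge_measure e) (\<lambda>x. - h x) = L2_norm (edge_measure e) h"
      using L2_norm_cmult[of "edge_measure e" "-1" h] by simp
    then show ?thesis
      unfolding L2_norm_add_square[OF L(1,3)] L2_norm_add_square[OF L(2,3)]
      by (simp add: mult.left_commute)
  qed
  then have "(\<Sum>e | e edge_of closure D \<and> e \<subseteq> \<Gamma>. (L2_norm (edge_measure e) (\<lambda>x. h x + p * g x))\<^sup>2) =
    (\<Sum>e | e edge_of closure D \<and> e \<subseteq> \<Gamma>. (L2_norm (edge_measure e) (\<lambda>x. - h x + p * g x))\<^sup>2 +
      4 * p * (LINT x|edge_measure e. h x * g x))"
    by (intro sum.cong) auto
  then show ?thesis
    unfolding energy_identity[OF v h g] by (simp add: sum.distrib sum_distrib_left)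
qed

text \<open>Tested with a fixed bump, the flux is bounded by gradient and function through Green's
  formula, and the trace is replaced by the constant \<open>c\<close>. The sign \<open>s\<close> is
  1 for own Robin data and -1 for those seen by the neighbour.\<close>

lemma robin_bump_estimate:
  assumes v: "solves_pde \<eta> D (\<lambda>x. 0) v" "H1_with_gradient D v G" and \<eta>: "\<eta> \<ge> 0"
    and h: "has_normal_derivative D \<Gamma> v h" and g: "has_trace D v g"
    and e: "e edge_of closure D" "e \<subseteq> \<Gamma>" and T: "test_function (away_from_other_edges e) \<phi> \<gamma>"
    and s: "\<bar>s\<bar> = 1"
  shows "\<bar>(LINT x|edge_measure e. (s * h x + p * g x) * \<phi> x) - p * c * (LINT x|edge_measure e. \<phi> x)\<bar>
    \<le> L2_norm \<mu> G * L2_norm \<mu> \<gamma> + \<eta> * L2_norm \<mu> v * L2_norm \<mu> \<phi>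
      + \<bar>p\<bar> * (L2_norm (edge_measure e) (\<lambda>x. g x - c) * L2_norm (edge_measure e) \<phi>)"
proof -
  have C1: "C1_with_gradient \<phi> \<gamma>" using T by (simp add: test_function_def)
  have L: "L2 \<mu> G" "L2 \<mu> v" "L2 \<mu> \<phi>" "L2 \<mu> \<gamma>"
    using v(2) L2_cell_C1[OF C1] by (auto simp: H1_with_gradient_def)
  have Le: "L2 (edge_measure e) h" "L2 (edge_measure e) g" "L2 (edge_measure e) \<phi>" "L2 (edge_measure e) (\<lambda>x. c)"
    using has_normal_derivative_L2[OF h e] has_trace_L2[OF g e(1)] L2_edge_C1[OF e(1) C1]
      L2_const[OF finite_edge_measure_edge[OF e(1)]] by auto
  have i: "integrable (edge_measure e) (\<lambda>x. h x * \<phi> x)" "integrable (edge_measure e) (\<lambda>x. g x * \<phi> x)"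
    "integrable (edge_measure e) \<phi>"
    using integrable_inner_L2[OF Le(1,3)] integrable_inner_L2[OF Le(2,3)]
      L2_imp_integrable[OF finite_edge_measure_edge[OF e(1)] Le(3)] by auto
  have h_eq: "(LINT x|edge_measure e. h x * \<phi> x) =
      (LINT x|\<mu>. G x \<bullet> \<gamma> x) + \<eta> * (LINT x|\<mu>. v x * \<phi> x)"
    using Green_formula_bump[OF h v(2) solves_homogeneous_laplacian[OF v] e T]
    by (simp add: mult.assoc)
  have "\<eta> * \<bar>LINT x|\<mu>. v x * \<phi> x\<bar> \<le> \<eta> * (L2_norm \<mu> v * L2_norm \<mu> \<phi>)"
    using L2_Cauchy_Schwarz[OF L(2,3)] \<eta> by (intro mult_left_mono) auto
  then have h_le: "\<bar>LINT x|edge_measure e. h x * \<phi> x\<bar> \<le> L2_norm \<mu> G * L2_norm \<mu> \<gamma>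
      + \<eta> * L2_norm \<mu> v * L2_norm \<mu> \<phi>"
    unfolding h_eq using L2_Cauchy_Schwarz[OF L(1,4)] \<eta>
      abs_triangle_ineq[of "LINT x|\<mu>. G x \<bullet> \<gamma> x" "\<eta> * (LINT x|\<mu>. v x * \<phi> x)"]
    by (simp add: abs_mult mult.assoc)
  have "\<bar>p\<bar> * \<bar>LINT x|edge_measure e. (g x - c) * \<phi> x\<bar> \<le> \<bar>p\<bar> * (L2_norm (edge_measure e) (\<lambda>x. g x - c) * L2_norm (edge_measure e) \<phi>)"
    using L2_Cauchy_Schwarz[OF L2_diff[OF Le(2,4)] Le(3)] by (intro mult_left_mono) auto
  moreover have "(LINT x|edge_measure e. (s * h x + p * g x) * \<phi> x) - p * c * (LINT x|edge_measure e. \<phi> x)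
      = s * (LINT x|edge_measure e. h x * \<phi> x) + p * (LINT x|edge_measure e. (g x - c) * \<phi> x)"
  proof -
    have A: "(LINT x|edge_measure e. (s * h x + p * g x) * \<phi> x)
        = s * (LINT x|edge_measure e. h x * \<phi> x) + p * (LINT x|edge_measure e. g x * \<phi> x)"
      using i by (simp add: distrib_right mult.assoc)
    have B: "(LINT x|edge_measure e. (g x - c) * \<phi> x) = (LINT x|edge_measure e. g x * \<phi> x) - c * (LINT x|edge_measure e. \<phi> x)"
      using i by (simp add: left_diff_distrib)
    show ?thesis unfolding A B by (simp add: right_diff_distrib)
  qed
  moreover have "\<bar>s * (LINT x|edge_measure e. h x * \<phi> x) + p * (LINT x|edge_measure e. (g x - c) * \<phi> x)\<bar>
      \<le> \<bar>LINT x|edge_measure e. h x * \<phi> x\<bar> + \<bar>p\<bar> * \<bar>LINT x|edge_measure e. (g x - c) * \<phi> x\<bar>"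
    using abs_triangle_ineq[of "s * (LINT x|edge_measure e. h x * \<phi> x)" "p * (LINT x|edge_measure e. (g x - c) * \<phi> x)"] s
    by (simp add: abs_mult)
  ultimately show ?thesis using h_le by linarith
qed

end

text \<open>Otherwise the fundamental lemma would make the constant function 1 vanish almost
  everywhere on \<open>e\<close>.\<close>

lemma exists_bump_with_nonzero_integral:
  assumes e: "finite_measure (edge_measure e)" "0 < measure (edge_measure e) UNIV"
    and S: "open S" "AE x in edge_measure e. x \<in> S"
  obtains \<phi> \<gamma> where "test_function S \<phi> \<gamma>" "(LINT x|edge_measure e. \<phi> x) \<noteq> 0"
proof (rule ccontr)
  assume "\<not> thesis"
  then have 0: "(LINT x|edge_measure e. \<phi> x * 1) = 0" if "test_function S \<phi> \<gamma>" for \<phi> \<gamma>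
    using that \<open>\<And>\<phi> \<gamma>. test_function S \<phi> \<gamma> \<Longrightarrow> _ \<Longrightarrow> thesis\<close> by auto
  have "AE x in edge_measure e. x \<in> S \<longrightarrow> (1::real) = 0"
    by (rule AE_zero_of_test_functions[OF _ _ S(1) 0]) (auto simp: finite_measure.integrable_const[OF e(1)])
  with S(2) have "AE x in edge_measure e. False" by eventually_elim simp
  then have "emeasure (edge_measure e) UNIV = 0"
    using AE_iff_measurable[of "UNIV" "edge_measure e" "\<lambda>x. False"] by simp
  with e(2) show False by (simp add: measure_def)
qed

section \<open>The mesh\<close>

definition cross2 :: "real^2 \<Rightarrow> real^2 \<Rightarrow> real" where
  "cross2 u v = u $ 1 * v $ 2 - u $ 2 * v $ 1"

text \<open>Cramer's rule. The sign of \<open>cross2 (t - s) (a - s)\<close> tells on which side of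
  the line through \<open>s\<close> and \<open>t\<close> the point \<open>a\<close> lies.\<close>

lemma cross2_coordinates:
  assumes "cross2 u v \<noteq> 0"
  shows "w = (cross2 w v / cross2 u v) *\<^sub>R u + (cross2 u w / cross2 u v) *\<^sub>R v"
proof -
  have "cross2 u v *\<^sub>R w = cross2 w v *\<^sub>R u + cross2 u w *\<^sub>R v"
    by (auto simp: vec_eq_iff forall_2 cross2_def algebra_simps)
  then have "(1 / cross2 u v) *\<^sub>R (cross2 u v *\<^sub>R w) = (1 / cross2 u v) *\<^sub>R (cross2 w v *\<^sub>R u + cross2 u w *\<^sub>R v)"
    by simp
  then show ?thesis using assms by (simp add: scaleR_add_right)
qed

text \<open>Each set contains the open triangle over the segment with apex \<open>a\<close> or
  \<open>b\<close>. For apexes on the same side these triangles overlap just above the midpoint of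
  the segment: \<open>b - s\<close> has a positive coefficient \<beta> along \<open>a - s\<close>,
  so a small shift of the midpoint lies in both.\<close>

lemma same_side_meet:
  fixes s t :: "real^2"
  assumes P: "open P" "convex P" "closed_segment s t \<subseteq> closure P" "a \<in> P"
    and Q: "open Q" "convex Q" "closed_segment s t \<subseteq> closure Q" "b \<in> Q"
    and side: "cross2 (t - s) (a - s) * cross2 (t - s) (b - s) > 0"
  shows "P \<inter> Q \<noteq> {}"
proof -
  define \<alpha> \<beta> where "\<alpha> = cross2 (b - s) (a - s) / cross2 (t - s) (a - s)"
    and "\<beta> = cross2 (t - s) (b - s) / cross2 (t - s) (a - s)"
  have ne: "cross2 (t - s) (a - s) \<noteq> 0" using side by auto
  have \<beta>: "\<beta> > 0" using side by (auto simp: \<beta>_def zero_less_divide_iff zero_less_mult_iff)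
  have b: "b - s = \<alpha> *\<^sub>R (t - s) + \<beta> *\<^sub>R (a - s)"
    unfolding \<alpha>_def \<beta>_def by (rule cross2_coordinates[OF ne])
  \<comment> \<open>\<open>M\<close> dominates the coefficients of the shifted point in both
    coordinate systems; \<epsilon> = 1 / (4 M) then keeps every deviation from the midpoint below
    1/4.\<close>
  define M where "M = 1 + \<bar>\<alpha> / \<beta>\<bar> + 1 / \<beta>"
  have M: "M \<ge> 1" "\<bar>\<alpha> / \<beta>\<bar> \<le> M" "1 / \<beta> \<le> M" using \<beta> by (auto simp: M_def)
  define \<epsilon> where "\<epsilon> = 1 / (4 * M)"
  have eM: "\<epsilon> * M = 1/4" using M(1) by (simp add: \<epsilon>_def)
  have \<epsilon>: "0 < \<epsilon>" "\<epsilon> \<le> 1/4"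
    using M(1) by (auto simp: \<epsilon>_def field_simps)
  have s1: "\<bar>\<epsilon> * (\<alpha> / \<beta>)\<bar> \<le> 1/4" "\<epsilon> * (1 / \<beta>) \<le> 1/4"
    using mult_left_mono[OF M(2), of \<epsilon>] mult_left_mono[OF M(3), of \<epsilon>] \<epsilon> eM by (auto simp: abs_mult)
  have inP: "s + (1/2) *\<^sub>R (t - s) + \<epsilon> *\<^sub>R (a - s) \<in> P"
    using \<epsilon> by (intro triangle_point_in_open_convex P) auto
  have inQ: "s + (1/2 - \<epsilon> * (\<alpha> / \<beta>)) *\<^sub>R (t - s) + (\<epsilon> * (1 / \<beta>)) *\<^sub>R (b - s) \<in> Q"
  proof (rule triangle_point_in_open_convex[OF Q])
    show "0 < \<epsilon> * (1 / \<beta>)" using \<epsilon> \<beta> by simp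
    show "0 \<le> 1/2 - \<epsilon> * (\<alpha> / \<beta>)" "1/2 - \<epsilon> * (\<alpha> / \<beta>) + \<epsilon> * (1 / \<beta>) \<le> 1" using s1 by linarith+
  qed
  have eq: "s + (1/2 - \<epsilon> * (\<alpha> / \<beta>)) *\<^sub>R (t - s) + (\<epsilon> * (1 / \<beta>)) *\<^sub>R (b - s) = s + (1/2) *\<^sub>R (t - s) + \<epsilon> *\<^sub>R (a - s)"
    unfolding b using \<beta> by (simp add: algebra_simps)
  show ?thesis using inP inQ[unfolded eq] by blast
qed

text \<open>In coordinates along the segment and towards an apex, a point near \<open>x\<close> is
  classified by its height \<open>g\<close>: positive over \<open>a\<close> puts it in
  \<open>P\<close>, zero on the segment, negative over \<open>a\<close> means positive over
  \<open>b\<close> and puts it in \<open>Q\<close>.\<close>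

lemma opposite_sides_cover:
  fixes s t :: "real^2"
  assumes P: "open P" "convex P" "closed_segment s t \<subseteq> closure P" "a \<in> P"
    and Q: "open Q" "convex Q" "closed_segment s t \<subseteq> closure Q" "b \<in> Q"
    and side: "cross2 (t - s) (a - s) * cross2 (t - s) (b - s) < 0" and x: "x \<in> open_segment s t"
  shows "x \<in> interior (closure P \<union> closure Q)"
proof -
  obtain r where r: "0 < r" "r < 1" "x = s + r *\<^sub>R (t - s)"
    using x by (auto simp: in_segment algebra_simps)
  have ne: "cross2 (t - s) (a - s) \<noteq> 0" "cross2 (t - s) (b - s) \<noteq> 0" using side by auto
  define f g where "f c y = cross2 (y - s) (c - s) / cross2 (t - s) (c - s)"
    and "g c y = cross2 (t - s) (y - s) / cross2 (t - s) (c - s)" for c y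
  have y: "y = s + f c y *\<^sub>R (t - s) + g c y *\<^sub>R (c - s)" if "c \<in> {a, b}" for c y
    using cross2_coordinates[of "t - s" "c - s" "y - s"] ne that
    by (auto simp: f_def g_def algebra_simps)
  have cont: "continuous_on UNIV (f c)" "continuous_on UNIV (g c)" for c
    unfolding f_def g_def cross2_def divide_inverse by (intro continuous_intros)+
  \<comment> \<open>The open conditions on the coordinates for both apexes hold at \<open>x\<close>,
    where \<open>f\<close> is \<open>r\<close> and \<open>g\<close> is 0 for \<open>a\<close> and
    for \<open>b\<close>.\<close>
  define A where "A = (\<Inter>c\<in>{a, b}. {y. 0 < f c y} \<inter> {y. f c y + g c y < 1})"
  have "open A"
    unfolding A_def by (intro open_INT ballI open_Int open_Collect_less continuous_intros cont) auto
  moreover have "x \<in> A"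
  proof -
    have "f c x = r" "g c x = 0" if "c \<in> {a, b}" for c
      using ne that unfolding f_def g_def r(3) by (auto simp: cross2_def field_simps)
    with r show ?thesis by (auto simp: A_def)
  qed
  moreover have "A \<subseteq> closure P \<union> closure Q"
  proof
    fix y assume "y \<in> A"
    then have fa: "0 < f a y" "f a y + g a y < 1" and fb: "0 < f b y" "f b y + g b y < 1"
      by (auto simp: A_def)
    consider "g a y > 0" | "g a y = 0" | "g a y < 0" by linarith
    then show "y \<in> closure P \<union> closure Q"
    proof cases
      case 1
      then have "y \<in> P"
        using fa by (subst y[of a]) (auto intro!: triangle_point_in_open_convex P)
      then show ?thesis using closure_subset by blast
    next
      case 2
      then have "y \<in> closed_segment s t"
        using fa y[of a y] unfolding in_segment by (intro exI[of _ "f a y"]) (auto simp: algebra_simps)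
      then show ?thesis using P(3) by blast
    next
      case 3
      then have "g b y > 0"
        using side by (auto simp: g_def zero_less_divide_iff divide_less_0_iff mult_less_0_iff)
      then have "y \<in> Q"
        using fb by (subst y[of b]) (auto intro!: triangle_point_in_open_convex Q)
      then show ?thesis using closure_subset by blast
    qed
  qed
  ultimately show ?thesis by (auto simp: interior_def)
qed

section \<open>Boundary points, edges and faces of a cell\<close>

context polygonal_cell
begin

lemma point_on_edge:
  assumes "x \<in> closure D" "x \<notin> D"
  obtains e where "e edge_of closure D" "x \<in> e"
proof -
  have "x \<in> frontier (closure D)"
    using assms interior_closure_cell by (simp add: frontier_def)
  then have "x \<in> rel_frontier (closure D)"
    using rel_frontier_nonempty_interior[of "closure D"] nonempty_cell interior_closure_cell by simp
  then obtain F where F: "F facet_of closure D" "x \<in> F"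
    using rel_frontier_of_polyhedron[OF polytope_imp_polyhedron[OF polytope_cell]] by auto
  then have "F edge_of closure D" using aff_dim_cell by (auto simp: facet_of_def edge_of_def)
  with F that show thesis by blast
qed

text \<open>A face that meets the relative interior of an edge contains the edge, and a proper face
  of a planar cell has dimension at most 1. One point thus suffices to identify an interface with an
  edge.\<close>

lemma face_containing_edge:
  assumes e: "e edge_of closure D" and T: "T face_of closure D" "T \<noteq> closure D" and x: "x \<in> rel_interior e" "x \<in> T"
  shows "T = e"
proof -
  have e': "e face_of closure D" "aff_dim e = 1" using e by (auto simp: edge_of_def)
  have "e \<subseteq> T" using subset_of_face_of[OF T(1) edge_subset[OF e]] x by blast
  have lt: "aff_dim T < 2"
    using face_of_aff_dim_lt[OF convex_closure[OF convex_cell] T] aff_dim_cell by simp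
  have eT: "e face_of T" by (rule face_of_subset[OF e'(1) \<open>e \<subseteq> T\<close> face_of_imp_subset[OF T(1)]])
  show ?thesis
  proof (rule ccontr)
    assume "T \<noteq> e"
    then have "aff_dim e < aff_dim T" using face_of_aff_dim_lt[OF face_of_imp_convex[OF T(1)] eT] by auto
    with lt e'(2) show False by simp
  qed
qed

end

lemma polygonal_cell_triangle:
  fixes T :: "(real^2) set"
  assumes "2 simplex T"
  shows "polygonal_cell (interior T)"
proof -
  have p: "polytope T" by (rule simplex_imp_polytope[OF assms])
  have d: "aff_dim T = 2" using aff_dim_simplex[OF assms] by simp
  then have "affine hull T = UNIV" using aff_dim_eq_full[of T] by simp
  then have "rel_interior T = interior T" by (rule rel_interior_interior)
  moreover have c: "convex T" using p by (rule polytope_imp_convex)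
  moreover have "T \<noteq> {}" using d by auto
  ultimately have ne: "interior T \<noteq> {}" using rel_interior_eq_empty by metis
  have "closure (interior T) = T"
    using convex_closure_interior[OF c ne] polytope_imp_closed[OF p] by simp
  then show ?thesis
    using p c ne polytope_imp_bounded[OF p]
    by unfold_locales (auto intro: convex_interior bounded_interior)
qed

lemma polygonal_cell_box:
  fixes a b :: "real^2"
  assumes "box a b \<noteq> {}"
  shows "polygonal_cell (box a b)"
  using assms by unfold_locales (auto simp: polytope_interval)

section \<open>Neighbours and interfaces of a conforming mesh\<close>

locale mesh =
  fixes \<Omega> :: "(real^2) set" and N :: nat and C :: "nat \<Rightarrow> (real^2) set"
  assumes domain: "polygonal_domain \<Omega>" and mesh: "coarse_mesh \<Omega> N C"
begin

abbreviation \<N> :: "nat \<Rightarrow> nat set" where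
  "\<N> \<equiv> neighbours N C"

abbreviation \<Gamma> :: "nat \<Rightarrow> (real^2) set" where
  "\<Gamma> \<equiv> interfaces N C"

abbreviation \<sigma> :: "nat \<Rightarrow> nat \<Rightarrow> (real^2) measure" where
  "\<sigma> i j \<equiv> edge_measure (interface C i j)"

abbreviation normal_deriv :: "nat \<Rightarrow> (real^2 \<Rightarrow> real) \<Rightarrow> real^2 \<Rightarrow> real" where
  "normal_deriv i v \<equiv> normal_derivative (C i) (interfaces N C i) v"

lemma cell: "i \<in> {1..N} \<Longrightarrow> polygonal_cell (C i)"
proof -
  assume i: "i \<in> {1..N}"
  have "triangular_cells N C \<or> cartesian_cells N C" using mesh by (simp add: coarse_mesh_def)
  then show ?thesis
  proof
    assume "triangular_cells N C"
    then obtain T where "2 simplex T" "C i = interior T" using i unfolding triangular_cells_def by blast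
    then show ?thesis using polygonal_cell_triangle by simp
  next
    assume "cartesian_cells N C"
    then obtain X Y k l where XY: "strict_mono X" "strict_mono Y"
      and C: "C i = box (vector [X k, Y l]) (vector [X (Suc k), Y (Suc l)])"
      using i unfolding cartesian_cells_def by blast
    have "(1/2) *\<^sub>R (vector [X k, Y l] + vector [X (Suc k), Y (Suc l)]) \<in> C i"
      using strict_monoD[OF XY(1), of k "Suc k"] strict_monoD[OF XY(2), of l "Suc l"]
      unfolding C by (auto simp: mem_box_cart forall_2)
    then show ?thesis unfolding C by (intro polygonal_cell_box) auto
  qed
qed

lemma disjoint_cells: "i \<in> {1..N} \<Longrightarrow> j \<in> {1..N} \<Longrightarrow> i \<noteq> j \<Longrightarrow> C i \<inter> C j = {}"
  using mesh by (simp add: coarse_mesh_def)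

text \<open>Disjoint open sets do not meet each other's closures, so common points of the closures
  lie on both frontiers.\<close>

lemma interface_eq:
  assumes "i \<in> {1..N}" "j \<in> {1..N}" "i \<noteq> j"
  shows "interface C i j = closure (C i) \<inter> closure (C j)"
proof -
  interpret i: polygonal_cell "C i" by (rule cell[OF assms(1)])
  interpret j: polygonal_cell "C j" by (rule cell[OF assms(2)])
  have "C i \<inter> C j = {}" "C j \<inter> C i = {}" using disjoint_cells[OF assms] by blast+
  then have "C i \<inter> closure (C j) = {}" "C j \<inter> closure (C i) = {}"
    using i.open_cell j.open_cell by (simp_all add: open_Int_closure_eq_empty)
  then show ?thesis
    using i.open_cell j.open_cell by (auto simp: interface_def frontier_def interior_open)
qed

lemma interface_face:
  assumes "i \<in> {1..N}" "j \<in> {1..N}" "i \<noteq> j"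
  shows "interface C i j face_of closure (C i)"
  using mesh assms unfolding interface_eq[OF assms] coarse_mesh_def by blast

lemma interface_commute: "interface C i j = interface C j i"
  by (auto simp: interface_def)

lemma interface_neq_closure:
  assumes "i \<in> {1..N}" "j \<in> {1..N}" "i \<noteq> j"
  shows "interface C i j \<noteq> closure (C i)"
proof -
  interpret i: polygonal_cell "C i" by (rule cell[OF assms(1)])
  obtain x where "x \<in> C i" using i.nonempty_cell by blast
  moreover then have "x \<in> closure (C i)" using closure_subset by blast
  moreover have "x \<notin> interface C i j"
    using \<open>x \<in> C i\<close> i.open_cell by (auto simp: interface_def frontier_def interior_open)
  ultimately show ?thesis by blast
qed

lemma neighbours_iff:
  "j \<in> \<N> i \<longleftrightarrow> j \<in> {1..N} \<and> j \<noteq> i \<and> interface C i j edge_of closure (C i)"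
  by (auto simp: neighbours_def)

lemma neighbours_sym:
  assumes i: "i \<in> {1..N}" and j: "j \<in> \<N> i"
  shows "i \<in> \<N> j"
proof -
  have j': "j \<in> {1..N}" "j \<noteq> i" "aff_dim (interface C i j) = 1"
    using j by (auto simp: neighbours_iff edge_of_def)
  then show ?thesis
    using interface_face[OF j'(1) i j'(2)] i by (auto simp: neighbours_iff edge_of_def interface_commute[of i])
qed

lemma finite_neighbours: "finite (\<N> i)"
  by (simp add: neighbours_def)

text \<open>Neither point is on the line of the common edge, and cells on the same side of it would
  overlap.\<close>

lemma interface_sides:
  assumes i: "i \<in> {1..N}" and j: "j \<in> \<N> i" and st: "interface C i j = closed_segment s t" "s \<noteq> t"
    and a: "a \<in> C i" "b \<in> C j"
  shows "cross2 (t - s) (a - s) * cross2 (t - s) (b - s) < 0"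
proof -
  have j': "j \<in> {1..N}" "j \<noteq> i" using j by (auto simp: neighbours_iff)
  interpret i: polygonal_cell "C i" by (rule cell[OF i])
  interpret j: polygonal_cell "C j" by (rule cell[OF j'(1)])
  have e: "interface C i j edge_of closure (C i)" "interface C i j edge_of closure (C j)"
    using j neighbours_sym[OF i j] by (auto simp: neighbours_iff interface_commute[of i])
  have "cross2 (t - s) (a - s) \<noteq> 0" "cross2 (t - s) (b - s) \<noteq> 0"
    using i.edge_noncollinear[OF e(1) st a(1)] j.edge_noncollinear[OF e(2) st a(2)]
    by (simp_all add: cross2_def)
  moreover have "\<not> cross2 (t - s) (a - s) * cross2 (t - s) (b - s) > 0"
    using same_side_meet[OF i.open_cell i.convex_cell _ a(1) j.open_cell j.convex_cell _ a(2), of s t]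
      disjoint_cells[OF i j'(1)] j'(2) i.edge_subset[OF e(1)] j.edge_subset[OF e(2)] st(1) by auto
  ultimately show ?thesis by (metis mult_eq_0_iff linorder_neqE_linordered_idom)
qed

text \<open>Two neighbours across the same edge would both lie opposite to \<open>C i\<close>, hence
  on the same side, and would overlap. Injectivity turns sums over edges into sums over
  neighbours.\<close>

lemma inj_on_interface:
  assumes i: "i \<in> {1..N}"
  shows "inj_on (interface C i) (\<N> i)"
proof (rule inj_onI, rule ccontr)
  fix j k assume j: "j \<in> \<N> i" and k: "k \<in> \<N> i"
    and eq: "interface C i j = interface C i k" and ne: "j \<noteq> k"
  have jk: "j \<in> {1..N}" "k \<in> {1..N}" using j k by (auto simp: neighbours_iff)
  interpret i: polygonal_cell "C i" by (rule cell[OF i])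
  interpret j: polygonal_cell "C j" by (rule cell[OF jk(1)])
  interpret k: polygonal_cell "C k" by (rule cell[OF jk(2)])
  obtain a b c where abc: "a \<in> C i" "b \<in> C j" "c \<in> C k"
    using i.nonempty_cell j.nonempty_cell k.nonempty_cell by blast
  have "interface C i j edge_of closure (C i)" using j by (simp add: neighbours_iff)
  then obtain s t where st: "s \<noteq> t" "interface C i j = closed_segment s t" by (rule i.edge_cases)
  have "cross2 (t - s) (a - s) * cross2 (t - s) (b - s) < 0" "cross2 (t - s) (a - s) * cross2 (t - s) (c - s) < 0"
    using interface_sides[OF i j st(2,1) abc(1,2)] interface_sides[OF i k _ st(1) abc(1,3)] st(2) eq by auto
  then have "cross2 (t - s) (b - s) * cross2 (t - s) (c - s) > 0"
    by (auto simp: mult_less_0_iff zero_less_mult_iff)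
  moreover have "closed_segment s t \<subseteq> closure (C j)" "closed_segment s t \<subseteq> closure (C k)"
    using interface_eq[OF i] j k st(2) eq by (auto simp: neighbours_iff)
  ultimately have "C j \<inter> C k \<noteq> {}"
    using same_side_meet[OF j.open_cell j.convex_cell _ abc(2) k.open_cell k.convex_cell _ abc(3)] by blast
  then show False using disjoint_cells[OF jk ne] by blast
qed

text \<open>If \<open>e\<close> meets \<Omega>, so does its relative interior. A point
  \<open>x\<close> there is a limit of points of \<Omega> outside \<open>closure (C i)\<close>;
  these lie in finitely many other closed cells, one of which therefore contains \<open>x\<close>.
  Conformity makes the interface with that cell a face, and it has to be \<open>e\<close>.\<close>

lemma edge_interface_or_boundary:
  assumes i: "i \<in> {1..N}" and e: "e edge_of closure (C i)"
  shows "(\<exists>j\<in>\<N> i. e = interface C i j) \<or> e \<subseteq> frontier \<Omega>"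
proof (rule disjCI)
  assume nb: "\<not> e \<subseteq> frontier \<Omega>"
  interpret i: polygonal_cell "C i" by (rule cell[OF i])
  have cl: "closure \<Omega> = (\<Union>i\<in>{1..N}. closure (C i))" and dom: "open \<Omega>" "interior (closure \<Omega>) = \<Omega>"
    using mesh domain by (auto simp: coarse_mesh_def polygonal_domain_def)
  have "e \<subseteq> closure \<Omega>" using i.edge_subset[OF e] i cl by blast
  with nb dom have "e \<inter> \<Omega> \<noteq> {}" by (auto simp: frontier_def interior_open)
  moreover have "e \<subseteq> closure (rel_interior e)"
    using e closure_subset[of e] convex_closure_rel_interior[OF face_of_imp_convex, of e] by (auto simp: edge_of_def)
  ultimately have "closure (rel_interior e) \<inter> \<Omega> \<noteq> {}" by blast
  then have "rel_interior e \<inter> \<Omega> \<noteq> {}"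
    using dom(1) by (simp add: open_Int_closure_eq_empty inf_commute)
  then obtain x where x: "x \<in> rel_interior e" "x \<in> \<Omega>" by blast
  then have xe: "x \<in> e" using rel_interior_subset by blast
  define F where "F = (\<Union>j\<in>{1..N} - {i}. closure (C j))"
  have "closed F" unfolding F_def by (intro closed_UN) auto
  have "x \<notin> interior (closure (C i))"
    using xe i.edge_disjoint_cell[OF e] i.interior_closure_cell by auto
  then have "x \<in> closure (- closure (C i))" by (simp add: closure_complement)
  have "x \<in> closure F"
  proof (rule closure_iff_nhds_not_empty[THEN iffD2, rule_format])
    fix A S assume "S \<subseteq> A" "x \<in> S" "open S"
    then have "open (S \<inter> \<Omega>)" "x \<in> S \<inter> \<Omega>" using dom x by auto
    with \<open>x \<in> closure (- closure (C i))\<close> have "- closure (C i) \<inter> (S \<inter> \<Omega>) \<noteq> {}"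
      by (metis closure_iff_nhds_not_empty order_refl)
    then obtain y where "y \<in> S" "y \<in> \<Omega>" "y \<notin> closure (C i)" by blast
    moreover then have "y \<in> F" using cl closure_subset[of \<Omega>] by (auto simp: F_def)
    ultimately show "F \<inter> A \<noteq> {}" using \<open>S \<subseteq> A\<close> by blast
  qed
  then have "x \<in> F" using \<open>closed F\<close> by simp
  then obtain j where j: "j \<in> {1..N}" "j \<noteq> i" "x \<in> closure (C j)"
    unfolding F_def by blast
  have "x \<in> interface C i j"
    using interface_eq[OF i j(1)] j xe i.edge_subset[OF e] by auto
  then have "interface C i j = e"
    using i.face_containing_edge[OF e interface_face[OF i j(1)] interface_neq_closure[OF i j(1)] x(1)] j(2) by auto
  then show "\<exists>j\<in>\<N> i. e = interface C i j"
    using j e by (auto simp: neighbours_iff)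
qed

text \<open>An edge covered by interfaces but different from each of them would meet each in at most
  a point and would be finite.\<close>

lemma edges_in_interfaces:
  assumes i: "i \<in> {1..N}"
  shows "{e. e edge_of closure (C i) \<and> e \<subseteq> \<Gamma> i} = interface C i ` \<N> i"
proof safe
  interpret i: polygonal_cell "C i" by (rule cell[OF i])
  fix e assume e: "e edge_of closure (C i)" "e \<subseteq> \<Gamma> i"
  show "e \<in> interface C i ` \<N> i"
  proof (rule ccontr)
    assume n: "e \<notin> interface C i ` \<N> i"
    have "e = (\<Union>j\<in>\<N> i. e \<inter> interface C i j)" using e(2) by (auto simp: interfaces_def)
    moreover have "finite (e \<inter> interface C i j)" if "j \<in> \<N> i" for j
    proof -
      have "e \<noteq> interface C i j" using n that by blast
      then have "\<exists>z. e \<inter> interface C i j \<subseteq> {z}"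
        using i.edges_intersect_in_point[OF e(1), of "interface C i j"] that by (simp add: neighbours_iff)
      then show ?thesis by (auto intro: finite_subset)
    qed
    ultimately have "finite e" using finite_neighbours by (metis (no_types, lifting) finite_UN_I)
    moreover obtain s t where "s \<noteq> t" "e = closed_segment s t" using e(1) by (rule i.edge_cases)
    ultimately show False by simp
  qed
qed (auto simp: neighbours_iff interfaces_def)

lemma sum_over_interface_edges:
  assumes i: "i \<in> {1..N}"
  shows "(\<Sum>e | e edge_of closure (C i) \<and> e \<subseteq> \<Gamma> i. F e) = (\<Sum>j\<in>\<N> i. F (interface C i j))"
  unfolding edges_in_interfaces[OF i] by (simp add: sum.reindex[OF inj_on_interface[OF i]])

text \<open>Translates the boundary condition of the algorithm, posed on the frontier of \<Omega>,
  into the one demanded of test functions in Green's formula: an edge that is not an interface lies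
  on the frontier of \<Omega>.\<close>

lemma vanishes_on_complement_of_interfaces:
  assumes i: "i \<in> {1..N}" and v: "vanishes_on (C i) (frontier (C i) \<inter> frontier \<Omega>) v"
  shows "vanishes_on (C i) (frontier (C i) - \<Gamma> i) v"
proof -
  interpret i: polygonal_cell "C i" by (rule cell[OF i])
  obtain g where g: "has_trace (C i) v g"
    "\<And>e. e edge_of closure (C i) \<Longrightarrow> AE x in edge_measure e. x \<in> frontier (C i) \<inter> frontier \<Omega> \<longrightarrow> g x = 0"
    using v unfolding vanishes_on_def by blast
  have "AE x in edge_measure e. x \<in> frontier (C i) - \<Gamma> i \<longrightarrow> g x = 0"
    if e: "e edge_of closure (C i)" for e
    using g(2)[OF e] i.AE_edge_in[OF e]
  proof eventually_elim
    case (elim x)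
    then show ?case using edge_interface_or_boundary[OF i e] by (auto simp: interfaces_def)
  qed
  with g(1) show ?thesis unfolding vanishes_on_def by blast
qed

section \<open>Paths of neighbouring cells to the boundary\<close>

definition adjacency :: "(nat \<times> nat) set" where
  "adjacency = {(i, j). i \<in> {1..N} \<and> j \<in> \<N> i}"

text \<open>If no cell of a connected component of the adjacency graph had a boundary edge, the union of the
  component would be open and closed off the finite set of its vertices, hence unbounded.\<close>

lemma reachable_boundary_edge:
  assumes i: "i \<in> {1..N}"
  shows "\<exists>k e. (i, k) \<in> adjacency\<^sup>* \<and> k \<in> {1..N} \<and> e edge_of closure (C k) \<and> e \<subseteq> frontier \<Omega>"
proof (rule ccontr)
  assume neg: "\<not> ?thesis"
  define K where "K = {k. (i, k) \<in> adjacency\<^sup>*}"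
  have KN: "k \<in> {1..N}" if "k \<in> K" for k
  proof -
    have "(i, k) \<in> adjacency\<^sup>*" using that by (simp add: K_def)
    then show ?thesis by (cases rule: rtranclE) (use i in \<open>auto simp: adjacency_def neighbours_iff\<close>)
  qed
  have finK: "finite K" by (rule finite_subset[of _ "{1..N}"]) (auto dest: KN)
  have shared: "\<exists>j\<in>K. j \<in> \<N> k \<and> e = interface C k j" if k: "k \<in> K" and e: "e edge_of closure (C k)" for k e
  proof -
    have "\<not> e \<subseteq> frontier \<Omega>" using neg k e KN[OF k] by (auto simp: K_def)
    then obtain j where j: "j \<in> \<N> k" "e = interface C k j"
      using edge_interface_or_boundary[OF KN[OF k] e] by blast
    moreover have "j \<in> K"
      using k j(1) KN[OF k] by (auto simp: K_def adjacency_def intro: rtrancl_into_rtrancl)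
    ultimately show ?thesis by blast
  qed
  define ends :: "(real^2) set \<Rightarrow> (real^2) \<times> (real^2)" where
    "ends e = (SOME p. fst p \<noteq> snd p \<and> e = closed_segment (fst p) (snd p))" for e
  have ends: "fst (ends e) \<noteq> snd (ends e) \<and> e = closed_segment (fst (ends e)) (snd (ends e))"
    if k: "k \<in> K" and e: "e edge_of closure (C k)" for k e
  proof -
    interpret k: polygonal_cell "C k" by (rule cell[OF KN[OF k]])
    obtain s t where "s \<noteq> t" "e = closed_segment s t" using e by (rule k.edge_cases)
    then have "\<exists>p. fst p \<noteq> snd p \<and> e = closed_segment (fst p) (snd p)" by (intro exI[of _ "(s, t)"]) simp
    then show ?thesis unfolding ends_def by (rule someI_ex)
  qed
  define V where "V = (\<Union>k\<in>K. \<Union>e\<in>{e. e edge_of closure (C k)}. {fst (ends e), snd (ends e)})"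
  have finV: "finite V"
    unfolding V_def using finK polygonal_cell.finite_edges[OF cell[OF KN]] by (intro finite_UN_I) auto
  define M where "M = (\<Union>k\<in>K. closure (C k))"
  have clM: "closed M" unfolding M_def using finK by (intro closed_UN) auto
  have bM: "bounded M"
    unfolding M_def using finK polygonal_cell.bounded_cell[OF cell[OF KN]] by (intro bounded_UN) auto
  \<comment> \<open>Points of an open cell are interior at once. Points in the relative interior of
    an edge are interior because the cell across that edge belongs to the same component and the two
    closed cells cover a neighbourhood.\<close>
  have intM: "x \<in> interior M" if x: "x \<in> M" "x \<notin> V" for x
  proof -
    obtain k where k: "k \<in> K" "x \<in> closure (C k)" using x by (auto simp: M_def)
    interpret k: polygonal_cell "C k" by (rule cell[OF KN[OF k(1)]])
    show ?thesis
    proof (cases "x \<in> C k")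
      case True
      have "C k \<subseteq> M" using k(1) closure_subset by (auto simp: M_def)
      with k.open_cell True show ?thesis by (auto simp: interior_def)
    next
      case False
      obtain e where e: "e edge_of closure (C k)" "x \<in> e" by (rule k.point_on_edge[OF k(2) False])
      obtain j where j: "j \<in> K" "j \<in> \<N> k" "e = interface C k j" using shared[OF k(1) e(1)] by blast
      interpret j: polygonal_cell "C j" by (rule cell[OF KN[OF j(1)]])
      obtain s t where st: "s \<noteq> t" "e = closed_segment s t" "s \<in> V" "t \<in> V"
        using ends[OF k(1) e(1)] k(1) e(1) unfolding V_def by blast
      have xo: "x \<in> open_segment s t" using e(2) st x(2) by (auto simp: open_segment_def)
      obtain a b where ab: "a \<in> C k" "b \<in> C j" using k.nonempty_cell j.nonempty_cell by blast
      have sub: "closed_segment s t \<subseteq> closure (C k)" "closed_segment s t \<subseteq> closure (C j)"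
        using interface_eq[OF KN[OF k(1)] KN[OF j(1)]] j st(2) by (auto simp: neighbours_iff)
      have "x \<in> interior (closure (C k) \<union> closure (C j))"
        by (rule opposite_sides_cover[OF k.open_cell k.convex_cell sub(1) ab(1) j.open_cell j.convex_cell sub(2) ab(2)
              interface_sides[OF KN[OF k(1)] j(2) _ st(1) ab] xo]) (use j(3) st(2) in simp)
      moreover have "interior (closure (C k) \<union> closure (C j)) \<subseteq> interior M"
        using k(1) j(1) by (intro interior_mono) (auto simp: M_def)
      ultimately show ?thesis by blast
    qed
  qed
  \<comment> \<open>The plane without finitely many points is connected, so it lies entirely in
    \<open>interior M\<close> or entirely outside \<open>M\<close>. The second is impossible as
    \<open>M\<close> contains a nonempty open cell, the first as \<open>M\<close> is
    bounded.\<close>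
  have "connected (- V)"
    using finV by (intro path_connected_imp_connected path_connected_complement_countable) (auto intro: countable_finite)
  moreover have "- V \<subseteq> interior M \<union> - M" using intM by blast
  moreover have "interior M \<inter> - M \<inter> - V = {}" using interior_subset by blast
  ultimately have "interior M \<inter> - V = {} \<or> - M \<inter> - V = {}"
    using connectedD[of "- V" "interior M" "- M"] clM by auto
  then show False
  proof
    assume "interior M \<inter> - V = {}"
    then have "C i \<subseteq> V"
    proof -
      interpret i: polygonal_cell "C i" by (rule cell[OF i])
      have "C i \<subseteq> M" using closure_subset by (auto simp: M_def K_def)
      then have "C i \<subseteq> interior M" using i.open_cell by (simp add: interior_maximal)
      with \<open>interior M \<inter> - V = {}\<close> show ?thesis by blast
    qed
    then have "finite (C i)" using finV finite_subset by blast
    moreover have "open (C i)" "C i \<noteq> {}"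
      using polygonal_cell.open_cell[OF cell[OF i]] polygonal_cell.nonempty_cell[OF cell[OF i]] by auto
    ultimately show False using finite_imp_not_open by blast
  next
    assume "- M \<inter> - V = {}"
    then have "UNIV = M \<union> V" by blast
    moreover have "bounded (M \<union> V)" using bM finV by (simp add: finite_imp_bounded)
    ultimately show False using not_bounded_UNIV by metis
  qed
qed

end

section \<open>The algorithm\<close>

context mesh
begin

text \<open>What \<open>uh n\<close>, \<open>u (Suc n)\<close>, elements of \<open>Xd\<close> and
  their combinations have in common. It guarantees that the trace and the normal derivative selected
  by \<open>SOME\<close> really are such.\<close>

definition admissible :: "nat \<Rightarrow> (real^2 \<Rightarrow> real) \<Rightarrow> bool" where
  "admissible i v \<longleftrightarrow> vanishes_on (C i) (frontier (C i) \<inter> frontier \<Omega>) v \<and>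
     (\<exists>h. has_normal_derivative (C i) (\<Gamma> i) v h)"

lemma admissible_has_trace:
  assumes "i \<in> {1..N}" "admissible i v"
  shows "has_trace (C i) v (trace (C i) v)"
  using assms polygonal_cell.vanishes_on_imp_has_trace[OF cell] by (auto simp: admissible_def)

lemma admissible_has_normal_derivative:
  assumes "i \<in> {1..N}" "admissible i v"
  shows "has_normal_derivative (C i) (\<Gamma> i) v (normal_deriv i v)"
  using assms polygonal_cell.has_normal_derivative_normal_derivative[OF cell] by (auto simp: admissible_def)

lemma admissible_add_scaleR:
  assumes i: "i \<in> {1..N}" and v: "admissible i v" "admissible i v'"
  shows "admissible i (\<lambda>x. v x + c * v' x)"
proof -
  interpret i: polygonal_cell "C i" by (rule cell[OF i])
  show ?thesis
    using v i.vanishes_on_add_scaleR i.has_normal_derivative_add_scaleR unfolding admissible_def by blast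
qed

lemma neighbour_interface:
  assumes "i \<in> {1..N}" "j \<in> \<N> i"
  shows "interface C i j edge_of closure (C i)" "interface C i j \<subseteq> \<Gamma> i"
    "interface C i j edge_of closure (C j)" "interface C i j \<subseteq> \<Gamma> j" "j \<in> {1..N}"
proof -
  have i: "i \<in> \<N> j" by (rule neighbours_sym[OF assms])
  show "interface C i j edge_of closure (C i)" "j \<in> {1..N}" using assms by (simp_all add: neighbours_iff)
  show "interface C i j edge_of closure (C j)" using i by (simp add: neighbours_iff interface_commute[of i j])
  show "interface C i j \<subseteq> \<Gamma> i" using assms(2) by (auto simp: interfaces_def)
  show "interface C i j \<subseteq> \<Gamma> j" using i unfolding interfaces_def interface_commute[of i j] by blast
qed

text \<open>The selections made by \<open>SOME\<close> need not be linear as functions; uniqueness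
  makes them linear almost everywhere on each edge.\<close>

lemma normal_derivative_trace_linear:
  assumes i: "i \<in> {1..N}" and v: "admissible i v" "admissible i v'"
    and e: "e edge_of closure (C i)" "e \<subseteq> \<Gamma> i"
  shows "AE x in edge_measure e.
    normal_deriv i (\<lambda>x. v x + c * v' x) x =
      normal_deriv i v x + c * normal_deriv i v' x \<and>
    trace (C i) (\<lambda>x. v x + c * v' x) x = trace (C i) v x + c * trace (C i) v' x"
proof -
  interpret i: polygonal_cell "C i" by (rule cell[OF i])
  note vv = admissible_add_scaleR[OF i v, of c]
  show ?thesis
    by (intro eventually_conj
      i.has_normal_derivative_unique[OF admissible_has_normal_derivative[OF i vv]
        i.has_normal_derivative_add_scaleR[OF admissible_has_normal_derivative[OF i v(1)]
          admissible_has_normal_derivative[OF i v(2)]] e]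
      i.has_trace_unique[OF admissible_has_trace[OF i vv]
        i.has_trace_add_scaleR[OF admissible_has_trace[OF i v(1)] admissible_has_trace[OF i v(2)]] e(1)])
qed

lemma robin_own_linear:
  assumes "i \<in> {1..N}" "j \<in> \<N> i" "admissible i v" "admissible i v'"
  shows "AE x in \<sigma> i j.
    robin_own N C s i (\<lambda>x. v x + c * v' x) x = robin_own N C s i v x + c * robin_own N C s i v' x"
  using normal_derivative_trace_linear[OF assms(1,3,4) neighbour_interface(1,2)[OF assms(1,2)], of c]
  by eventually_elim (auto simp: robin_own_def algebra_simps)

lemma robin_neighbour_linear:
  assumes "i \<in> {1..N}" "j \<in> \<N> i" "admissible j v" "admissible j v'"
  shows "AE x in \<sigma> i j.
    robin_neighbour N C s j (\<lambda>x. v x + c * v' x) x = robin_neighbour N C s j v x + c * robin_neighbour N C s j v' x"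
  using normal_derivative_trace_linear[OF neighbour_interface(5)[OF assms(1,2)] assms(3,4) neighbour_interface(3,4)[OF assms(1,2)], of c]
  by eventually_elim (auto simp: robin_neighbour_def algebra_simps)

lemma L2_normal_derivative_trace:
  assumes i: "i \<in> {1..N}" and v: "admissible i v"
    and e: "e edge_of closure (C i)" "e \<subseteq> \<Gamma> i"
  shows "L2 (edge_measure e) (normal_deriv i v)"
    "L2 (edge_measure e) (trace (C i) v)"
proof -
  interpret i: polygonal_cell "C i" by (rule cell[OF i])
  show "L2 (edge_measure e) (normal_deriv i v)"
    by (rule i.has_normal_derivative_L2[OF admissible_has_normal_derivative[OF i v] e])
  show "L2 (edge_measure e) (trace (C i) v)"
    by (rule i.has_trace_L2[OF admissible_has_trace[OF i v] e(1)])
qed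

lemma L2_robin_own:
  assumes "i \<in> {1..N}" "j \<in> \<N> i" "admissible i v"
  shows "L2 (\<sigma> i j) (robin_own N C s i v)"
  using L2_normal_derivative_trace[OF assms(1,3) neighbour_interface(1,2)[OF assms(1,2)]]
  unfolding robin_own_def[abs_def] by (intro L2_add L2_cmult)

lemma L2_robin_neighbour:
  assumes "i \<in> {1..N}" "j \<in> \<N> i" "admissible j v"
  shows "L2 (\<sigma> i j) (robin_neighbour N C s j v)"
proof -
  note L = L2_normal_derivative_trace[OF neighbour_interface(5)[OF assms(1,2)] assms(3) neighbour_interface(3,4)[OF assms(1,2)]]
  show ?thesis
    using L2_add[OF L2_cmult[OF L(1), of "-1"] L2_cmult[OF L(2), of s]]
    unfolding robin_neighbour_def[abs_def] by simp
qed

definition jump :: "real \<Rightarrow> nat \<Rightarrow> nat \<Rightarrow> (real^2 \<Rightarrow> real) \<Rightarrow> real^2 \<Rightarrow> real" where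
  "jump s i j v x = robin_own N C s i v x - robin_neighbour N C s j v x"

lemma robin_jump_eq:
  "robin_jump N C s v = (\<Sum>i\<in>{1..N}. \<Sum>j\<in>\<N> i. (L2_norm (\<sigma> i j) (jump s i j v))\<^sup>2)"
  by (simp add: robin_jump_def jump_def[abs_def])

lemma L2_jump:
  assumes "i \<in> {1..N}" "j \<in> \<N> i" "\<And>i. i \<in> {1..N} \<Longrightarrow> admissible i v"
  shows "L2 (\<sigma> i j) (jump s i j v)"
  using L2_robin_own[OF assms(1,2)] L2_robin_neighbour[OF assms(1,2)] neighbour_interface(5)[OF assms(1,2)] assms(1,3)
  unfolding jump_def[abs_def] by (intro L2_diff) auto

lemma jump_linear:
  assumes ij: "i \<in> {1..N}" "j \<in> \<N> i"
    and v: "\<And>i. i \<in> {1..N} \<Longrightarrow> admissible i v" "\<And>i. i \<in> {1..N} \<Longrightarrow> admissible i v'"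
  shows "AE x in \<sigma> i j. jump s i j (\<lambda>x. v x + c * v' x) x = jump s i j v x + c * jump s i j v' x"
  using robin_own_linear[OF ij v(1)[OF ij(1)] v(2)[OF ij(1)], of s c]
    robin_neighbour_linear[OF ij v(1)[OF neighbour_interface(5)[OF ij]] v(2)[OF neighbour_interface(5)[OF ij]], of s c]
  by eventually_elim (auto simp: jump_def algebra_simps)

text \<open>The Robin jump is a quadratic form and \<open>B\<close> its polar form. Because
  \<open>B\<close> is the same for all \<open>c\<close>, different multiples of a correction can be
  compared.\<close>

lemma robin_jump_expand:
  assumes v: "\<And>i. i \<in> {1..N} \<Longrightarrow> admissible i v" "\<And>i. i \<in> {1..N} \<Longrightarrow> admissible i v'"
  obtains B where "\<And>c. robin_jump N C s (\<lambda>x. v x + c * v' x) = robin_jump N C s v + 2 * c * B + c\<^sup>2 * robin_jump N C s v'"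
proof -
  define b where "b i j = (LINT x|\<sigma> i j. jump s i j v x * jump s i j v' x)" for i j
  have *: "(L2_norm (\<sigma> i j) (jump s i j (\<lambda>x. v x + c * v' x)))\<^sup>2 =
      (L2_norm (\<sigma> i j) (jump s i j v))\<^sup>2 + 2 * c * b i j +
      c\<^sup>2 * (L2_norm (\<sigma> i j) (jump s i j v'))\<^sup>2"
    if ij: "i \<in> {1..N}" "j \<in> \<N> i" for i j c
  proof -
    note L = L2_jump[OF ij v(1), of s] L2_jump[OF ij v(2), of s]
      L2_jump[OF ij admissible_add_scaleR[OF _ v(1) v(2)], of s c]
    have "L2_norm (\<sigma> i j) (jump s i j (\<lambda>x. v x + c * v' x)) =
        L2_norm (\<sigma> i j) (\<lambda>x. jump s i j v x + c * jump s i j v' x)"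
      by (intro L2_norm_cong_AE jump_linear ij v L2_measurable[OF L(3)] L2_measurable[OF L2_add[OF L(1) L2_cmult[OF L(2)]]])
    then show ?thesis
      using L2_norm_add_square[OF L(1) L2_cmult[OF L(2), of c]]
      by (simp add: L2_norm_cmult power_mult_distrib b_def mult.left_commute)
  qed
  have "robin_jump N C s (\<lambda>x. v x + c * v' x) = robin_jump N C s v +
      2 * c * (\<Sum>i\<in>{1..N}. \<Sum>j\<in>\<N> i. b i j) + c\<^sup>2 * robin_jump N C s v'" for c
    unfolding robin_jump_eq sum_distrib_left sum.distrib[symmetric] by (intro sum.cong refl *)
  then show thesis by (rule that)
qed

text \<open>Adjacency is symmetric; this reassigns a quantity living on an interface from one of its
  cells to the other.\<close>

lemma sum_neighbours_swap:
  "(\<Sum>i\<in>{1..N}. \<Sum>j\<in>\<N> i. F i j) = (\<Sum>i\<in>{1..N}. \<Sum>j\<in>\<N> i. F j i)"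
proof -
  have n: "\<N> i = {j. j \<in> {1..N} \<and> j \<in> \<N> i}" for i
    by (auto simp: neighbours_def)
  have "(\<Sum>i\<in>{1..N}. \<Sum>j\<in>\<N> i. F i j) = (\<Sum>i\<in>{1..N}. \<Sum>j | j \<in> {1..N} \<and> j \<in> \<N> i. F i j)"
    by (subst n) simp
  also have "\<dots> = (\<Sum>j\<in>{1..N}. \<Sum>i | i \<in> {1..N} \<and> j \<in> \<N> i. F i j)"
    by (rule sum.swap_restrict) auto
  also have "\<dots> = (\<Sum>j\<in>{1..N}. \<Sum>i\<in>\<N> j. F i j)"
  proof (intro sum.cong refl)
    fix j assume "j \<in> {1..N}"
    then show "{i. i \<in> {1..N} \<and> j \<in> \<N> i} = \<N> j"
      using neighbours_sym by (auto simp: neighbours_def[of N C j]) (auto simp: neighbours_def)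
  qed
  finally show ?thesis .
qed

lemma robin_jump_nonneg: "0 \<le> robin_jump N C s v"
  unfolding robin_jump_def by (intro sum_nonneg zero_le_power2)

lemma jump_le_robin_jump:
  assumes "i \<in> {1..N}" "j \<in> \<N> i"
  shows "L2_norm (\<sigma> i j) (jump s i j v) \<le> sqrt (robin_jump N C s v)"
proof (rule real_le_rsqrt)
  have "(L2_norm (\<sigma> i j) (jump s i j v))\<^sup>2 \<le>
      (\<Sum>j\<in>\<N> i. (L2_norm (\<sigma> i j) (jump s i j v))\<^sup>2)"
    by (rule member_le_sum[OF assms(2)]) (auto simp: finite_neighbours)
  also have "\<dots> \<le> robin_jump N C s v"
    unfolding robin_jump_eq by (rule member_le_sum[OF assms(1)]) (auto intro: sum_nonneg)
  finally show "(L2_norm (\<sigma> i j) (jump s i j v))\<^sup>2 \<le> robin_jump N C s v" .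
qed

end

section \<open>Decay of the Robin jump along a run with equal parameters\<close>

locale DCS_RJMin_run = mesh +
  fixes \<eta> p :: real and f :: "real^2 \<Rightarrow> real" and Xd :: "(real^2 \<Rightarrow> real) set"
    and u uh U :: "nat \<Rightarrow> real^2 \<Rightarrow> real"
  assumes \<eta>: "\<eta> \<ge> 0" and p: "p > 0" and coarse: "coarse_space \<eta> \<Omega> N C Xd"
    and run: "DCS_RJMin \<eta> \<Omega> N C f p p Xd u uh U"
begin

abbreviation J :: "(real^2 \<Rightarrow> real) \<Rightarrow> real" where
  "J v \<equiv> robin_jump N C p v"

lemma zero_in_Xd: "(\<lambda>x. 0) \<in> Xd"
proof -
  obtain B where "Xd = {\<lambda>x. \<Sum>b\<in>B. c b * b x | c. True}"
    using coarse by (auto simp: coarse_space_def finite_dim_subspace_def)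
  then show ?thesis by (auto intro!: exI[of _ "\<lambda>b. 0"])
qed

lemma scale_in_Xd:
  assumes "V \<in> Xd" shows "(\<lambda>x. r * V x) \<in> Xd"
proof -
  obtain B where B: "Xd = {\<lambda>x. \<Sum>b\<in>B. c b * b x | c. True}"
    using coarse by (auto simp: coarse_space_def finite_dim_subspace_def)
  with assms obtain c where "V = (\<lambda>x. \<Sum>b\<in>B. c b * b x)" by blast
  then have "(\<lambda>x. r * V x) = (\<lambda>x. \<Sum>b\<in>B. (r * c b) * b x)"
    by (simp add: sum_distrib_left mult.assoc)
  then show ?thesis unfolding B by (intro CollectI exI[of _ "\<lambda>b. r * c b"]) simp
qed

lemma admissible_Xd: "V \<in> Xd \<Longrightarrow> i \<in> {1..N} \<Longrightarrow> admissible i V"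
  using coarse unfolding coarse_space_def homogeneous_solutions_def admissible_def by blast

lemma robin_step: "robin_step \<eta> \<Omega> N C f p (u n) (uh n)"
  using run by (simp add: DCS_RJMin_def)

lemma admissible_uh: "i \<in> {1..N} \<Longrightarrow> admissible i (uh n)"
  using robin_step[of n] unfolding robin_step_def admissible_def by blast

lemma U_in_Xd: "U (Suc n) \<in> Xd"
  using run by (simp add: DCS_RJMin_def is_arg_min_def)

lemma u_Suc: "u (Suc n) = (\<lambda>x. uh n x + 1 * U (Suc n) x)"
  using run by (simp add: DCS_RJMin_def)

lemma admissible_u: "i \<in> {1..N} \<Longrightarrow> admissible i (u (Suc n))"
  unfolding u_Suc by (intro admissible_add_scaleR admissible_uh admissible_Xd U_in_Xd)

lemma minimal:
  assumes "V \<in> Xd"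
  shows "J (u (Suc n)) \<le> J (\<lambda>x. uh n x + V x)"
  using run assms unfolding DCS_RJMin_def is_arg_min_def by (metis (no_types, lifting) not_le)

lemma robin_jump_decreases: "J (u (Suc n)) \<le> J (uh n)"
  using minimal[OF zero_in_Xd, of n] by simp

text \<open>The minimizer is compared with half of itself. Eliminating \<open>B\<close> between the
  expansions at \<open>c = 1\<close> and \<open>c = 1/2\<close> gives the factor 2; the vanishing
  derivative at the minimum would give 1, but any constant suffices for the limit.\<close>

lemma robin_jump_correction: "J (U (Suc n)) \<le> 2 * (J (uh n) - J (u (Suc n)))"
proof -
  obtain B where B: "\<And>c. J (\<lambda>x. uh n x + c * U (Suc n) x) = J (uh n) + 2 * c * B + c\<^sup>2 * J (U (Suc n))"
    using robin_jump_expand[OF admissible_uh admissible_Xd[OF U_in_Xd]] by blast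
  have "J (u (Suc n)) = J (uh n) + 2 * B + J (U (Suc n))"
    unfolding u_Suc B by simp
  moreover have "J (u (Suc n)) \<le> J (uh n) + B + J (U (Suc n)) / 4"
    using minimal[OF scale_in_Xd[OF U_in_Xd[of n], of "1/2"], of n] B[of "1/2"] by (simp add: power2_eq_square)
  ultimately show ?thesis by argo
qed

text \<open>The index is shifted by one: \<open>u 0\<close> is zero or coarse and so has right-hand
  side 0 instead of \<open>f\<close>, which makes \<open>uh 0 - u 0\<close> no homogeneous solution
  in general. The factor \<open>- 1\<close> matches the form of the linearity lemmas.\<close>

definition w :: "nat \<Rightarrow> real^2 \<Rightarrow> real" where
  "w n = (\<lambda>x. uh (Suc n) x + (- 1) * u (Suc n) x)"

lemma admissible_w: "i \<in> {1..N} \<Longrightarrow> admissible i (w n)"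
  unfolding w_def by (intro admissible_add_scaleR admissible_uh admissible_u)

lemma solves_w:
  assumes i: "i \<in> {1..N}"
  shows "solves_pde \<eta> (C i) (\<lambda>x. 0) (w n)"
proof -
  interpret i: polygonal_cell "C i" by (rule cell[OF i])
  have uh: "solves_pde \<eta> (C i) f (uh n)" for n
    using robin_step[of n] i unfolding robin_step_def by blast
  have "solves_pde \<eta> (C i) (\<lambda>x. 0) (U (Suc n))"
    using coarse i U_in_Xd[of n] unfolding coarse_space_def homogeneous_solutions_def by blast
  from solves_pde_add_scaleR[OF i.open_cell i.bounded_cell uh[of n] this, where c = 1]
  have "solves_pde \<eta> (C i) f (u (Suc n))" unfolding u_Suc by simp
  from solves_pde_add_scaleR[OF i.open_cell i.bounded_cell uh[of "Suc n"] this, where c = "-1"]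
  show ?thesis by (simp add: w_def)
qed

lemma robin_own_w:
  assumes ij: "i \<in> {1..N}" "j \<in> \<N> i"
  shows "AE x in \<sigma> i j. robin_own N C p i (w n) x = - jump p i j (u (Suc n)) x"
proof -
  have "AE x in \<sigma> i j. robin_own N C p i (uh (Suc n)) x = robin_neighbour N C p j (u (Suc n)) x"
    using robin_step[of "Suc n"] ij unfolding robin_step_def by blast
  moreover have "AE x in \<sigma> i j. robin_own N C p i (w n) x =
      robin_own N C p i (uh (Suc n)) x + (- 1) * robin_own N C p i (u (Suc n)) x"
    unfolding w_def by (rule robin_own_linear[OF ij admissible_uh[OF ij(1)] admissible_u[OF ij(1)]])
  ultimately show ?thesis by eventually_elim (simp add: jump_def)
qed

lemma robin_neighbour_w:
  assumes ij: "i \<in> {1..N}" "j \<in> \<N> i"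
  shows "AE x in \<sigma> i j. robin_neighbour N C p j (w n) x = - jump p i j (uh (Suc n)) x"
proof -
  note j = neighbour_interface(5)[OF ij]
  have "AE x in \<sigma> i j. robin_own N C p i (uh (Suc n)) x = robin_neighbour N C p j (u (Suc n)) x"
    using robin_step[of "Suc n"] ij unfolding robin_step_def by blast
  moreover have "AE x in \<sigma> i j. robin_neighbour N C p j (w n) x =
      robin_neighbour N C p j (uh (Suc n)) x + (- 1) * robin_neighbour N C p j (u (Suc n)) x"
    unfolding w_def by (rule robin_neighbour_linear[OF ij admissible_uh[OF j] admissible_u[OF j]])
  ultimately show ?thesis by eventually_elim (simp add: jump_def)
qed

lemma L2_norm_robin_own_w:
  assumes ij: "i \<in> {1..N}" "j \<in> \<N> i"
  shows "L2_norm (\<sigma> i j) (robin_own N C p i (w n)) =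
    L2_norm (\<sigma> i j) (jump p i j (u (Suc n)))"
proof -
  have L: "L2 (\<sigma> i j) (jump p i j (u (Suc n)))"
    by (rule L2_jump[OF ij admissible_u])
  have AE: "AE x in \<sigma> i j. robin_own N C p i (w n) x = (- 1) * jump p i j (u (Suc n)) x"
    using robin_own_w[OF ij, of n] by eventually_elim simp
  have "L2_norm (\<sigma> i j) (robin_own N C p i (w n)) =
      L2_norm (\<sigma> i j) (\<lambda>x. (- 1) * jump p i j (u (Suc n)) x)"
    by (rule L2_norm_cong_AE[OF AE L2_measurable[OF L2_robin_own[OF ij admissible_w[OF ij(1)]]]
          L2_measurable[OF L2_cmult[OF L]]])
  then show ?thesis by (simp only: L2_norm_cmult)
qed

lemma L2_norm_robin_neighbour_w:
  assumes ij: "i \<in> {1..N}" "j \<in> \<N> i"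
  shows "L2_norm (\<sigma> i j) (robin_neighbour N C p j (w n)) =
    L2_norm (\<sigma> i j) (jump p i j (uh (Suc n)))"
proof -
  have L: "L2 (\<sigma> i j) (jump p i j (uh (Suc n)))"
    by (rule L2_jump[OF ij admissible_uh])
  have AE: "AE x in \<sigma> i j. robin_neighbour N C p j (w n) x = (- 1) * jump p i j (uh (Suc n)) x"
    using robin_neighbour_w[OF ij, of n] by eventually_elim simp
  have "L2_norm (\<sigma> i j) (robin_neighbour N C p j (w n)) =
      L2_norm (\<sigma> i j) (\<lambda>x. (- 1) * jump p i j (uh (Suc n)) x)"
    by (rule L2_norm_cong_AE[OF AE L2_measurable[OF L2_robin_neighbour[OF ij admissible_w[OF neighbour_interface(5)[OF ij]]]]
          L2_measurable[OF L2_cmult[OF L]]])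
  then show ?thesis by (simp only: L2_norm_cmult)
qed

section \<open>Energy of the differences\<close>

definition grad_w :: "nat \<Rightarrow> nat \<Rightarrow> real^2 \<Rightarrow> real^2" where
  "grad_w i n = (SOME G. H1_with_gradient (C i) (w n) G)"

lemma H1_w:
  assumes "i \<in> {1..N}"
  shows "H1_with_gradient (C i) (w n) (grad_w i n)"
proof -
  have "\<exists>G. H1_with_gradient (C i) (w n) G"
    using admissible_w[OF assms, of n] unfolding admissible_def has_normal_derivative_def by blast
  then show ?thesis unfolding grad_w_def by (rule someI_ex)
qed

definition energy :: "nat \<Rightarrow> nat \<Rightarrow> real" where
  "energy i n = (L2_norm (lebesgue_on (C i)) (grad_w i n))\<^sup>2 + \<eta> * (L2_norm (lebesgue_on (C i)) (w n))\<^sup>2"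

lemma energy_nonneg: "0 \<le> energy i n"
  using \<eta> by (simp add: energy_def)

lemma total_energy_nonneg: "0 \<le> 4 * p * (\<Sum>i\<in>{1..N}. energy i n)"
  using p by (intro mult_nonneg_nonneg sum_nonneg energy_nonneg) auto

lemma energy_balance: "J (u (Suc n)) = J (uh (Suc n)) + 4 * p * (\<Sum>i\<in>{1..N}. energy i n)"
proof -
  have cell_balance: "(\<Sum>j\<in>\<N> i. (L2_norm (\<sigma> i j) (robin_own N C p i (w n)))\<^sup>2) =
      (\<Sum>j\<in>\<N> i. (L2_norm (\<sigma> i j) (robin_neighbour N C p i (w n)))\<^sup>2) + 4 * p * energy i n"
    if i: "i \<in> {1..N}" for i
  proof -
    interpret i: polygonal_cell "C i" by (rule cell[OF i])
    have "vanishes_on (C i) (frontier (C i) - \<Gamma> i) (w n)"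
      using admissible_w[OF i, of n] by (intro vanishes_on_complement_of_interfaces i) (simp add: admissible_def)
    from i.robin_energy_identity[OF solves_w[OF i] H1_w[OF i] this
        admissible_has_normal_derivative[OF i admissible_w[OF i]] admissible_has_trace[OF i admissible_w[OF i]], of p]
    show ?thesis
      unfolding sum_over_interface_edges[OF i] energy_def robin_own_def[abs_def] robin_neighbour_def[abs_def] .
  qed
  have "J (u (Suc n)) = (\<Sum>i\<in>{1..N}. \<Sum>j\<in>\<N> i. (L2_norm (\<sigma> i j) (robin_own N C p i (w n)))\<^sup>2)"
    unfolding robin_jump_eq by (simp add: L2_norm_robin_own_w)
  also have "\<dots> = (\<Sum>i\<in>{1..N}. \<Sum>j\<in>\<N> i. (L2_norm (\<sigma> i j) (robin_neighbour N C p i (w n)))\<^sup>2)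
      + 4 * p * (\<Sum>i\<in>{1..N}. energy i n)"
    by (simp add: cell_balance sum.distrib sum_distrib_left)
  \<comment> \<open>So far the data are grouped by the cell that carries them. Grouped by the cell
    across the interface, they are the jumps of \<open>uh (Suc n)\<close> up to sign.\<close>
  also have "(\<Sum>i\<in>{1..N}. \<Sum>j\<in>\<N> i. (L2_norm (\<sigma> i j) (robin_neighbour N C p i (w n)))\<^sup>2)
      = (\<Sum>i\<in>{1..N}. \<Sum>j\<in>\<N> i. (L2_norm (edge_measure (interface C j i)) (robin_neighbour N C p j (w n)))\<^sup>2)"
    by (rule sum_neighbours_swap)
  also have "\<dots> = J (uh (Suc n))"
    unfolding robin_jump_eq
    by (intro sum.cong refl) (simp add: L2_norm_robin_neighbour_w interface_commute[of _ i for i])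
  finally show ?thesis .
qed

text \<open>The energy balance and the coarse minimization give
  \<open>J (u (Suc (Suc n))) \<le> J (uh (Suc n)) \<le> J (u (Suc n))\<close>; a decreasing sequence
  bounded below converges, so its increments tend to zero.\<close>

lemma robin_jump_differences: "(\<lambda>n. J (u (Suc n)) - J (u (Suc (Suc n)))) \<longlonglongrightarrow> 0"
proof -
  have "J (u (Suc (Suc n))) \<le> J (u (Suc n))" for n
    using robin_jump_decreases[of "Suc n"] energy_balance[of n] total_energy_nonneg[of n] by argo
  then have dec: "decseq (\<lambda>n. J (u (Suc n)))" by (rule decseq_SucI)
  obtain L where L: "(\<lambda>n. J (u (Suc n))) \<longlonglongrightarrow> L"
    by (rule decseq_convergent[OF dec, of 0]) (intro allI robin_jump_nonneg, rule that)
  from tendsto_diff[OF L LIMSEQ_Suc[OF L]] show ?thesis by simp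
qed

lemma energy_tendsto_0:
  assumes i: "i \<in> {1..N}"
  shows "(\<lambda>n. energy i n) \<longlonglongrightarrow> 0"
proof (rule Lim_null_comparison)
  show "(\<lambda>n. (J (u (Suc n)) - J (u (Suc (Suc n)))) / (4 * p)) \<longlonglongrightarrow> 0"
    using tendsto_divide[OF robin_jump_differences tendsto_const[of "4 * p"]] p by simp
  have "energy i n \<le> (J (u (Suc n)) - J (u (Suc (Suc n)))) / (4 * p)" for n
  proof -
    have "energy i n \<le> (\<Sum>i\<in>{1..N}. energy i n)"
      using energy_nonneg i by (intro member_le_sum) auto
    then have "4 * p * energy i n \<le> 4 * p * (\<Sum>i\<in>{1..N}. energy i n)"
      using p by (intro mult_left_mono) auto
    also have "\<dots> \<le> J (u (Suc n)) - J (u (Suc (Suc n)))"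
      using energy_balance[of n] robin_jump_decreases[of "Suc n"] by simp
    finally show ?thesis using p by (simp add: pos_le_divide_eq mult.commute)
  qed
  then show "\<forall>\<^sub>F n in sequentially. norm (energy i n) \<le> (J (u (Suc n)) - J (u (Suc (Suc n)))) / (4 * p)"
    using energy_nonneg by (intro always_eventually allI) simp
qed

lemma robin_jump_correction_tendsto_0: "(\<lambda>n. J (U (Suc (Suc n)))) \<longlonglongrightarrow> 0"
proof (rule Lim_null_comparison)
  show "(\<lambda>n. 2 * (J (u (Suc n)) - J (u (Suc (Suc n))))) \<longlonglongrightarrow> 0"
    using tendsto_mult_left[OF robin_jump_differences, of 2] by simp
  have "J (U (Suc (Suc n))) \<le> 2 * (J (u (Suc n)) - J (u (Suc (Suc n))))" for n
    using robin_jump_correction[of "Suc n"] energy_balance[of n] total_energy_nonneg[of n] by argo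
  then show "\<forall>\<^sub>F n in sequentially. norm (J (U (Suc (Suc n)))) \<le> 2 * (J (u (Suc n)) - J (u (Suc (Suc n))))"
    using robin_jump_nonneg by (intro always_eventually allI) simp
qed

section \<open>Decay of gradients and of the cell constants\<close>

lemma grad_w_tendsto_0:
  assumes i: "i \<in> {1..N}"
  shows "(\<lambda>n. L2_norm (lebesgue_on (C i)) (grad_w i n)) \<longlonglongrightarrow> 0"
proof (rule Lim_null_comparison)
  show "(\<lambda>n. sqrt (energy i n)) \<longlonglongrightarrow> 0"
    using tendsto_real_sqrt[OF energy_tendsto_0[OF i]] by simp
  have "L2_norm (lebesgue_on (C i)) (grad_w i n) \<le> sqrt (energy i n)" for n
    by (rule real_le_rsqrt) (use \<eta> in \<open>simp add: energy_def\<close>)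
  then show "\<forall>\<^sub>F n in sequentially. norm (L2_norm (lebesgue_on (C i)) (grad_w i n)) \<le> sqrt (energy i n)"
    by simp
qed

text \<open>The factor \<eta> stays on the norm, so that \<eta> = 0 is included: the square of the
  left side is at most \<eta> times the energy.\<close>

lemma \<eta>_w_tendsto_0:
  assumes i: "i \<in> {1..N}"
  shows "(\<lambda>n. \<eta> * L2_norm (lebesgue_on (C i)) (w n)) \<longlonglongrightarrow> 0"
proof (rule Lim_null_comparison)
  show "(\<lambda>n. sqrt (\<eta> * energy i n)) \<longlonglongrightarrow> 0"
    using tendsto_real_sqrt[OF tendsto_mult_left[OF energy_tendsto_0[OF i], of \<eta>]] by simp
  have "\<eta> * L2_norm (lebesgue_on (C i)) (w n) \<le> sqrt (\<eta> * energy i n)" for n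
  proof (rule real_le_rsqrt)
    have "(\<eta> * L2_norm (lebesgue_on (C i)) (w n))\<^sup>2 = \<eta> * (\<eta> * (L2_norm (lebesgue_on (C i)) (w n))\<^sup>2)"
      by (simp add: power2_eq_square)
    also have "\<dots> \<le> \<eta> * energy i n"
      unfolding energy_def using \<eta> by (intro mult_left_mono) auto
    finally show "(\<eta> * L2_norm (lebesgue_on (C i)) (w n))\<^sup>2 \<le> \<eta> * energy i n" .
  qed
  then show "\<forall>\<^sub>F n in sequentially. norm (\<eta> * L2_norm (lebesgue_on (C i)) (w n)) \<le> sqrt (\<eta> * energy i n)"
    using \<eta> by simp
qed

lemma nearly_constant_w:
  obtains c :: "nat \<Rightarrow> nat \<Rightarrow> real" and \<delta> :: "nat \<Rightarrow> nat \<Rightarrow> real" where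
    "\<forall>i\<in>{1..N}. \<delta> i \<longlonglongrightarrow> 0"
    "\<forall>i\<in>{1..N}. \<forall>n. L2_norm (lebesgue_on (C i)) (\<lambda>x. w n x - c i n) \<le> \<delta> i n"
    "\<forall>i\<in>{1..N}. \<forall>n e. e edge_of closure (C i) \<longrightarrow> L2_norm (edge_measure e) (\<lambda>x. trace (C i) (w n) x - c i n) \<le> \<delta> i n"
proof -
  have "\<exists>c \<delta>. \<delta> \<longlonglongrightarrow> 0 \<and> (\<forall>n. L2_norm (lebesgue_on (C i)) (\<lambda>x. w n x - c n) \<le> \<delta> n) \<and>
      (\<forall>n e. e edge_of closure (C i) \<longrightarrow> L2_norm (edge_measure e) (\<lambda>x. trace (C i) (w n) x - c n) \<le> \<delta> n)"
    if i: "i \<in> {1..N}" for i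
  proof -
    interpret i: polygonal_cell "C i" by (rule cell[OF i])
    obtain K where K: "K \<ge> 0" "\<forall>v G g \<epsilon>. H1_with_gradient (C i) v G \<longrightarrow> has_trace (C i) v g \<longrightarrow> \<epsilon> > 0 \<longrightarrow>
      (\<exists>c. L2_norm (lebesgue_on (C i)) (\<lambda>x. v x - c) \<le> K * L2_norm (lebesgue_on (C i)) G + \<epsilon> \<and>
        (\<forall>e. e edge_of closure (C i) \<longrightarrow> L2_norm (edge_measure e) (\<lambda>x. g x - c) \<le> K * L2_norm (lebesgue_on (C i)) G + \<epsilon>))"
      by (rule i.nearly_constant)
    \<comment> \<open>The slack \<epsilon> of \<open>nearly_constant\<close> has to be positive;
      \<open>inverse (real (Suc n))\<close> is positive and vanishes in the limit.\<close>
    define \<delta> where "\<delta> n = K * L2_norm (lebesgue_on (C i)) (grad_w i n) + inverse (real (Suc n))" for n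
    have "\<exists>c. L2_norm (lebesgue_on (C i)) (\<lambda>x. w n x - c) \<le> \<delta> n \<and>
        (\<forall>e. e edge_of closure (C i) \<longrightarrow> L2_norm (edge_measure e) (\<lambda>x. trace (C i) (w n) x - c) \<le> \<delta> n)" for n
      unfolding \<delta>_def
      by (rule K(2)[rule_format, OF H1_w[OF i] admissible_has_trace[OF i admissible_w[OF i]]]) simp
    then have "\<exists>c. \<forall>n. L2_norm (lebesgue_on (C i)) (\<lambda>x. w n x - c n) \<le> \<delta> n \<and>
        (\<forall>e. e edge_of closure (C i) \<longrightarrow> L2_norm (edge_measure e) (\<lambda>x. trace (C i) (w n) x - c n) \<le> \<delta> n)"
      by (intro choice allI)
    moreover have "\<delta> \<longlonglongrightarrow> 0"
      unfolding \<delta>_def[abs_def]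
      using tendsto_add[OF tendsto_mult_left[OF grad_w_tendsto_0[OF i], of K] LIMSEQ_inverse_real_of_nat] by simp
    ultimately show ?thesis by blast
  qed
  then have "\<forall>i\<in>{1..N}. \<exists>c \<delta>. \<delta> \<longlonglongrightarrow> 0 \<and> (\<forall>n. L2_norm (lebesgue_on (C i)) (\<lambda>x. w n x - c n) \<le> \<delta> n) \<and>
      (\<forall>n e. e edge_of closure (C i) \<longrightarrow> L2_norm (edge_measure e) (\<lambda>x. trace (C i) (w n) x - c n) \<le> \<delta> n)"
    by blast
  from bchoice[OF this] obtain c where "\<forall>i\<in>{1..N}. \<exists>\<delta>. \<delta> \<longlonglongrightarrow> 0 \<and> (\<forall>n. L2_norm (lebesgue_on (C i)) (\<lambda>x. w n x - c i n) \<le> \<delta> n) \<and>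
      (\<forall>n e. e edge_of closure (C i) \<longrightarrow> L2_norm (edge_measure e) (\<lambda>x. trace (C i) (w n) x - c i n) \<le> \<delta> n)"
    by blast
  from bchoice[OF this] obtain \<delta> where "\<forall>i\<in>{1..N}. \<delta> i \<longlonglongrightarrow> 0 \<and> (\<forall>n. L2_norm (lebesgue_on (C i)) (\<lambda>x. w n x - c i n) \<le> \<delta> i n) \<and>
      (\<forall>n e. e edge_of closure (C i) \<longrightarrow> L2_norm (edge_measure e) (\<lambda>x. trace (C i) (w n) x - c i n) \<le> \<delta> i n)"
    by blast
  then show thesis by (intro that[of \<delta> c]) auto
qed

text \<open>The trace is zero on \<open>e\<close>, so its distance to the constant is
  \<open>\<bar>c n\<bar>\<close> times the square root of the length of \<open>e\<close>, and that
  length is positive.\<close>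

lemma constant_tendsto_0_boundary:
  assumes k: "k \<in> {1..N}" and e: "e edge_of closure (C k)" "e \<subseteq> frontier \<Omega>"
    and \<delta>: "\<delta> \<longlonglongrightarrow> 0" "\<And>n. L2_norm (edge_measure e) (\<lambda>x. trace (C k) (w n) x - c n) \<le> \<delta> n"
  shows "c \<longlonglongrightarrow> 0"
proof -
  interpret k: polygonal_cell "C k" by (rule cell[OF k])
  define m where "m = sqrt (measure (edge_measure e) UNIV)"
  have m: "m > 0" using k.measure_edge_pos[OF e(1)] by (simp add: m_def)
  note fin = k.finite_edge_measure_edge[OF e(1)]
  have "\<bar>c n\<bar> * m \<le> \<delta> n" for n
  proof -
    obtain g where g: "has_trace (C k) (w n) g"
      "\<And>e. e edge_of closure (C k) \<Longrightarrow> AE x in edge_measure e. x \<in> frontier (C k) \<inter> frontier \<Omega> \<longrightarrow> g x = 0"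
      using admissible_w[OF k, of n] unfolding admissible_def vanishes_on_def by blast
    have tr: "has_trace (C k) (w n) (trace (C k) (w n))" by (rule k.has_trace_trace[OF g(1)])
    have "AE x in edge_measure e. trace (C k) (w n) x - c n = - c n"
      using g(2)[OF e(1)] k.has_trace_unique[OF tr g(1) e(1)] k.AE_edge_in[OF e(1)]
    proof eventually_elim
      case (elim x)
      then show ?case using e(2) k.edge_subset_frontier[OF e(1)] by auto
    qed
    then have "L2_norm (edge_measure e) (\<lambda>x. trace (C k) (w n) x - c n) = L2_norm (edge_measure e) (\<lambda>x. - c n)"
      using L2_measurable[OF L2_diff[OF k.has_trace_L2[OF tr e(1)] L2_const[OF fin, of "c n"]]]
      by (intro L2_norm_cong_AE) auto
    also have "\<dots> = \<bar>c n\<bar> * m" by (simp add: L2_norm_const[OF fin] m_def)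
    finally show ?thesis using \<delta>(2)[of n] by simp
  qed
  then have le: "\<bar>c n\<bar> \<le> \<delta> n / m" for n using m by (simp add: pos_le_divide_eq)
  show ?thesis
  proof (rule Lim_null_comparison)
    show "(\<lambda>n. \<delta> n / m) \<longlonglongrightarrow> 0" using tendsto_divide[OF \<delta>(1) tendsto_const[of m]] m by simp
    show "\<forall>\<^sub>F n in sequentially. norm (c n) \<le> \<delta> n / m" using le by simp
  qed
qed

text \<open>Both sides of the transmission relation are tested with one bump on the interface. Up to
  vanishing errors the results are \<open>p * c (Suc n) * I\<close> and \<open>p * c' n * I\<close>,
  and division by the nonzero \<open>p * I\<close> compares the constants.\<close>

lemma constant_difference_tendsto_0:
  assumes i: "i \<in> {1..N}" and j: "j \<in> \<N> i"
    and \<delta>i: "\<delta> \<longlonglongrightarrow> 0" "\<And>n. L2_norm (\<sigma> i j) (\<lambda>x. trace (C i) (w n) x - c n) \<le> \<delta> n"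
    and \<delta>j: "\<delta>' \<longlonglongrightarrow> 0" "\<And>n. L2_norm (\<sigma> i j) (\<lambda>x. trace (C j) (w n) x - c' n) \<le> \<delta>' n"
  shows "(\<lambda>n. c (Suc n) - c' n) \<longlonglongrightarrow> 0"
proof -
  define e where "e = interface C i j"
  note e = neighbour_interface[OF i j, folded e_def]
  note j' = e(5)
  interpret i: polygonal_cell "C i" by (rule cell[OF i])
  interpret j: polygonal_cell "C j" by (rule cell[OF j'])
  \<comment> \<open>The bump has to avoid the other edges of both cells, because Green's formula is
    applied on either side.\<close>
  have "AE x in edge_measure e. x \<in> i.away_from_other_edges e \<inter> j.away_from_other_edges e"
    using i.AE_away[OF e(1)] j.AE_away[OF e(3)] by eventually_elim simp
  then obtain \<phi> \<gamma> where \<phi>: "test_function (i.away_from_other_edges e \<inter> j.away_from_other_edges e) \<phi> \<gamma>"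
    and I: "(LINT x|edge_measure e. \<phi> x) \<noteq> 0"
    using exists_bump_with_nonzero_integral[OF i.finite_edge_measure_edge[OF e(1)] i.measure_edge_pos[OF e(1)]
        open_Int[OF i.open_away j.open_away]] by blast
  have Ti: "test_function (i.away_from_other_edges e) \<phi> \<gamma>" and Tj: "test_function (j.away_from_other_edges e) \<phi> \<gamma>"
    using test_function_mono[OF \<phi>] by auto
  have L\<phi>: "L2 (edge_measure e) \<phi>"
    using i.L2_edge_C1[OF e(1)] \<phi> by (auto simp: test_function_def)
  define I where "I = (LINT x|edge_measure e. \<phi> x)"
  define err where "err k d n = L2_norm (lebesgue_on (C k)) (grad_w k n) * L2_norm (lebesgue_on (C k)) \<gamma>
      + \<eta> * L2_norm (lebesgue_on (C k)) (w n) * L2_norm (lebesgue_on (C k)) \<phi>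
      + \<bar>p\<bar> * (d n * L2_norm (edge_measure e) \<phi>)" for k n and d :: "nat \<Rightarrow> real"
  have err0: "err k d \<longlonglongrightarrow> 0" if "k \<in> {1..N}" "d \<longlonglongrightarrow> 0" for k d
  proof -
    have "err k d \<longlonglongrightarrow> 0 * L2_norm (lebesgue_on (C k)) \<gamma> + 0 * L2_norm (lebesgue_on (C k)) \<phi> + \<bar>p\<bar> * (0 * L2_norm (edge_measure e) \<phi>)"
      unfolding err_def[abs_def] by (intro tendsto_intros grad_w_tendsto_0 \<eta>_w_tendsto_0 that)
    then show ?thesis by simp
  qed
  have own: "\<bar>(LINT x|edge_measure e. robin_own N C p i (w n) x * \<phi> x) - p * c n * I\<bar> \<le> err i \<delta> n" for n
  proof -
    have "\<bar>(LINT x|edge_measure e. robin_own N C p i (w n) x * \<phi> x) - p * c n * I\<bar> \<le>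
      L2_norm (lebesgue_on (C i)) (grad_w i n) * L2_norm (lebesgue_on (C i)) \<gamma>
      + \<eta> * L2_norm (lebesgue_on (C i)) (w n) * L2_norm (lebesgue_on (C i)) \<phi>
      + \<bar>p\<bar> * (L2_norm (edge_measure e) (\<lambda>x. trace (C i) (w n) x - c n) * L2_norm (edge_measure e) \<phi>)"
      using i.robin_bump_estimate[OF solves_w[OF i] H1_w[OF i] \<eta> admissible_has_normal_derivative[OF i admissible_w[OF i]]
          admissible_has_trace[OF i admissible_w[OF i]] e(1,2) Ti, of 1 n p "c n"]
      by (simp add: robin_own_def I_def)
    also have "\<dots> \<le> err i \<delta> n"
      unfolding err_def using \<delta>i(2)[of n] by (intro add_left_mono mult_left_mono mult_right_mono) (auto simp: e_def)
    finally show ?thesis .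
  qed
  have nb: "\<bar>(LINT x|edge_measure e. robin_neighbour N C p j (w n) x * \<phi> x) - p * c' n * I\<bar> \<le> err j \<delta>' n" for n
  proof -
    have "\<bar>(LINT x|edge_measure e. robin_neighbour N C p j (w n) x * \<phi> x) - p * c' n * I\<bar> \<le>
      L2_norm (lebesgue_on (C j)) (grad_w j n) * L2_norm (lebesgue_on (C j)) \<gamma>
      + \<eta> * L2_norm (lebesgue_on (C j)) (w n) * L2_norm (lebesgue_on (C j)) \<phi>
      + \<bar>p\<bar> * (L2_norm (edge_measure e) (\<lambda>x. trace (C j) (w n) x - c' n) * L2_norm (edge_measure e) \<phi>)"
      using j.robin_bump_estimate[OF solves_w[OF j'] H1_w[OF j'] \<eta> admissible_has_normal_derivative[OF j' admissible_w[OF j']]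
          admissible_has_trace[OF j' admissible_w[OF j']] e(3,4) Tj, of "-1" n p "c' n"]
      by (simp add: robin_neighbour_def I_def)
    also have "\<dots> \<le> err j \<delta>' n"
      unfolding err_def using \<delta>j(2)[of n] by (intro add_left_mono mult_left_mono mult_right_mono) (auto simp: e_def)
    finally show ?thesis .
  qed
  \<comment> \<open>By \<open>robin_own_w\<close> the first trace is minus the jump of
    \<open>u (Suc (Suc n))\<close>, by \<open>robin_neighbour_w\<close> the second is minus the jump
    of \<open>uh (Suc n)\<close>. They differ by the jump of the coarse correction, whose norm tends
    to zero.\<close>
  have cpl: "\<bar>(LINT x|edge_measure e. robin_own N C p i (w (Suc n)) x * \<phi> x) - (LINT x|edge_measure e. robin_neighbour N C p j (w n) x * \<phi> x)\<bar>
      \<le> sqrt (J (U (Suc (Suc n)))) * L2_norm (edge_measure e) \<phi>" for n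
  proof -
    have LU: "L2 (edge_measure e) (jump p i j (U (Suc (Suc n))))"
      unfolding e_def by (rule L2_jump[OF i j admissible_Xd[OF U_in_Xd]])
    have Lo: "L2 (edge_measure e) (robin_own N C p i (w (Suc n)))" "L2 (edge_measure e) (robin_neighbour N C p j (w n))"
      unfolding e_def by (rule L2_robin_own[OF i j admissible_w[OF i]], rule L2_robin_neighbour[OF i j admissible_w[OF j']])
    have jl: "AE x in \<sigma> i j. jump p i j (u (Suc (Suc n))) x =
        jump p i j (uh (Suc n)) x + 1 * jump p i j (U (Suc (Suc n))) x"
      unfolding u_Suc[of "Suc n"] by (rule jump_linear[OF i j]) (auto intro: admissible_uh admissible_Xd U_in_Xd)
    have AE: "AE x in edge_measure e. robin_own N C p i (w (Suc n)) x - robin_neighbour N C p j (w n) x = - jump p i j (U (Suc (Suc n))) x"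
      using robin_own_w[OF i j, of "Suc n"] robin_neighbour_w[OF i j, of n] jl
      unfolding e_def by eventually_elim simp
    have "(LINT x|edge_measure e. robin_own N C p i (w (Suc n)) x * \<phi> x) - (LINT x|edge_measure e. robin_neighbour N C p j (w n) x * \<phi> x)
        = (LINT x|edge_measure e. (robin_own N C p i (w (Suc n)) x - robin_neighbour N C p j (w n) x) * \<phi> x)"
      using integrable_inner_L2[OF Lo(1) L\<phi>] integrable_inner_L2[OF Lo(2) L\<phi>] by (simp add: left_diff_distrib)
    also have "\<dots> = (LINT x|edge_measure e. - (jump p i j (U (Suc (Suc n))) x * \<phi> x))"
    proof (rule integral_cong_AE)
      show "AE x in edge_measure e. (robin_own N C p i (w (Suc n)) x - robin_neighbour N C p j (w n) x) * \<phi> x =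
          - (jump p i j (U (Suc (Suc n))) x * \<phi> x)"
        using AE by eventually_elim simp
    qed (intro borel_measurable_times borel_measurable_diff borel_measurable_uminus L2_measurable[OF Lo(1)]
          L2_measurable[OF Lo(2)] L2_measurable[OF L\<phi>] L2_measurable[OF LU])+
    finally have "\<bar>(LINT x|edge_measure e. robin_own N C p i (w (Suc n)) x * \<phi> x) - (LINT x|edge_measure e. robin_neighbour N C p j (w n) x * \<phi> x)\<bar>
        \<le> L2_norm (edge_measure e) (jump p i j (U (Suc (Suc n)))) * L2_norm (edge_measure e) \<phi>"
      using L2_Cauchy_Schwarz[OF LU L\<phi>] by simp
    also have "\<dots> \<le> sqrt (J (U (Suc (Suc n)))) * L2_norm (edge_measure e) \<phi>"
      using jump_le_robin_jump[OF i j] by (intro mult_right_mono) (auto simp: e_def)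
    finally show ?thesis .
  qed
  define r where "r n = (err i \<delta> (Suc n) + err j \<delta>' n + sqrt (J (U (Suc (Suc n)))) * L2_norm (edge_measure e) \<phi>) / \<bar>p * I\<bar>" for n
  have pI: "\<bar>p * I\<bar> > 0" using p I by (simp add: I_def)
  show ?thesis
  proof (rule Lim_null_comparison)
    have "r \<longlonglongrightarrow> (0 + 0 + sqrt 0 * L2_norm (edge_measure e) \<phi>) / \<bar>p * I\<bar>"
      unfolding r_def[abs_def] using pI
      by (intro tendsto_intros LIMSEQ_Suc[OF err0[OF i \<delta>i(1)]] err0[OF j' \<delta>j(1)] robin_jump_correction_tendsto_0) auto
    then show "r \<longlonglongrightarrow> 0" by simp
    have "\<bar>c (Suc n) - c' n\<bar> \<le> r n" for n
    proof -
      have "\<bar>p * c (Suc n) * I - p * c' n * I\<bar> \<le> err i \<delta> (Suc n) + err j \<delta>' n + sqrt (J (U (Suc (Suc n)))) * L2_norm (edge_measure e) \<phi>"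
        using own[of "Suc n"] nb[of n] cpl[of n] by linarith
      also have "p * c (Suc n) * I - p * c' n * I = (c (Suc n) - c' n) * (p * I)" by (simp add: algebra_simps)
      finally show ?thesis using pI by (simp add: r_def pos_le_divide_eq abs_mult)
    qed
    then show "\<forall>\<^sub>F n in sequentially. norm (c (Suc n) - c' n) \<le> r n" by simp
  qed
qed

lemma w_tendsto_0:
  assumes i: "i \<in> {1..N}"
  shows "(\<lambda>n. L2_norm (lebesgue_on (C i)) (w n)) \<longlonglongrightarrow> 0"
proof -
  obtain c \<delta> where \<delta>: "\<forall>i\<in>{1..N}. \<delta> i \<longlonglongrightarrow> 0"
    and cw: "\<forall>i\<in>{1..N}. \<forall>n. L2_norm (lebesgue_on (C i)) (\<lambda>x. w n x - c i n) \<le> \<delta> i n"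
    and ct: "\<forall>i\<in>{1..N}. \<forall>n e. e edge_of closure (C i) \<longrightarrow> L2_norm (edge_measure e) (\<lambda>x. trace (C i) (w n) x - c i n) \<le> \<delta> i n"
    by (rule nearly_constant_w)
  obtain k e where k: "(i, k) \<in> adjacency\<^sup>*" "k \<in> {1..N}" "e edge_of closure (C k)" "e \<subseteq> frontier \<Omega>"
    using reachable_boundary_edge[OF i] by blast
  \<comment> \<open>The induction runs backwards along the path, from the boundary cell
    \<open>k\<close> to \<open>i\<close>. Each edge of the path shifts the index by one, which does
    not affect the limit.\<close>
  have "c i \<longlonglongrightarrow> 0" using k(1)
  proof (induction rule: converse_rtrancl_induct)
    case base
    show ?case
      by (rule constant_tendsto_0_boundary[OF k(2-4), where \<delta> = "\<delta> k"]) (use \<delta> ct k in auto)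
  next
    case (step a b)
    then have a: "a \<in> {1..N}" and b: "b \<in> \<N> a" by (auto simp: adjacency_def)
    note e = neighbour_interface[OF a b]
    have "(\<lambda>n. c a (Suc n) - c b n) \<longlonglongrightarrow> 0"
      by (rule constant_difference_tendsto_0[OF a b, where \<delta> = "\<delta> a" and \<delta>' = "\<delta> b"]) (use \<delta> ct a e in auto)
    from tendsto_add[OF this step.IH] have "(\<lambda>n. c a (Suc n)) \<longlonglongrightarrow> 0" by simp
    then show ?case by (rule LIMSEQ_imp_Suc)
  qed
  interpret i: polygonal_cell "C i" by (rule cell[OF i])
  note fin = i.finite_measure_cell
  have Lw: "L2 (lebesgue_on (C i)) (w n)" for n using H1_w[OF i] by (simp add: H1_with_gradient_def)
  show ?thesis
  proof (rule Lim_null_comparison)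
    show "(\<lambda>n. \<bar>c i n\<bar> * sqrt (measure (lebesgue_on (C i)) (space (lebesgue_on (C i)))) + \<delta> i n) \<longlonglongrightarrow> 0"
      using tendsto_add[OF tendsto_mult_right[OF tendsto_rabs[OF \<open>c i \<longlonglongrightarrow> 0\<close>]] bspec[OF \<delta> i]] by simp
    have "L2_norm (lebesgue_on (C i)) (w n) \<le> \<bar>c i n\<bar> * sqrt (measure (lebesgue_on (C i)) (space (lebesgue_on (C i)))) + \<delta> i n" for n
    proof -
      have "L2_norm (lebesgue_on (C i)) (\<lambda>x. w n x - c i n) \<le> \<delta> i n" using cw i by blast
      then show ?thesis
        using L2_norm_le_add_diff[OF Lw L2_const[OF fin, of "c i n"], of n]
        unfolding L2_norm_const[OF fin] by linarith
    qed
    then show "\<forall>\<^sub>F n in sequentially. norm (L2_norm (lebesgue_on (C i)) (w n))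
      \<le> \<bar>c i n\<bar> * sqrt (measure (lebesgue_on (C i)) (space (lebesgue_on (C i)))) + \<delta> i n" by simp
  qed
qed

end

theorem proposition4p1:
  fixes \<Omega> :: "(real^2) set" and N :: nat and C :: "nat \<Rightarrow> (real^2) set"
    and \<eta> p q :: real and f :: "real^2 \<Rightarrow> real" and Xd :: "(real^2 \<Rightarrow> real) set"
    and u uh U :: "nat \<Rightarrow> real^2 \<Rightarrow> real"
  assumes "polygonal_domain \<Omega>" and "coarse_mesh \<Omega> N C"
    and "\<eta> \<ge> 0" and "L2 (lebesgue_on \<Omega>) f"
    and "coarse_space \<eta> \<Omega> N C Xd"
    and "p > 0" and "q > 0"
    and "DCS_RJMin \<eta> \<Omega> N C f p q Xd u uh U"
    and "q = p"
  shows "\<forall>i\<in>{1..N}. (\<lambda>n. L2_norm (lebesgue_on (C i)) (\<lambda>x. uh n x - u n x)) \<longlonglongrightarrow> 0"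
proof
  fix i assume i: "i \<in> {1..N}"
  interpret DCS_RJMin_run \<Omega> N C \<eta> p f Xd u uh U
    using assms by unfold_locales auto
  \<comment> \<open>\<open>w\<close> starts at step 1; the term for \<open>n = 0\<close> does not
    affect the limit.\<close>
  have "(\<lambda>n. L2_norm (lebesgue_on (C i)) (\<lambda>x. uh (Suc n) x - u (Suc n) x)) \<longlonglongrightarrow> 0"
    using w_tendsto_0[OF i] by (simp add: w_def)
  then show "(\<lambda>n. L2_norm (lebesgue_on (C i)) (\<lambda>x. uh n x - u n x)) \<longlonglongrightarrow> 0"
    by (rule LIMSEQ_imp_Suc)
qed

end
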